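(* Let $p>3$, and let $u\in H(T_{\max})$ be a solution of the Kirchhoff problem (K) of the context with $u_0\in H^2(\Omega)\cap H_0^1(\Omega)$, $u_1\in H_0^1(\Omega)$. Assume that one of the following holds. **Case (a):** $\lambda\le b\lambda_1$, and (a1) $E(0)<0$, or (a2) $E(0)=0$ and $\int_\Omega u_0u_1\,dx>0$, or (a3) $3<p<5$, $0<E(0)<d_p$, $\int_\Omega u_0u_1\,dx>0$ and $u_0\in W_p^-$, or (a4) $E(0)>0$, $\int_\Omega u_0u_1\,dx>0$ and $\|u_0\|_2^4>\dfrac{4(p+1)}{(p-3)a\lambda_1^2}E(0)$. **Case (b):** $\lambda>b\lambda_1$, and (b1) $E(0)<-h_0/(2p+2)$, or (b2) $E(0)=-h_0/(2p+2)$ and $\int_\Omega u_0u_1\,dx>0$, where $$h_0=\frac{(p-1)^2(\lambda-b\lambda_1)^2}{2(p-3)a\lambda_1^2}.$$ Then the maximal existence time $T_{\max}$ of $u$ is finite. **Vacuum region:** If $3<p<5$ and $\lambda\le b\lambda_1$, then $$\|\nabla u(t)\|_2\ge\left[\frac{p+1}4\,a\,S_{p+1}^{(p+1)/2}\right]^{1/(p-3)}\qquad\text{for all } t\in[0,T_{\max}),$$ provided that $E(0)\le0$ and $\|\nabla u_0\|_2>0$.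
   Context: $\Omega\subset\mathbb{R}^3$ is a bounded open set with smooth boundary; $a,b>0$, $\lambda\in\mathbb{R}$. $\|\cdot\|_q$ is the $L^q(\Omega)$ norm. Problem (K): $$u_{tt}-\Big(a\int_\Omega|\nabla u|^2dx+b\Big)\Delta u=\lambda u+|u|^{p-1}u\ (t>0,\ x\in\Omega),\quad u(0,x)=u_0(x),\ u_t(0,x)=u_1(x)\ (x\in\Omega),\quad u=0\ (t\ge0,\ x\in\partial\Omega).$$ $H(T)=C([0,T);H_0^1(\Omega)\cap H^2(\Omega))\cap C^1([0,T);H_0^1(\Omega))\cap C^2([0,T);L^2(\Omega))$. For $u_0\in H^2(\Omega)\cap H_0^1(\Omega)$, $u_1\in H_0^1(\Omega)$, problem (K) has a unique solution in $H(T)$ for some $T>0$ (known local existence result); $T_{\max}\in(0,\infty]$ is its maximal existence time. If $T_{\max}<\infty$ then $\lim_{t\to T_{\max}^-}[\|\Delta u(t)\|_2+\|\nabla u_t(t)\|_2]=+\infty$ (part of the same known result). $u(t)$ denotes $u(t,\cdot)$. $\lambda_1>0$ is the principal Dirichlet eigenvalue of $-\Delta$ on $\Omega$. $S_q=\inf_{u\in H_0^1(\Omega)\setminus\{0\}}\|\nabla u\|_2^2/\|u\|_q^2$ for $1<q\le6$. $$J(u)=\frac a4\|\nabla u\|_2^4+\frac b2\|\nabla u\|_2^2-\frac\lambda2\|u\|_2^2-\frac1{p+1}\|u\|_{p+1}^{p+1},\qquad I(u)=a\|\nabla u\|_2^4+b\|\nabla u\|_2^2-\lambda\|u\|_2^2-\|u\|_{p+1}^{p+1},$$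 $E(0)=\frac12\|u_1\|_2^2+J(u_0)$. For $3<p<5$: $N_p=\{u\in H_0^1(\Omega)\setminus\{0\}: I(u)=0\}$, $N_p^-=\{u\in H_0^1(\Omega): I(u)<0\}$, $d_p=\inf_{N_p}J$, $W_p^-=\{u\in N_p^-:J(u)<d_p\}$. *)

theory Defs
  imports "HOL-Analysis.Analysis"
begin

section \<open>Smooth functions and domains\<close>

abbreviation partial_deriv :: "'a::euclidean_space \<Rightarrow> ('a \<Rightarrow> real) \<Rightarrow> 'a \<Rightarrow> real"
  where "partial_deriv i f x \<equiv> frechet_derivative f (at x) i"

text \<open>Only meaningful for open \<open>S\<close>.\<close>

primrec Ck_on :: "nat \<Rightarrow> ('a::euclidean_space \<Rightarrow> real) \<Rightarrow> 'a set \<Rightarrow> bool" where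
  "Ck_on 0 f S \<longleftrightarrow> continuous_on S f"
| "Ck_on (Suc k) f S \<longleftrightarrow> f differentiable_on S \<and> (\<forall>i\<in>Basis. Ck_on k (partial_deriv i f) S)"

definition smooth_on :: "('a::euclidean_space \<Rightarrow> real) \<Rightarrow> 'a set \<Rightarrow> bool"
  where "smooth_on f S \<longleftrightarrow> (\<forall>k. Ck_on k f S)"

text \<open>Near each boundary point the open set is the strict sublevel set of a smooth function
  without critical points, i.e. it lies locally on one side of a smooth hypersurface.\<close>

definition smooth_boundary :: "'a::euclidean_space set \<Rightarrow> bool"
  where "smooth_boundary \<Omega> \<longleftrightarrow>
    (\<forall>x0\<in>frontier \<Omega>. \<exists>U \<rho>. open U \<and> x0 \<in> U \<and> smooth_on \<rho> U \<and>
       (\<forall>x\<in>U. \<exists>i\<in>Basis. partial_deriv i \<rho> x \<noteq> 0) \<and> \<Omega> \<inter> U = {x \<in> U. \<rho> x < 0})"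

definition test_function :: "'a::euclidean_space set \<Rightarrow> ('a \<Rightarrow> real) \<Rightarrow> bool"
  where "test_function \<Omega> \<phi> \<longleftrightarrow>
    smooth_on \<phi> UNIV \<and> (\<exists>K. compact K \<and> K \<subseteq> \<Omega> \<and> (\<forall>x. x \<notin> K \<longrightarrow> \<phi> x = 0))"

section \<open>Lebesgue and Sobolev spaces\<close>

text \<open>Elements of the spaces are represented by functions, not by classes of functions;
  only their values on \<open>\<Omega>\<close> up to null sets matter.\<close>

definition Lnorm :: "'a::euclidean_space set \<Rightarrow> real \<Rightarrow> ('a \<Rightarrow> 'b::real_normed_vector) \<Rightarrow> real"
  where "Lnorm \<Omega> q f = (LINT x|lebesgue_on \<Omega>. norm (f x) powr q) powr (1 / q)"

definition L2_space :: "'a::euclidean_space set \<Rightarrow> ('a \<Rightarrow> real) set"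
  where "L2_space \<Omega> =
    {u \<in> borel_measurable (lebesgue_on \<Omega>). integrable (lebesgue_on \<Omega>) (\<lambda>x. (u x)\<^sup>2)}"

definition zero_on :: "'a::euclidean_space set \<Rightarrow> ('a \<Rightarrow> real) \<Rightarrow> bool"
  where "zero_on \<Omega> u \<longleftrightarrow> (AE x in lebesgue_on \<Omega>. u x = 0)"

definition locally_integrable :: "'a::euclidean_space set \<Rightarrow> ('a \<Rightarrow> real) \<Rightarrow> bool"
  where "locally_integrable \<Omega> u \<longleftrightarrow> (\<forall>K. compact K \<and> K \<subseteq> \<Omega> \<longrightarrow> integrable (lebesgue_on K) u)"

definition has_weak_deriv ::
    "'a::euclidean_space set \<Rightarrow> 'a \<Rightarrow> ('a \<Rightarrow> real) \<Rightarrow> ('a \<Rightarrow> real) \<Rightarrow> bool"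
  where "has_weak_deriv \<Omega> i u v \<longleftrightarrow>
    locally_integrable \<Omega> u \<and> locally_integrable \<Omega> v \<and>
    (\<forall>\<phi>. test_function \<Omega> \<phi> \<longrightarrow>
      (LINT x|lebesgue_on \<Omega>. u x * partial_deriv i \<phi> x) = - (LINT x|lebesgue_on \<Omega>. v x * \<phi> x))"

text \<open>The weak derivative is unique up to null sets, so the choice is immaterial; it is arbitrary
  if there is none.\<close>

definition weak_deriv :: "'a::euclidean_space set \<Rightarrow> 'a \<Rightarrow> ('a \<Rightarrow> real) \<Rightarrow> 'a \<Rightarrow> real"
  where "weak_deriv \<Omega> i u = (SOME v. has_weak_deriv \<Omega> i u v)"

definition weak_grad :: "'a::euclidean_space set \<Rightarrow> ('a \<Rightarrow> real) \<Rightarrow> 'a \<Rightarrow> 'a"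
  where "weak_grad \<Omega> u x = (\<Sum>i\<in>Basis. weak_deriv \<Omega> i u x *\<^sub>R i)"

definition weak_laplacian :: "'a::euclidean_space set \<Rightarrow> ('a \<Rightarrow> real) \<Rightarrow> 'a \<Rightarrow> real"
  where "weak_laplacian \<Omega> u x = (\<Sum>i\<in>Basis. weak_deriv \<Omega> i (weak_deriv \<Omega> i u) x)"

definition H1_space :: "'a::euclidean_space set \<Rightarrow> ('a \<Rightarrow> real) set"
  where "H1_space \<Omega> =
    {u \<in> L2_space \<Omega>. \<forall>i\<in>Basis. \<exists>v\<in>L2_space \<Omega>. has_weak_deriv \<Omega> i u v}"

definition H2_space :: "'a::euclidean_space set \<Rightarrow> ('a \<Rightarrow> real) set"
  where "H2_space \<Omega> = {u \<in> H1_space \<Omega>. \<forall>i\<in>Basis. weak_deriv \<Omega> i u \<in> H1_space \<Omega>}"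

definition H1_norm :: "'a::euclidean_space set \<Rightarrow> ('a \<Rightarrow> real) \<Rightarrow> real"
  where "H1_norm \<Omega> u = sqrt ((Lnorm \<Omega> 2 u)\<^sup>2 + (\<Sum>i\<in>Basis. (Lnorm \<Omega> 2 (weak_deriv \<Omega> i u))\<^sup>2))"

definition H2_norm :: "'a::euclidean_space set \<Rightarrow> ('a \<Rightarrow> real) \<Rightarrow> real"
  where "H2_norm \<Omega> u = sqrt ((Lnorm \<Omega> 2 u)\<^sup>2 + (\<Sum>i\<in>Basis. (Lnorm \<Omega> 2 (weak_deriv \<Omega> i u))\<^sup>2)
    + (\<Sum>i\<in>Basis. \<Sum>j\<in>Basis. (Lnorm \<Omega> 2 (weak_deriv \<Omega> j (weak_deriv \<Omega> i u)))\<^sup>2))"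

definition H01_space :: "'a::euclidean_space set \<Rightarrow> ('a \<Rightarrow> real) set"
  where "H01_space \<Omega> = {u \<in> H1_space \<Omega>.
    \<exists>\<phi> :: nat \<Rightarrow> 'a \<Rightarrow> real. (\<forall>n. test_function \<Omega> (\<phi> n)) \<and>
      (\<lambda>n. H1_norm \<Omega> (\<lambda>x. \<phi> n x - u x)) \<longlonglongrightarrow> 0}"

section \<open>Principal eigenvalue and Sobolev constants\<close>

definition dirichlet_eigenvalue :: "'a::euclidean_space set \<Rightarrow> real \<Rightarrow> bool"
  where "dirichlet_eigenvalue \<Omega> \<mu> \<longleftrightarrow>
    (\<exists>e\<in>H01_space \<Omega>. \<not> zero_on \<Omega> e \<and>
      (\<forall>v\<in>H01_space \<Omega>. (LINT x|lebesgue_on \<Omega>. weak_grad \<Omega> e x \<bullet> weak_grad \<Omega> v x)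
         = \<mu> * (LINT x|lebesgue_on \<Omega>. e x * v x)))"

definition principal_eigenvalue :: "'a::euclidean_space set \<Rightarrow> real"
  where "principal_eigenvalue \<Omega> = (LEAST \<mu>. dirichlet_eigenvalue \<Omega> \<mu>)"

definition sobolev_const :: "'a::euclidean_space set \<Rightarrow> real \<Rightarrow> real"
  where "sobolev_const \<Omega> q =
    (INF u\<in>{u \<in> H01_space \<Omega>. \<not> zero_on \<Omega> u}. (Lnorm \<Omega> 2 (weak_grad \<Omega> u))\<^sup>2 / (Lnorm \<Omega> q u)\<^sup>2)"

section \<open>Functions of time with values in a function space\<close>

text \<open>\<open>X\<close> is the space and \<open>N\<close> its norm. At an endpoint belonging to the time interval \<open>J\<close> the
  derivative is one-sided. Membership of the values of \<open>v\<close> in \<open>X\<close> is required because \<open>N\<close> is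
  meaningless outside \<open>X\<close>.\<close>

definition has_time_deriv ::
    "('a \<Rightarrow> real) set \<Rightarrow> (('a \<Rightarrow> real) \<Rightarrow> real) \<Rightarrow> real set \<Rightarrow>
     (real \<Rightarrow> 'a \<Rightarrow> real) \<Rightarrow> (real \<Rightarrow> 'a \<Rightarrow> real) \<Rightarrow> bool"
  where "has_time_deriv X N J u v \<longleftrightarrow>
    (\<forall>t\<in>J. u t \<in> X \<and> v t \<in> X \<and>
      ((\<lambda>s. N (\<lambda>x. (u s x - u t x) / (s - t) - v t x)) \<longlongrightarrow> 0) (at t within J))"

primrec Ck_time ::
    "nat \<Rightarrow> ('a \<Rightarrow> real) set \<Rightarrow> (('a \<Rightarrow> real) \<Rightarrow> real) \<Rightarrow> real set \<Rightarrow> (real \<Rightarrow> 'a \<Rightarrow> real) \<Rightarrow> bool" where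
  "Ck_time 0 X N J u \<longleftrightarrow>
    (\<forall>t\<in>J. u t \<in> X \<and> ((\<lambda>s. N (\<lambda>x. u s x - u t x)) \<longlongrightarrow> 0) (at t within J))"
| "Ck_time (Suc k) X N J u \<longleftrightarrow> (\<exists>v. has_time_deriv X N J u v \<and> Ck_time k X N J v)"

definition time_interval :: "ereal \<Rightarrow> real set"
  where "time_interval T = {t. 0 \<le> t \<and> ereal t < T}"

definition H_class :: "'a::euclidean_space set \<Rightarrow> ereal \<Rightarrow> (real \<Rightarrow> 'a \<Rightarrow> real) set"
  where "H_class \<Omega> T = {u.
    Ck_time 0 (H01_space \<Omega> \<inter> H2_space \<Omega>) (H2_norm \<Omega>) (time_interval T) u \<and>
    Ck_time 1 (H01_space \<Omega>) (H1_norm \<Omega>) (time_interval T) u \<and>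
    Ck_time 2 (L2_space \<Omega>) (Lnorm \<Omega> 2) (time_interval T) u}"

section \<open>The Kirchhoff problem\<close>

text \<open>The boundary condition is part of \<open>H_class\<close>, whose members take values in \<open>H01_space\<close>.\<close>

definition kirchhoff_solution ::
    "'a::euclidean_space set \<Rightarrow> real \<Rightarrow> real \<Rightarrow> real \<Rightarrow> real \<Rightarrow> ('a \<Rightarrow> real) \<Rightarrow> ('a \<Rightarrow> real) \<Rightarrow>
     ereal \<Rightarrow> (real \<Rightarrow> 'a \<Rightarrow> real) \<Rightarrow> bool"
  where "kirchhoff_solution \<Omega> a b lam p u0 u1 T u \<longleftrightarrow>
    0 < T \<and> u \<in> H_class \<Omega> T \<and>
    (\<exists>ut utt.
      has_time_deriv (L2_space \<Omega>) (Lnorm \<Omega> 2) (time_interval T) u ut \<and>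
      has_time_deriv (L2_space \<Omega>) (Lnorm \<Omega> 2) (time_interval T) ut utt \<and>
      (\<forall>t\<in>time_interval T. 0 < t \<longrightarrow>
        (AE x in lebesgue_on \<Omega>.
          utt t x - (a * (LINT y|lebesgue_on \<Omega>. (norm (weak_grad \<Omega> (u t) y))\<^sup>2) + b)
              * weak_laplacian \<Omega> (u t) x
            = lam * u t x + \<bar>u t x\<bar> powr (p - 1) * u t x)) \<and>
      (AE x in lebesgue_on \<Omega>. u 0 x = u0 x) \<and>
      (AE x in lebesgue_on \<Omega>. ut 0 x = u1 x))"

definition kirchhoff_Tmax ::
    "'a::euclidean_space set \<Rightarrow> real \<Rightarrow> real \<Rightarrow> real \<Rightarrow> real \<Rightarrow> ('a \<Rightarrow> real) \<Rightarrow> ('a \<Rightarrow> real) \<Rightarrow> ereal"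
  where "kirchhoff_Tmax \<Omega> a b lam p u0 u1 =
    Sup {T. \<exists>u. kirchhoff_solution \<Omega> a b lam p u0 u1 T u}"

definition kirchhoff_J ::
    "'a::euclidean_space set \<Rightarrow> real \<Rightarrow> real \<Rightarrow> real \<Rightarrow> real \<Rightarrow> ('a \<Rightarrow> real) \<Rightarrow> real"
  where "kirchhoff_J \<Omega> a b lam p u =
    a / 4 * (Lnorm \<Omega> 2 (weak_grad \<Omega> u)) ^ 4 + b / 2 * (Lnorm \<Omega> 2 (weak_grad \<Omega> u))\<^sup>2
    - lam / 2 * (Lnorm \<Omega> 2 u)\<^sup>2 - 1 / (p + 1) * Lnorm \<Omega> (p + 1) u powr (p + 1)"

definition kirchhoff_I ::
    "'a::euclidean_space set \<Rightarrow> real \<Rightarrow> real \<Rightarrow> real \<Rightarrow> real \<Rightarrow> ('a \<Rightarrow> real) \<Rightarrow> real"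
  where "kirchhoff_I \<Omega> a b lam p u =
    a * (Lnorm \<Omega> 2 (weak_grad \<Omega> u)) ^ 4 + b * (Lnorm \<Omega> 2 (weak_grad \<Omega> u))\<^sup>2
    - lam * (Lnorm \<Omega> 2 u)\<^sup>2 - Lnorm \<Omega> (p + 1) u powr (p + 1)"

definition kirchhoff_E0 ::
    "'a::euclidean_space set \<Rightarrow> real \<Rightarrow> real \<Rightarrow> real \<Rightarrow> real \<Rightarrow> ('a \<Rightarrow> real) \<Rightarrow> ('a \<Rightarrow> real) \<Rightarrow> real"
  where "kirchhoff_E0 \<Omega> a b lam p u0 u1 = 1 / 2 * (Lnorm \<Omega> 2 u1)\<^sup>2 + kirchhoff_J \<Omega> a b lam p u0"

definition nehari ::
    "'a::euclidean_space set \<Rightarrow> real \<Rightarrow> real \<Rightarrow> real \<Rightarrow> real \<Rightarrow> ('a \<Rightarrow> real) set"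
  where "nehari \<Omega> a b lam p =
    {u \<in> H01_space \<Omega>. \<not> zero_on \<Omega> u \<and> kirchhoff_I \<Omega> a b lam p u = 0}"

definition nehari_minus ::
    "'a::euclidean_space set \<Rightarrow> real \<Rightarrow> real \<Rightarrow> real \<Rightarrow> real \<Rightarrow> ('a \<Rightarrow> real) set"
  where "nehari_minus \<Omega> a b lam p = {u \<in> H01_space \<Omega>. kirchhoff_I \<Omega> a b lam p u < 0}"

definition well_depth ::
    "'a::euclidean_space set \<Rightarrow> real \<Rightarrow> real \<Rightarrow> real \<Rightarrow> real \<Rightarrow> real"
  where "well_depth \<Omega> a b lam p = (INF u\<in>nehari \<Omega> a b lam p. kirchhoff_J \<Omega> a b lam p u)"

definition W_minus ::
    "'a::euclidean_space set \<Rightarrow> real \<Rightarrow> real \<Rightarrow> real \<Rightarrow> real \<Rightarrow> ('a \<Rightarrow> real) set"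
  where "W_minus \<Omega> a b lam p =
    {u \<in> nehari_minus \<Omega> a b lam p. kirchhoff_J \<Omega> a b lam p u < well_depth \<Omega> a b lam p}"

end

theory Submission
  imports Defs "HOL-Complex_Analysis.Great_Picard"
begin

text \<open>Suppose \<open>u\<close> is global and put \<open>\<phi>(t) = \<parallel>u(t)\<parallel>\<^sub>2\<^sup>2\<close>. Testing the
  equation with \<open>u\<close> and \<open>u\<^sub>t\<close> gives \<open>\<phi>'' = 2 (\<parallel>u\<^sub>t\<parallel>\<^sub>2\<^sup>2 - I(u))\<close> and conservation
  of energy, hence
  \<open>\<phi>'' = (p + 3) \<parallel>u\<^sub>t\<parallel>\<^sub>2\<^sup>2 + (p - 3) a / 2 \<parallel>\<nabla>u\<parallel>\<^sub>2\<^sup>4 + (p - 1) (b \<parallel>\<nabla>u\<parallel>\<^sub>2\<^sup>2 - \<lambda> \<parallel>u\<parallel>\<^sub>2\<^sup>2) - 2 (p + 1) E(0)\<close>.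
  In each case the last three terms are bounded below by a constant that is positive, or zero with
  \<open>\<phi>'(0) > 0\<close>, and then \<open>\<phi> powr (- (p - 1) / 4)\<close> is eventually positive, decreasing and concave,
  which is impossible. In case (a3) the bound comes from the point of the Nehari manifold on the ray
  through \<open>u(t)\<close>, and \<open>u(t)\<close> cannot leave the region \<open>I < 0\<close> through \<open>0\<close> because \<open>\<phi>\<close> increases.
  The vacuum region follows from \<open>J(u(t)) \<le> 0\<close>, the definition of \<open>S\<^sub>p\<^sub>+\<^sub>1\<close> and continuity of
  \<open>\<parallel>\<nabla>u(t)\<parallel>\<^sub>2\<close>.

  The Poincare inequality with constant \<open>\<lambda>\<^sub>1\<close> requires that the infimum of the Rayleigh quotient
  is attained, which is Rellich's theorem. No Sobolev embedding is needed: the equation itself puts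
  \<open>\<bar>u\<bar>\<^sup>p\<close> into \<open>L\<^sup>2\<close>, continuously in time.\<close>

section \<open>The Hilbert space structure of \<open>L2_space\<close>\<close>

text \<open>With \<phi> = ||u||^2, 2 g = \<phi>' and K = ||u_t||^2, Cauchy-Schwarz gives g^2 \<le>
  \<phi> K; together with \<phi>'' \<ge> (p + 3) K this is \<phi> \<phi>'' \<ge> (p + 3)/4
  \<phi>'^2, and the exponent is 1 - (p + 3)/4 = -(p - 1)/4. The cases differ in how P - (p + 1)
  E(0) is bounded below, where P = (p - 3) a \<psi>^2/4 + (p - 1) (b \<psi> - \<lambda> \<phi>)/2
  and \<psi> = ||grad u||^2. For \<lambda> \<le> b \<lambda>_1 both parts of P are nonnegative; (a4)
  says that (p - 3) a \<lambda>_1^2 \<phi>(0)^2/4, a lower bound of P as long as \<phi> \<ge>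
  \<phi>(0), exceeds (p + 1) E(0). For \<lambda> > b \<lambda>_1 the negative part is at most linear
  in \<psi>, and the resulting quadratic in \<psi> has minimum -h_0/2. The analysis is shaped by the
  encoding: functions stand for classes, so derivatives are linear and unique only almost
  everywhere, and the integral of a non-integrable function is 0, so that membership in L^2 has to
  accompany every statement about norms.\<close>

definition L2_inner :: "'a::euclidean_space set \<Rightarrow> ('a \<Rightarrow> real) \<Rightarrow> ('a \<Rightarrow> real) \<Rightarrow> real"
  where "L2_inner \<Omega> f g = (LINT x|lebesgue_on \<Omega>. f x * g x)"

text \<open>Kept for vector values, because it is applied to \<open>weak_grad\<close> as well as to
  scalar functions.\<close>

lemma Lnorm_2_eq: "Lnorm \<Omega> 2 f = sqrt (LINT x|lebesgue_on \<Omega>. (norm (f x))\<^sup>2)"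
proof -
  have "norm (f x) powr 2 = (norm (f x))\<^sup>2" for x
    by (cases "norm (f x) = 0") (auto simp: powr_numeral)
  then show ?thesis
    unfolding Lnorm_def by (simp add: powr_half_sqrt)
qed

lemma Lnorm_2_real: "Lnorm \<Omega> 2 (f :: 'a::euclidean_space \<Rightarrow> real) = sqrt (L2_inner \<Omega> f f)"
  by (simp add: Lnorm_2_eq L2_inner_def power2_eq_square)

lemma Lnorm_nonneg [simp]: "0 \<le> Lnorm \<Omega> q f"
  by (simp add: Lnorm_def)

lemma L2_inner_self_nonneg [simp]: "0 \<le> L2_inner \<Omega> f f"
  by (simp add: L2_inner_def)

lemma Lnorm_2_sq: "(Lnorm \<Omega> 2 (f :: 'a::euclidean_space \<Rightarrow> real))\<^sup>2 = L2_inner \<Omega> f f"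
  by (simp add: Lnorm_2_real)

lemma L2_measurable [measurable_dest]: "f \<in> L2_space \<Omega> \<Longrightarrow> f \<in> borel_measurable (lebesgue_on \<Omega>)"
  by (simp add: L2_space_def)

lemma L2_square_integrable: "f \<in> L2_space \<Omega> \<Longrightarrow> integrable (lebesgue_on \<Omega>) (\<lambda>x. (f x)\<^sup>2)"
  by (simp add: L2_space_def)

lemma L2_mult_integrable:
  assumes "f \<in> L2_space \<Omega>" "g \<in> L2_space \<Omega>"
  shows "integrable (lebesgue_on \<Omega>) (\<lambda>x. f x * g x)"
proof (rule Bochner_Integration.integrable_bound)
  show "integrable (lebesgue_on \<Omega>) (\<lambda>x. (f x)\<^sup>2 + (g x)\<^sup>2)"
    using assms by (intro Bochner_Integration.integrable_add L2_square_integrable)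
  show "(\<lambda>x. f x * g x) \<in> borel_measurable (lebesgue_on \<Omega>)"
    using assms by measurable
  have "norm (f x * g x) \<le> norm ((f x)\<^sup>2 + (g x)\<^sup>2)" for x
  proof -
    have "2 * (\<bar>f x\<bar> * \<bar>g x\<bar>) \<le> \<bar>f x\<bar>\<^sup>2 + \<bar>g x\<bar>\<^sup>2"
      using sum_squares_bound[of "\<bar>f x\<bar>" "\<bar>g x\<bar>"] by simp
    moreover have "0 \<le> \<bar>f x\<bar> * \<bar>g x\<bar>" by simp
    moreover have "norm ((f x)\<^sup>2 + (g x)\<^sup>2) = (f x)\<^sup>2 + (g x)\<^sup>2" by simp
    ultimately show ?thesis unfolding real_norm_def abs_mult power2_abs by linarith
  qed
  then show "AE x in lebesgue_on \<Omega>. norm (f x * g x) \<le> norm ((f x)\<^sup>2 + (g x)\<^sup>2)"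
    by simp
qed

lemma L2_zero [simp]: "(\<lambda>x. 0) \<in> L2_space \<Omega>"
  by (simp add: L2_space_def)

lemma L2_scale [intro]: "f \<in> L2_space \<Omega> \<Longrightarrow> (\<lambda>x. c * f x) \<in> L2_space \<Omega>"
  by (auto simp: L2_space_def power_mult_distrib)

lemma L2_divide [intro]: "f \<in> L2_space \<Omega> \<Longrightarrow> (\<lambda>x. f x / c) \<in> L2_space \<Omega>"
  using L2_scale[of f \<Omega> "1 / c"] by simp

lemma L2_minus [intro]: "f \<in> L2_space \<Omega> \<Longrightarrow> (\<lambda>x. - f x) \<in> L2_space \<Omega>"
  using L2_scale[of f \<Omega> "-1"] by simp

lemma L2_add [intro]:
  assumes "f \<in> L2_space \<Omega>" "g \<in> L2_space \<Omega>"
  shows "(\<lambda>x. f x + g x) \<in> L2_space \<Omega>"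
  using assms L2_mult_integrable[OF assms] by (auto simp: L2_space_def power2_sum mult.assoc)

lemma L2_diff [intro]:
  assumes "f \<in> L2_space \<Omega>" "g \<in> L2_space \<Omega>"
  shows "(\<lambda>x. f x - g x) \<in> L2_space \<Omega>"
  using L2_add[OF assms(1) L2_minus[OF assms(2)]] by simp

lemma L2_sum [intro]:
  assumes "\<And>i. i \<in> I \<Longrightarrow> f i \<in> L2_space \<Omega>"
  shows "(\<lambda>x. \<Sum>i\<in>I. f i x) \<in> L2_space \<Omega>"
  using assms by (induction I rule: infinite_finite_induct) auto

lemma L2_inner_commute: "L2_inner \<Omega> f g = L2_inner \<Omega> g f"
  by (simp add: L2_inner_def mult.commute)

lemma L2_inner_add_left:
  "\<lbrakk>f \<in> L2_space \<Omega>; g \<in> L2_space \<Omega>; h \<in> L2_space \<Omega>\<rbrakk> \<Longrightarrow>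
    L2_inner \<Omega> (\<lambda>x. f x + g x) h = L2_inner \<Omega> f h + L2_inner \<Omega> g h"
  unfolding L2_inner_def
  by (subst Bochner_Integration.integral_add[symmetric]) (auto simp: L2_mult_integrable distrib_right)

lemma L2_inner_diff_left:
  "\<lbrakk>f \<in> L2_space \<Omega>; g \<in> L2_space \<Omega>; h \<in> L2_space \<Omega>\<rbrakk> \<Longrightarrow>
    L2_inner \<Omega> (\<lambda>x. f x - g x) h = L2_inner \<Omega> f h - L2_inner \<Omega> g h"
  unfolding L2_inner_def
  by (subst Bochner_Integration.integral_diff[symmetric]) (auto simp: L2_mult_integrable left_diff_distrib)

lemma L2_inner_scale_left: "L2_inner \<Omega> (\<lambda>x. c * f x) g = c * L2_inner \<Omega> f g"
  by (simp add: L2_inner_def mult.assoc)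

lemma L2_inner_divide_left: "L2_inner \<Omega> (\<lambda>x. f x / c) g = L2_inner \<Omega> f g / c"
  using L2_inner_scale_left[of \<Omega> "1 / c"] by simp

lemma L2_inner_sum_left:
  assumes "\<And>i. i \<in> I \<Longrightarrow> f i \<in> L2_space \<Omega>" "h \<in> L2_space \<Omega>"
  shows "L2_inner \<Omega> (\<lambda>x. \<Sum>i\<in>I. f i x) h = (\<Sum>i\<in>I. L2_inner \<Omega> (f i) h)"
proof -
  have "(\<lambda>x. (\<Sum>i\<in>I. f i x) * h x) = (\<lambda>x. \<Sum>i\<in>I. f i x * h x)"
    by (simp add: sum_distrib_right)
  then show ?thesis
    unfolding L2_inner_def using assms
    by (subst Bochner_Integration.integral_sum[symmetric]) (auto simp: L2_mult_integrable)
qed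

lemma L2_inner_add_right:
  "\<lbrakk>f \<in> L2_space \<Omega>; g \<in> L2_space \<Omega>; h \<in> L2_space \<Omega>\<rbrakk> \<Longrightarrow>
    L2_inner \<Omega> h (\<lambda>x. f x + g x) = L2_inner \<Omega> h f + L2_inner \<Omega> h g"
  by (subst (1 2 3) L2_inner_commute) (rule L2_inner_add_left)

lemma L2_inner_diff_right:
  "\<lbrakk>f \<in> L2_space \<Omega>; g \<in> L2_space \<Omega>; h \<in> L2_space \<Omega>\<rbrakk> \<Longrightarrow>
    L2_inner \<Omega> h (\<lambda>x. f x - g x) = L2_inner \<Omega> h f - L2_inner \<Omega> h g"
  by (subst (1 2 3) L2_inner_commute) (rule L2_inner_diff_left)

lemma L2_inner_scale_right: "L2_inner \<Omega> g (\<lambda>x. c * f x) = c * L2_inner \<Omega> g f"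
  by (subst (1 2) L2_inner_commute) (rule L2_inner_scale_left)

lemma L2_inner_divide_right: "L2_inner \<Omega> g (\<lambda>x. f x / c) = L2_inner \<Omega> g f / c"
  by (subst (1 2) L2_inner_commute) (rule L2_inner_divide_left)

section \<open>Invariance under change on null sets\<close>

lemma AE_lebesgue_on_iff:
  "\<Omega> \<in> sets lebesgue \<Longrightarrow> (AE x in lebesgue_on \<Omega>. P x) \<longleftrightarrow> (AE x in lebesgue. x \<in> \<Omega> \<longrightarrow> P x)"
  by (rule AE_restrict_space_iff) simp

text \<open>Completeness of \<open>lebesgue\<close> is the reason; extension by zero outside
  \<Omega> moves the question to the whole space.\<close>

lemma borel_measurable_lebesgue_on_AE:
  fixes f g :: "'a::euclidean_space \<Rightarrow> real"
  assumes f: "f \<in> borel_measurable (lebesgue_on \<Omega>)" and \<Omega>: "\<Omega> \<in> sets lebesgue"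
    and ae: "AE x in lebesgue_on \<Omega>. f x = g x"
  shows "g \<in> borel_measurable (lebesgue_on \<Omega>)"
proof -
  have "(\<lambda>x. if x \<in> \<Omega> then f x else 0) \<in> borel_measurable lebesgue"
    using f borel_measurable_if \<Omega> by blast
  moreover have "AE x in lebesgue. (if x \<in> \<Omega> then f x else 0) = (if x \<in> \<Omega> then g x else 0)"
    using ae \<Omega> by (auto simp: AE_lebesgue_on_iff elim!: eventually_mono)
  ultimately have "(\<lambda>x. if x \<in> \<Omega> then g x else 0) \<in> borel_measurable lebesgue"
    by (rule borel_measurable_AE)
  then show ?thesis
    using borel_measurable_if \<Omega> by blast
qed

lemma L2_AE_cong:
  assumes "f \<in> L2_space \<Omega>" "\<Omega> \<in> sets lebesgue" "AE x in lebesgue_on \<Omega>. f x = g x"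
  shows "g \<in> L2_space \<Omega>"
proof -
  have [measurable]: "g \<in> borel_measurable (lebesgue_on \<Omega>)"
    using borel_measurable_lebesgue_on_AE assms L2_measurable by blast
  have [measurable]: "f \<in> borel_measurable (lebesgue_on \<Omega>)"
    using assms L2_measurable by blast
  have "integrable (lebesgue_on \<Omega>) (\<lambda>x. (f x)\<^sup>2) \<longleftrightarrow> integrable (lebesgue_on \<Omega>) (\<lambda>x. (g x)\<^sup>2)"
    using assms(3) by (intro integrable_cong_AE) auto
  then show ?thesis
    using assms by (simp add: L2_space_def)
qed

lemma L2_inner_AE_cong:
  assumes "f \<in> L2_space \<Omega>" "g \<in> L2_space \<Omega>" "\<Omega> \<in> sets lebesgue"
    "AE x in lebesgue_on \<Omega>. f x = f' x" "AE x in lebesgue_on \<Omega>. g x = g' x"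
  shows "L2_inner \<Omega> f g = L2_inner \<Omega> f' g'"
proof -
  have [measurable]: "f \<in> borel_measurable (lebesgue_on \<Omega>)" "g \<in> borel_measurable (lebesgue_on \<Omega>)"
    using assms L2_measurable by auto
  have [measurable]: "f' \<in> borel_measurable (lebesgue_on \<Omega>)" "g' \<in> borel_measurable (lebesgue_on \<Omega>)"
    using assms L2_measurable L2_AE_cong by blast+
  show ?thesis
    unfolding L2_inner_def by (intro integral_cong_AE) (use assms(4,5) in auto)
qed

section \<open>Cauchy-Schwarz and triangle inequality\<close>

lemma L2_inner_sq_add:
  assumes "f \<in> L2_space \<Omega>" "g \<in> L2_space \<Omega>"
  shows "L2_inner \<Omega> (\<lambda>x. f x + c * g x) (\<lambda>x. f x + c * g x)
    = L2_inner \<Omega> f f + 2 * c * L2_inner \<Omega> f g + c\<^sup>2 * L2_inner \<Omega> g g"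
  using assms
  by (simp add: L2_inner_add_left L2_inner_add_right L2_add L2_scale L2_inner_scale_left
      L2_inner_scale_right L2_inner_commute[of \<Omega> g f] power2_eq_square algebra_simps)

text \<open>The quadratic in \<open>c\<close> is nonnegative and has its minimum at
  \<open>- ?C / ?B\<close>. On representatives the form is only semidefinite, so
  \<open>?B = 0\<close> is a genuine case, in which a nonconstant affine function would have to be
  nonnegative.\<close>

lemma L2_Cauchy_Schwarz_sq:
  assumes "f \<in> L2_space \<Omega>" "g \<in> L2_space \<Omega>"
  shows "(L2_inner \<Omega> f g)\<^sup>2 \<le> L2_inner \<Omega> f f * L2_inner \<Omega> g g"
proof -
  let ?A = "L2_inner \<Omega> f f" and ?B = "L2_inner \<Omega> g g" and ?C = "L2_inner \<Omega> f g"
  have pos: "0 \<le> ?A + 2 * c * ?C + c\<^sup>2 * ?B" for c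
    using L2_inner_self_nonneg[of \<Omega> "\<lambda>x. f x + c * g x"] L2_inner_sq_add[OF assms, of c] by simp
  show ?thesis
  proof (cases "?B = 0")
    case True
    have "?C = 0"
    proof (rule ccontr)
      assume "?C \<noteq> 0"
      \<comment> \<open>At this \<open>c\<close> the affine function takes the value -1.\<close>
      then show False
        using pos[of "- (?A + 1) / (2 * ?C)"] True by (simp add: field_simps)
    qed
    then show ?thesis by simp
  next
    case False
    then have "?B > 0" using L2_inner_self_nonneg[of \<Omega> g] by linarith
    then show ?thesis
      using pos[of "- ?C / ?B"] by (simp add: field_simps power2_eq_square)
  qed
qed

lemma L2_Cauchy_Schwarz:
  assumes "f \<in> L2_space \<Omega>" "g \<in> L2_space \<Omega>"
  shows "\<bar>L2_inner \<Omega> f g\<bar> \<le> Lnorm \<Omega> 2 f * Lnorm \<Omega> 2 g"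
  using real_sqrt_le_mono[OF L2_Cauchy_Schwarz_sq[OF assms]]
  by (simp add: Lnorm_2_real real_sqrt_mult)

lemma Lnorm_2_triangle:
  assumes "f \<in> L2_space \<Omega>" "g \<in> L2_space \<Omega>"
  shows "Lnorm \<Omega> 2 (\<lambda>x. f x + g x) \<le> Lnorm \<Omega> 2 f + Lnorm \<Omega> 2 g"
proof (rule power2_le_imp_le)
  have "(Lnorm \<Omega> 2 (\<lambda>x. f x + g x))\<^sup>2
      = (Lnorm \<Omega> 2 f)\<^sup>2 + 2 * L2_inner \<Omega> f g + (Lnorm \<Omega> 2 g)\<^sup>2"
    using L2_inner_sq_add[OF assms, of 1] by (simp add: Lnorm_2_sq)
  also have "\<dots> \<le> (Lnorm \<Omega> 2 f + Lnorm \<Omega> 2 g)\<^sup>2"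
    using L2_Cauchy_Schwarz[OF assms] by (simp add: power2_sum)
  finally show "(Lnorm \<Omega> 2 (\<lambda>x. f x + g x))\<^sup>2 \<le> (Lnorm \<Omega> 2 f + Lnorm \<Omega> 2 g)\<^sup>2" .
qed simp

lemma Lnorm_2_scale: "Lnorm \<Omega> 2 (\<lambda>x. c * f x :: real) = \<bar>c\<bar> * Lnorm \<Omega> 2 f"
  by (simp add: Lnorm_2_real L2_inner_scale_left L2_inner_scale_right real_sqrt_mult
      flip: mult.assoc)

lemma Lnorm_2_minus_commute: "Lnorm \<Omega> 2 (\<lambda>x. f x - g x :: real) = Lnorm \<Omega> 2 (\<lambda>x. g x - f x)"
  using Lnorm_2_scale[of \<Omega> "-1" "\<lambda>x. f x - g x"] by simp

lemma L2_inner_self_eq_0_iff: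
  "f \<in> L2_space \<Omega> \<Longrightarrow> L2_inner \<Omega> f f = 0 \<longleftrightarrow> zero_on \<Omega> f"
  unfolding L2_inner_def zero_on_def
  using integral_nonneg_eq_0_iff_AE[OF L2_square_integrable[of f \<Omega>]]
  by (simp add: power2_eq_square)

lemma L2_AE_eq_iff:
  assumes "f \<in> L2_space \<Omega>" "g \<in> L2_space \<Omega>"
  shows "Lnorm \<Omega> 2 (\<lambda>x. f x - g x) = 0 \<longleftrightarrow> (AE x in lebesgue_on \<Omega>. f x = g x)"
  using L2_inner_self_eq_0_iff[OF L2_diff[OF assms]]
  by (simp add: Lnorm_2_real zero_on_def)

section \<open>Convergence in \<open>L2_space\<close>\<close>

text \<open>Membership is part of the notion because \<open>Lnorm\<close> is 0 on functions whose
  power is not integrable, so that a small norm alone proves nothing. It is required only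
  eventually, since along \<open>at t within J\<close> nothing is known about times outside
  \<open>J\<close>.\<close>

definition L2_tendsto ::
    "'a::euclidean_space set \<Rightarrow> ('s \<Rightarrow> 'a \<Rightarrow> real) \<Rightarrow> ('a \<Rightarrow> real) \<Rightarrow> 's filter \<Rightarrow> bool"
  where "L2_tendsto \<Omega> f l F \<longleftrightarrow> l \<in> L2_space \<Omega> \<and> (\<forall>\<^sub>F s in F. f s \<in> L2_space \<Omega>) \<and>
    ((\<lambda>s. Lnorm \<Omega> 2 (\<lambda>x. f s x - l x)) \<longlongrightarrow> 0) F"

lemma L2_tendsto_const: "l \<in> L2_space \<Omega> \<Longrightarrow> L2_tendsto \<Omega> (\<lambda>_. l) l F"
  by (simp add: L2_tendsto_def Lnorm_def)

lemma tendsto_0_Lnorm_le: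
  assumes "\<forall>\<^sub>F s in F. Lnorm \<Omega> q (f s) \<le> g s" "(g \<longlongrightarrow> 0) F"
  shows "((\<lambda>s. Lnorm \<Omega> q (f s)) \<longlongrightarrow> 0) F"
  by (rule tendsto_sandwich[OF _ assms(1) tendsto_const assms(2)]) simp

lemma L2_tendsto_add:
  assumes "L2_tendsto \<Omega> f l F" "L2_tendsto \<Omega> g m F"
  shows "L2_tendsto \<Omega> (\<lambda>s x. f s x + g s x) (\<lambda>x. l x + m x) F"
proof -
  have L: "l \<in> L2_space \<Omega>" "m \<in> L2_space \<Omega>" using assms by (auto simp: L2_tendsto_def)
  have ev: "\<forall>\<^sub>F s in F. f s \<in> L2_space \<Omega> \<and> g s \<in> L2_space \<Omega>"
    using assms by (auto simp: L2_tendsto_def eventually_conj_iff)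
  have "((\<lambda>s. Lnorm \<Omega> 2 (\<lambda>x. f s x + g s x - (l x + m x))) \<longlongrightarrow> 0) F"
  proof (rule tendsto_0_Lnorm_le)
    show "\<forall>\<^sub>F s in F. Lnorm \<Omega> 2 (\<lambda>x. f s x + g s x - (l x + m x)) \<le>
        Lnorm \<Omega> 2 (\<lambda>x. f s x - l x) + Lnorm \<Omega> 2 (\<lambda>x. g s x - m x)"
      using ev
    proof eventually_elim
      case (elim s)
      then show ?case
        using Lnorm_2_triangle[of "\<lambda>x. f s x - l x" \<Omega> "\<lambda>x. g s x - m x"] L
        by (auto simp: algebra_simps)
    qed
    show "((\<lambda>s. Lnorm \<Omega> 2 (\<lambda>x. f s x - l x) + Lnorm \<Omega> 2 (\<lambda>x. g s x - m x)) \<longlongrightarrow> 0) F"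
      using assms by (auto simp: L2_tendsto_def intro!: tendsto_add_zero)
  qed
  moreover have "\<forall>\<^sub>F s in F. (\<lambda>x. f s x + g s x) \<in> L2_space \<Omega>"
    using ev by eventually_elim auto
  ultimately show ?thesis using L by (auto simp: L2_tendsto_def)
qed

lemma L2_tendsto_scale_const:
  assumes "L2_tendsto \<Omega> f l F"
  shows "L2_tendsto \<Omega> (\<lambda>s x. c * f s x) (\<lambda>x. c * l x) F"
proof -
  have "Lnorm \<Omega> 2 (\<lambda>x. c * f s x - c * l x) = \<bar>c\<bar> * Lnorm \<Omega> 2 (\<lambda>x. f s x - l x)" for s
    using Lnorm_2_scale[of \<Omega> c "\<lambda>x. f s x - l x"] by (simp add: algebra_simps)
  moreover have "\<forall>\<^sub>F s in F. (\<lambda>x. c * f s x) \<in> L2_space \<Omega>"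
    using assms by (auto simp: L2_tendsto_def elim!: eventually_mono)
  ultimately show ?thesis
    using assms by (auto simp: L2_tendsto_def intro!: tendsto_mult_right_zero)
qed

lemma L2_tendsto_diff:
  assumes "L2_tendsto \<Omega> f l F" "L2_tendsto \<Omega> g m F"
  shows "L2_tendsto \<Omega> (\<lambda>s x. f s x - g s x) (\<lambda>x. l x - m x) F"
  using L2_tendsto_add[OF assms(1) L2_tendsto_scale_const[OF assms(2), of "-1"]] by simp

lemma Lnorm_2_diff_le:
  assumes "f \<in> L2_space \<Omega>" "g \<in> L2_space \<Omega>"
  shows "\<bar>Lnorm \<Omega> 2 f - Lnorm \<Omega> 2 g\<bar> \<le> Lnorm \<Omega> 2 (\<lambda>x. f x - g x)"
proof -
  have "Lnorm \<Omega> 2 f \<le> Lnorm \<Omega> 2 (\<lambda>x. f x - g x) + Lnorm \<Omega> 2 g"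
    using Lnorm_2_triangle[OF L2_diff[OF assms] assms(2)] by simp
  moreover have "Lnorm \<Omega> 2 g \<le> Lnorm \<Omega> 2 (\<lambda>x. g x - f x) + Lnorm \<Omega> 2 f"
    using Lnorm_2_triangle[OF L2_diff[OF assms(2,1)] assms(1)] by simp
  ultimately show ?thesis using Lnorm_2_minus_commute[of \<Omega> f g] by linarith
qed

lemma L2_tendsto_norm:
  assumes "L2_tendsto \<Omega> f l F"
  shows "((\<lambda>s. Lnorm \<Omega> 2 (f s)) \<longlongrightarrow> Lnorm \<Omega> 2 l) F"
proof -
  have "((\<lambda>s. Lnorm \<Omega> 2 (f s) - Lnorm \<Omega> 2 l) \<longlongrightarrow> 0) F"
  proof (rule Lim_null_comparison)
    show "\<forall>\<^sub>F s in F. norm (Lnorm \<Omega> 2 (f s) - Lnorm \<Omega> 2 l) \<le> Lnorm \<Omega> 2 (\<lambda>x. f s x - l x)"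
      using assms by (auto simp: L2_tendsto_def intro!: Lnorm_2_diff_le elim!: eventually_mono)
  qed (use assms in \<open>simp add: L2_tendsto_def\<close>)
  then show ?thesis using Lim_null by blast
qed

lemma L2_tendsto_inner:
  assumes f: "L2_tendsto \<Omega> f l F" and g: "L2_tendsto \<Omega> g m F"
  shows "((\<lambda>s. L2_inner \<Omega> (f s) (g s)) \<longlongrightarrow> L2_inner \<Omega> l m) F"
proof -
  have L: "l \<in> L2_space \<Omega>" "m \<in> L2_space \<Omega>" using assms by (auto simp: L2_tendsto_def)
  have ev: "\<forall>\<^sub>F s in F. f s \<in> L2_space \<Omega> \<and> g s \<in> L2_space \<Omega>"
    using assms by (auto simp: L2_tendsto_def eventually_conj_iff)
  have "((\<lambda>s. L2_inner \<Omega> (f s) (g s) - L2_inner \<Omega> l m) \<longlongrightarrow> 0) F"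
  proof (rule Lim_null_comparison)
    show "\<forall>\<^sub>F s in F. norm (L2_inner \<Omega> (f s) (g s) - L2_inner \<Omega> l m)
        \<le> Lnorm \<Omega> 2 (\<lambda>x. f s x - l x) * Lnorm \<Omega> 2 (g s) + Lnorm \<Omega> 2 l * Lnorm \<Omega> 2 (\<lambda>x. g s x - m x)"
      using ev
    proof eventually_elim
      case (elim s)
      have "L2_inner \<Omega> (f s) (g s) - L2_inner \<Omega> l m =
          L2_inner \<Omega> (\<lambda>x. f s x - l x) (g s) + L2_inner \<Omega> l (\<lambda>x. g s x - m x)"
        using elim L by (simp add: L2_inner_diff_left L2_inner_diff_right L2_diff)
      moreover have "\<bar>L2_inner \<Omega> (\<lambda>x. f s x - l x) (g s)\<bar> \<le> Lnorm \<Omega> 2 (\<lambda>x. f s x - l x) * Lnorm \<Omega> 2 (g s)"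
        using elim L by (intro L2_Cauchy_Schwarz) auto
      moreover have "\<bar>L2_inner \<Omega> l (\<lambda>x. g s x - m x)\<bar> \<le> Lnorm \<Omega> 2 l * Lnorm \<Omega> 2 (\<lambda>x. g s x - m x)"
        using elim L by (intro L2_Cauchy_Schwarz) auto
      ultimately show ?case by simp
    qed
    have "((\<lambda>s. Lnorm \<Omega> 2 (\<lambda>x. f s x - l x) * Lnorm \<Omega> 2 (g s) +
        Lnorm \<Omega> 2 l * Lnorm \<Omega> 2 (\<lambda>x. g s x - m x)) \<longlongrightarrow> 0 * Lnorm \<Omega> 2 m + Lnorm \<Omega> 2 l * 0) F"
      using f g L2_tendsto_norm[OF g] by (intro tendsto_intros) (auto simp: L2_tendsto_def)
    then show "((\<lambda>s. Lnorm \<Omega> 2 (\<lambda>x. f s x - l x) * Lnorm \<Omega> 2 (g s) +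
        Lnorm \<Omega> 2 l * Lnorm \<Omega> 2 (\<lambda>x. g s x - m x)) \<longlongrightarrow> 0) F"
      by simp
  qed
  then show ?thesis using Lim_null by blast
qed

lemma L2_tendsto_scale:
  fixes c :: "'s \<Rightarrow> real"
  assumes f: "L2_tendsto \<Omega> f l F" and c: "(c \<longlongrightarrow> d) F"
  shows "L2_tendsto \<Omega> (\<lambda>s x. c s * f s x) (\<lambda>x. d * l x) F"
proof -
  have L: "l \<in> L2_space \<Omega>" and ev: "\<forall>\<^sub>F s in F. f s \<in> L2_space \<Omega>"
    using f by (auto simp: L2_tendsto_def)
  have "((\<lambda>s. Lnorm \<Omega> 2 (\<lambda>x. c s * f s x - d * l x)) \<longlongrightarrow> 0) F"
  proof (rule tendsto_0_Lnorm_le)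
    show "\<forall>\<^sub>F s in F. Lnorm \<Omega> 2 (\<lambda>x. c s * f s x - d * l x) \<le>
        \<bar>c s - d\<bar> * Lnorm \<Omega> 2 (f s) + \<bar>d\<bar> * Lnorm \<Omega> 2 (\<lambda>x. f s x - l x)"
      using ev
    proof eventually_elim
      case (elim s)
      have "Lnorm \<Omega> 2 (\<lambda>x. (c s - d) * f s x + d * (f s x - l x))
          \<le> Lnorm \<Omega> 2 (\<lambda>x. (c s - d) * f s x) + Lnorm \<Omega> 2 (\<lambda>x. d * (f s x - l x))"
        using elim L by (intro Lnorm_2_triangle) auto
      then show ?case by (simp only: Lnorm_2_scale) (simp add: algebra_simps)
    qed
    have "((\<lambda>s. \<bar>c s - d\<bar> * Lnorm \<Omega> 2 (f s) + \<bar>d\<bar> * Lnorm \<Omega> 2 (\<lambda>x. f s x - l x)) \<longlongrightarrow>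
        \<bar>d - d\<bar> * Lnorm \<Omega> 2 l + \<bar>d\<bar> * 0) F"
      using f c L2_tendsto_norm[OF f] by (intro tendsto_intros) (auto simp: L2_tendsto_def)
    then show "((\<lambda>s. \<bar>c s - d\<bar> * Lnorm \<Omega> 2 (f s) + \<bar>d\<bar> * Lnorm \<Omega> 2 (\<lambda>x. f s x - l x)) \<longlongrightarrow> 0) F"
      by simp
  qed
  moreover have "\<forall>\<^sub>F s in F. (\<lambda>x. c s * f s x) \<in> L2_space \<Omega>"
    using ev by eventually_elim auto
  ultimately show ?thesis using L by (auto simp: L2_tendsto_def)
qed

lemma L2_tendsto_unique:
  assumes "L2_tendsto \<Omega> f l F" "L2_tendsto \<Omega> f m F" "F \<noteq> bot"
  shows "AE x in lebesgue_on \<Omega>. l x = m x"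
proof -
  have "L2_tendsto \<Omega> (\<lambda>s x. f s x - f s x) (\<lambda>x. l x - m x) F"
    by (rule L2_tendsto_diff[OF assms(1,2)])
  then have "((\<lambda>s. Lnorm \<Omega> 2 (\<lambda>x. f s x - f s x)) \<longlongrightarrow> Lnorm \<Omega> 2 (\<lambda>x. l x - m x)) F"
    by (rule L2_tendsto_norm)
  then have "Lnorm \<Omega> 2 (\<lambda>x. l x - m x) = 0"
    using tendsto_unique[OF assms(3)] tendsto_const by (fastforce simp: Lnorm_def)
  then show ?thesis
    using L2_AE_eq_iff assms by (auto simp: L2_tendsto_def)
qed

lemma Lnorm_2_AE_cong:
  assumes "f \<in> L2_space \<Omega>" "\<Omega> \<in> sets lebesgue" "AE x in lebesgue_on \<Omega>. f x = g x"
  shows "Lnorm \<Omega> 2 f = Lnorm \<Omega> 2 g"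
  using L2_inner_AE_cong[OF assms(1,1,2,3,3)] by (simp add: Lnorm_2_real)

lemma L2_tendsto_AE_cong:
  assumes "L2_tendsto \<Omega> f l F" "\<Omega> \<in> sets lebesgue"
    and "\<forall>\<^sub>F s in F. AE x in lebesgue_on \<Omega>. f s x = f' s x" "AE x in lebesgue_on \<Omega>. l x = l' x"
  shows "L2_tendsto \<Omega> f' l' F"
proof -
  have ev: "\<forall>\<^sub>F s in F. f s \<in> L2_space \<Omega> \<and> (AE x in lebesgue_on \<Omega>. f s x = f' s x)"
    and L: "l \<in> L2_space \<Omega>"
    using assms by (auto simp: L2_tendsto_def eventually_conj_iff)
  have "\<forall>\<^sub>F s in F. f' s \<in> L2_space \<Omega>"
    using ev by eventually_elim (use assms L2_AE_cong in blast)
  moreover have "l' \<in> L2_space \<Omega>" using L assms L2_AE_cong by blast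
  moreover have "\<forall>\<^sub>F s in F. Lnorm \<Omega> 2 (\<lambda>x. f s x - l x) = Lnorm \<Omega> 2 (\<lambda>x. f' s x - l' x)"
    using ev
  proof eventually_elim
    case (elim s)
    show ?case
    proof (rule Lnorm_2_AE_cong)
      show "AE x in lebesgue_on \<Omega>. f s x - l x = f' s x - l' x"
        using elim assms(4) by auto
    qed (use elim L assms in auto)
  qed
  ultimately show ?thesis
    using assms(1) Lim_transform_eventually unfolding L2_tendsto_def by fast
qed

text \<open>The squares of the differences tend to 0 in L^1, and L^1 convergence has an almost
  everywhere convergent subsequence. Pointwise limits are needed to pass to the limit inside the
  power nonlinearity.\<close>

lemma L2_tendsto_AE_subseq:
  fixes f :: "nat \<Rightarrow> 'a::euclidean_space \<Rightarrow> real"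
  assumes "\<And>n. f n \<in> L2_space \<Omega>" "L2_tendsto \<Omega> f l sequentially"
  obtains r where "strict_mono r" "AE x in lebesgue_on \<Omega>. (\<lambda>n. f (r n) x) \<longlonglongrightarrow> l x"
proof -
  have L: "l \<in> L2_space \<Omega>" using assms by (auto simp: L2_tendsto_def)
  have "(\<lambda>n. (Lnorm \<Omega> 2 (\<lambda>x. f n x - l x))\<^sup>2) \<longlonglongrightarrow> 0"
    using assms(2) tendsto_power[of _ 0 sequentially 2] by (auto simp: L2_tendsto_def)
  then have "(\<lambda>n. LINT x|lebesgue_on \<Omega>. norm ((f n x - l x)\<^sup>2)) \<longlonglongrightarrow> 0"
    by (simp add: Lnorm_2_eq)
  then obtain r :: "nat \<Rightarrow> nat" where r: "strict_mono r"
    and ae: "AE x in lebesgue_on \<Omega>. (\<lambda>n. (f (r n) x - l x)\<^sup>2) \<longlonglongrightarrow> 0"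
    using tendsto_L1_AE_subseq[of "lebesgue_on \<Omega>" "\<lambda>n x. (f n x - l x)\<^sup>2"]
      L2_square_integrable[OF L2_diff[OF assms(1) L]] by blast
  have "AE x in lebesgue_on \<Omega>. (\<lambda>n. f (r n) x) \<longlonglongrightarrow> l x"
    using ae
  proof eventually_elim
    case (elim x)
    then have "(\<lambda>n. \<bar>f (r n) x - l x\<bar>) \<longlonglongrightarrow> 0"
      using tendsto_real_sqrt[of _ 0 sequentially] by fastforce
    then have "(\<lambda>n. f (r n) x - l x) \<longlonglongrightarrow> 0"
      by (simp add: tendsto_rabs_zero_iff)
    then show ?case using Lim_null by blast
  qed
  with r that show ?thesis by blast
qed

section \<open>Bump functions\<close>

lemma Ck_on_lower: "Ck_on (Suc k) f S \<Longrightarrow> Ck_on k f S"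
proof (induction k arbitrary: f)
  case 0
  then show ?case by (simp add: differentiable_imp_continuous_on)
next
  case (Suc k)
  then show ?case by (metis Ck_on.simps(2))
qed

lemma Ck_on_const: "Ck_on k (\<lambda>x. c) S"
  by (induction k arbitrary: c) auto

lemma Ck_on_add:
  "Ck_on k f UNIV \<Longrightarrow> Ck_on k g UNIV \<Longrightarrow> Ck_on k (\<lambda>x. f x + g x) UNIV"
proof (induction k arbitrary: f g)
  case 0
  then show ?case by (auto intro: continuous_intros)
next
  case (Suc k)
  have d: "f differentiable at x" "g differentiable at x" for x
    using Suc.prems by (auto simp: differentiable_on_def)
  have "partial_deriv i (\<lambda>x. f x + g x) = (\<lambda>x. partial_deriv i f x + partial_deriv i g x)" for i
  proof
    fix x
    have "((\<lambda>x. f x + g x) has_derivative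
        (\<lambda>h. frechet_derivative f (at x) h + frechet_derivative g (at x) h)) (at x)"
      using d by (intro has_derivative_add) (auto simp: frechet_derivative_works[symmetric])
    from fun_cong[OF frechet_derivative_at[OF this], of i]
    show "partial_deriv i (\<lambda>x. f x + g x) x = partial_deriv i f x + partial_deriv i g x" by simp
  qed
  then show ?case using Suc by (auto intro: differentiable_on_add)
qed

lemma partial_deriv_mult:
  assumes "f differentiable at x" "g differentiable at x"
  shows "partial_deriv i (\<lambda>x. f x * g x :: real) x = f x * partial_deriv i g x + partial_deriv i f x * g x"
proof -
  have "((\<lambda>x. f x * g x) has_derivative
      (\<lambda>h. f x * frechet_derivative g (at x) h + frechet_derivative f (at x) h * g x)) (at x)"
    using assms by (intro has_derivative_mult) (auto simp: frechet_derivative_works[symmetric])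
  from fun_cong[OF frechet_derivative_at[OF this], of i] show ?thesis by simp
qed

text \<open>The Leibniz rule leaves one factor undifferentiated in each summand;
  \<open>Ck_on_lower\<close> brings that factor down to the order of the induction
  hypothesis.\<close>

lemma Ck_on_mult:
  "Ck_on k f UNIV \<Longrightarrow> Ck_on k g UNIV \<Longrightarrow> Ck_on k (\<lambda>x. f x * g x) UNIV"
proof (induction k arbitrary: f g)
  case 0
  then show ?case by (auto intro: continuous_intros)
next
  case (Suc k)
  have d: "f differentiable at x" "g differentiable at x" for x
    using Suc.prems by (auto simp: differentiable_on_def)
  have "partial_deriv i (\<lambda>x. f x * g x) =
      (\<lambda>x. f x * partial_deriv i g x + partial_deriv i f x * g x)" for i
    using partial_deriv_mult d by blast
  moreover have "Ck_on k (\<lambda>x. f x * partial_deriv i g x + partial_deriv i f x * g x) UNIV"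
    if "i \<in> Basis" for i
    using Suc.prems that Ck_on_lower[OF Suc.prems(1)] Ck_on_lower[OF Suc.prems(2)]
    by (intro Ck_on_add Suc.IH) auto
  moreover have "(\<lambda>x. f x * g x) differentiable_on UNIV"
    using d by (auto simp: differentiable_on_def intro!: differentiable_mult)
  ultimately show ?case by simp
qed

lemma Ck_on_prod:
  assumes "\<And>i. i \<in> I \<Longrightarrow> Ck_on k (f i) UNIV"
  shows "Ck_on k (\<lambda>x. \<Prod>i\<in>I. f i x) UNIV"
  using assms by (induction I rule: infinite_finite_induct) (auto simp: Ck_on_const Ck_on_mult)

text \<open>The derivatives of \<open>exp (- 1 / t)\<close> are polynomials in \<open>1 / t\<close> times \<open>exp (- 1 / t)\<close>, so this
  family is closed under differentiation.\<close>

definition flat :: "real poly \<Rightarrow> real \<Rightarrow> real"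
  where "flat P t = (if t > 0 then poly P (1 / t) * exp (- (1 / t)) else 0)"

lemma tendsto_poly_div_exp: "((\<lambda>x. poly P x / exp x) \<longlongrightarrow> (0::real)) at_top"
proof -
  have "((\<lambda>x. \<Sum>i\<le>degree P. coeff P i * (x ^ i / exp x)) \<longlongrightarrow> (\<Sum>i\<le>degree P. coeff P i * 0)) at_top"
    by (intro tendsto_sum tendsto_mult tendsto_const tendsto_power_div_exp_0)
  then show ?thesis by (simp add: poly_altdef sum_divide_distrib)
qed

text \<open>From the right, the substitution of 1/t turns the claim into the decay of polynomial
  over exponential at infinity; from the left the function is 0.\<close>

lemma tendsto_flat_0: "(flat P \<longlongrightarrow> 0) (at 0)"
proof -
  have "((\<lambda>t. poly P (inverse t) / exp (inverse t)) \<longlongrightarrow> 0) (at_right 0)"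
    by (rule filterlim_compose[OF tendsto_poly_div_exp filterlim_inverse_at_top_right])
  then have "(flat P \<longlongrightarrow> 0) (at_right 0)"
    by (rule Lim_transform_eventually)
      (auto simp: eventually_at_right_field flat_def exp_minus field_simps intro!: exI[of _ 1])
  moreover have "(flat P \<longlongrightarrow> 0) (at_left 0)"
    by (rule Lim_transform_eventually[OF tendsto_const])
      (auto simp: eventually_at_left_field flat_def intro!: exI[of _ "-1"])
  ultimately show ?thesis by (simp add: filterlim_at_split)
qed

text \<open>The derivative of P(1/t) exp(-1/t) is t^(-2) (P - P')(1/t) exp(-1/t), and
  \<open>[:0, 0, 1:]\<close> is the polynomial that supplies t^(-2).\<close>

lemma flat_DERIV: "(flat P has_real_derivative flat ([:0, 0, 1:] * (P - pderiv P)) t) (at t)"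
proof -
  consider "t > 0" | "t = 0" | "t < 0" by linarith
  then show ?thesis
  proof cases
    case 1
    have "((\<lambda>t. poly P (1 / t) * exp (- (1 / t))) has_real_derivative
        flat ([:0, 0, 1:] * (P - pderiv P)) t) (at t)"
      using 1 unfolding flat_def
      by (auto intro!: derivative_eq_intros DERIV_chain2[OF poly_DERIV]
          simp: field_simps power2_eq_square)
    then show ?thesis
      by (rule has_field_derivative_transform_within_open[where S = "{0<..}"])
        (use 1 in \<open>auto simp: flat_def\<close>)
  next
    case 2
    \<comment> \<open>The factor \<open>[:0, 1:]\<close> is the division by \<open>h\<close>: this
      function is the difference quotient at 0.\<close>
    have "((\<lambda>h. flat ([:0, 1:] * P) h) \<longlongrightarrow> 0) (at 0)"
      by (rule tendsto_flat_0)
    then have "((\<lambda>h. (flat P (0 + h) - flat P 0) / h) \<longlongrightarrow> 0) (at 0)"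
      by (rule Lim_transform_eventually) (auto simp: flat_def eventually_at_filter)
    then show ?thesis using 2 by (simp add: DERIV_def flat_def)
  next
    case 3
    have "((\<lambda>t. 0) has_real_derivative flat ([:0, 0, 1:] * (P - pderiv P)) t) (at t)"
      using 3 by (simp add: flat_def)
    then show ?thesis
      by (rule has_field_derivative_transform_within_open[where S = "{..<0}"])
        (use 3 in \<open>auto simp: flat_def\<close>)
  qed
qed

text \<open>The constant factor and the affine argument are there for the induction: a partial
  derivative has the same form with another polynomial and another constant.\<close>

lemma Ck_on_flat:
  fixes j :: "'a::euclidean_space"
  shows "Ck_on k (\<lambda>x. c * flat P (m * (x \<bullet> j) + e)) UNIV"
proof (induction k arbitrary: P c)
  case 0
  have "continuous_on UNIV (flat P)"
    using flat_DERIV DERIV_isCont by (force simp: continuous_on_eq_continuous_at)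
  then have "continuous_on UNIV (\<lambda>x::'a. flat P (m * (x \<bullet> j) + e))"
    by (rule continuous_on_compose2) (auto intro!: continuous_intros)
  then show ?case by (auto intro!: continuous_intros)
next
  case (Suc k)
  define Q where "Q = [:0, 0, 1:] * (P - pderiv P)"
  have D: "((\<lambda>x. c * flat P (m * (x \<bullet> j) + e)) has_derivative
      (\<lambda>h. c * (flat Q (m * (x \<bullet> j) + e) * (m * (h \<bullet> j))))) (at x)" for x
  proof (rule has_derivative_mult_right)
    have "(flat P has_derivative (\<lambda>h. flat Q (m * (x \<bullet> j) + e) * h)) (at (m * (x \<bullet> j) + e))"
      using flat_DERIV[of P "m * (x \<bullet> j) + e"] by (simp add: Q_def has_field_derivative_def)
    moreover have "((\<lambda>x. m * (x \<bullet> j) + e) has_derivative (\<lambda>h. m * (h \<bullet> j))) (at x)"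
      by (auto intro!: derivative_eq_intros)
    ultimately show "((\<lambda>x. flat P (m * (x \<bullet> j) + e)) has_derivative
        (\<lambda>h. flat Q (m * (x \<bullet> j) + e) * (m * (h \<bullet> j)))) (at x)"
      using has_derivative_compose by fastforce
  qed
  have "partial_deriv i (\<lambda>x. c * flat P (m * (x \<bullet> j) + e)) =
      (\<lambda>x. (c * m * (i \<bullet> j)) * flat Q (m * (x \<bullet> j) + e))" for i
    using frechet_derivative_at[OF D] by (auto simp: fun_eq_iff algebra_simps dest: fun_cong)
  moreover have "(\<lambda>x. c * flat P (m * (x \<bullet> j) + e)) differentiable_on UNIV"
    using D by (auto simp: differentiable_on_def differentiable_def)
  ultimately show ?case using Suc.IH by simp
qed

lemma flat_1_bounds: "0 \<le> flat 1 t" "flat 1 t \<le> 1"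
  by (auto simp: flat_def)

text \<open>For s > 0 the value is exp(-1/(n s)), so the dilations of \<open>flat 1\<close> are
  smooth approximations of the Heaviside step.\<close>

lemma tendsto_flat_1:
  "(\<lambda>n. flat 1 (real n * s)) \<longlonglongrightarrow> (if s > 0 then 1 else 0)"
proof (cases "s > 0")
  case True
  have "(\<lambda>n. 1 / s * (1 / real n)) \<longlonglongrightarrow> 1 / s * 0"
    by (intro tendsto_intros lim_1_over_n)
  then have "(\<lambda>n. exp (- (1 / s * (1 / real n)))) \<longlonglongrightarrow> exp (- (1 / s * 0))"
    by (intro tendsto_intros)
  then have "(\<lambda>n. exp (- (1 / s * (1 / real n)))) \<longlonglongrightarrow> 1" by simp
  then have "(\<lambda>n. flat 1 (real n * s)) \<longlonglongrightarrow> 1"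
    by (rule Lim_transform_eventually)
      (use True in \<open>auto simp: flat_def field_simps eventually_sequentially intro!: exI[of _ 1]\<close>)
  then show ?thesis using True by simp
next
  case False
  then have "flat 1 (real n * s) = 0" for n
    by (auto simp: flat_def zero_less_mult_iff)
  then show ?thesis using False by simp
qed

text \<open>An open box is an intersection of half-spaces, two per coordinate; the product of the
  corresponding smooth steps vanishes outside the box and tends to its indicator.\<close>

lemma box_approx_test_functions:
  fixes c d :: "'a::euclidean_space"
  assumes "cbox c d \<subseteq> \<Omega>"
  obtains \<phi> :: "nat \<Rightarrow> 'a \<Rightarrow> real" where "\<And>n. test_function \<Omega> (\<phi> n)"
    "\<And>n x. 0 \<le> \<phi> n x \<and> \<phi> n x \<le> 1" "\<And>n x. x \<notin> box c d \<Longrightarrow> \<phi> n x = 0"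
    "\<And>x. (\<lambda>n. \<phi> n x) \<longlonglongrightarrow> indicator (box c d) x"
proof -
  \<comment> \<open>The factors 1 and the expanded affine arguments match the form of
    \<open>Ck_on_flat\<close>; \<open>eq\<close> below gives the readable version.\<close>
  define \<psi> where "\<psi> = (\<lambda>n x. \<Prod>j\<in>Basis.
    (1 * flat 1 (real n * (x \<bullet> j) + - real n * (c \<bullet> j))) *
    (1 * flat 1 (- real n * (x \<bullet> j) + real n * (d \<bullet> j))))"
  have eq: "\<psi> n x = (\<Prod>j\<in>Basis. flat 1 (real n * (x \<bullet> j - c \<bullet> j)) * flat 1 (real n * (d \<bullet> j - x \<bullet> j)))"
    for n x
    unfolding \<psi>_def by (intro prod.cong) (auto simp: algebra_simps)
  have zero: "\<psi> n x = 0" if "x \<notin> box c d" for n x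
  proof -
    have "\<exists>j\<in>Basis. x \<bullet> j \<le> c \<bullet> j \<or> d \<bullet> j \<le> x \<bullet> j"
      using that by (force simp: mem_box not_less)
    then obtain j where "j \<in> Basis" "x \<bullet> j \<le> c \<bullet> j \<or> d \<bullet> j \<le> x \<bullet> j" by blast
    then show ?thesis
      unfolding eq by (intro prod_zero) (auto intro!: bexI[of _ j] simp: flat_def zero_less_mult_iff)
  qed
  have zero_cbox: "\<psi> n x = 0" if "x \<notin> cbox c d" for n x
    using zero that box_subset_cbox by blast
  have "Ck_on k (\<psi> n) UNIV" for k n
    unfolding \<psi>_def by (intro Ck_on_prod Ck_on_mult Ck_on_flat)
  then have "test_function \<Omega> (\<psi> n)" for n
    unfolding test_function_def smooth_on_def
    using assms zero_cbox by (auto intro!: exI[of _ "cbox c d"])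
  moreover have "0 \<le> \<psi> n x \<and> \<psi> n x \<le> 1" for n x
    unfolding eq by (auto intro!: prod_nonneg prod_le_1 mult_le_one simp: flat_1_bounds)
  moreover have "(\<lambda>n. \<psi> n x) \<longlonglongrightarrow> indicator (box c d) x" for x
  proof -
    have "(\<lambda>n. \<psi> n x) \<longlonglongrightarrow> (\<Prod>j\<in>Basis. (if x \<bullet> j - c \<bullet> j > 0 then 1 else 0) * (if d \<bullet> j - x \<bullet> j > 0 then 1 else 0))"
      unfolding eq by (intro tendsto_prod tendsto_mult tendsto_flat_1)
    moreover have "(\<Prod>j\<in>Basis. (if x \<bullet> j - c \<bullet> j > 0 then 1 else 0) * (if d \<bullet> j - x \<bullet> j > 0 then 1 else 0 :: real))
        = indicator (box c d) x"
    proof (cases "x \<in> box c d")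
      case True
      then show ?thesis by (auto simp: mem_box intro!: prod.neutral)
    next
      case False
      then have "\<exists>j\<in>Basis. x \<bullet> j \<le> c \<bullet> j \<or> d \<bullet> j \<le> x \<bullet> j"
        by (force simp: mem_box not_less)
      then obtain j where "j \<in> Basis" "x \<bullet> j \<le> c \<bullet> j \<or> d \<bullet> j \<le> x \<bullet> j" by blast
      then show ?thesis
        using False by (auto intro!: prod_zero bexI[of _ j])
    qed
    ultimately show ?thesis by simp
  qed
  ultimately show ?thesis using that zero by blast
qed

section \<open>The fundamental lemma of the calculus of variations\<close>

lemma open_sets_lebesgue: "open S \<Longrightarrow> S \<in> sets lebesgue"
  by (simp add: sets_completionI_sets)

lemma AE_zero_if_box_integrals_zero:
  fixes f :: "'a::euclidean_space \<Rightarrow> real"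
  assumes f: "integrable lborel f"
    and zero: "\<And>a b. (LINT x|lborel. indicator (box a b) x * f x) = 0"
  shows "AE x in lborel. f x = 0"
proof (rule sigma_finite_measure.density_zero[OF lborel.sigma_finite_measure_axioms f])
  have box0: "(LINT x:box a b|lborel. f x) = 0" for a b
    using zero by (simp add: set_lebesgue_integral_def)
  \<comment> \<open>Complements need the integral over the whole space, which is not a box; growing
    boxes exhaust it.\<close>
  have total: "(LINT x|lborel. f x) = 0"
  proof -
    have "(\<lambda>n. LINT x|lborel. indicator (box (- (real n *\<^sub>R One)) (real n *\<^sub>R One)) x * f x)
        \<longlonglongrightarrow> (LINT x|lborel. f x)"
    proof (rule integral_dominated_convergence[where w = "\<lambda>x. \<bar>f x\<bar>"])
      show "AE x in lborel. (\<lambda>n. indicator (box (- (real n *\<^sub>R One)) (real n *\<^sub>R One)) x * f x) \<longlonglongrightarrow> f x"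
      proof (intro AE_I2 tendsto_eventually)
        fix x :: 'a
        obtain N where N: "norm x < real N" using reals_Archimedean2 by blast
        have "x \<in> box (- (real n *\<^sub>R One)) (real n *\<^sub>R One)" if "n \<ge> N" for n
        proof -
          have "\<bar>x \<bullet> i\<bar> < real n" if "i \<in> Basis" for i
            using Basis_le_norm[OF that, of x] N \<open>n \<ge> N\<close> by simp
          then show ?thesis by (force simp: mem_box abs_less_iff)
        qed
        then show "\<forall>\<^sub>F n in sequentially. indicator (box (- (real n *\<^sub>R One)) (real n *\<^sub>R One)) x * f x = f x"
          by (auto simp: eventually_sequentially indicator_def intro!: exI[of _ N])
      qed
      show "AE x in lborel. norm (indicator (box (- (real n *\<^sub>R One)) (real n *\<^sub>R One)) x * f x) \<le> \<bar>f x\<bar>" for n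
        by (auto simp: indicator_def)
    qed (use f in auto)
    then have "(\<lambda>n::nat. 0) \<longlonglongrightarrow> (LINT x|lborel. f x)" by (simp only: zero)
    then show ?thesis by (simp add: LIMSEQ_const_iff)
  qed
  fix A :: "'a set" assume "A \<in> sets lborel"
  then have A: "A \<in> sigma_sets UNIV (range (\<lambda>(a, b). box a b))"
    by (simp add: borel_eq_box)
  have "Int_stable (range (\<lambda>(a, b). box a b :: 'a set))"
    by (auto simp: Int_stable_def box_Int_box)
  moreover have "range (\<lambda>(a, b). box a b :: 'a set) \<subseteq> Pow UNIV" by simp
  ultimately show "(LINT x:A|lborel. f x) = 0"
    using A
  proof (induction rule: sigma_sets_induct_disjoint)
    case (basic A)
    then show ?case using box0 by auto
  next
    case empty
    then show ?case by (simp add: set_lebesgue_integral_def)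
  next
    case (compl A)
    then have A: "A \<in> sets lborel" by (simp add: borel_eq_box)
    have "(LINT x:UNIV - A|lborel. f x) = (LINT x|lborel. f x - indicator A x * f x)"
      unfolding set_lebesgue_integral_def
      by (intro Bochner_Integration.integral_cong) (auto simp: indicator_def)
    also have "\<dots> = (LINT x|lborel. f x) - (LINT x|lborel. indicator A x * f x)"
      using f integrable_mult_indicator[OF A f] by (intro Bochner_Integration.integral_diff) auto
    finally show ?case using total compl by (simp add: set_lebesgue_integral_def)
  next
    case (union A)
    then have A: "A i \<in> sets lborel" for i by (auto simp: borel_eq_box)
    have "(LINT x:(\<Union>i. A i)|lborel. f x) = (\<Sum>i. LINT x:A i|lborel. f x)"
    proof (rule lebesgue_integral_countable_add)
      show "A i \<inter> A j = {}" if "i \<noteq> j" for i j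
        using union(1) that by (auto simp: disjoint_family_on_def)
      show "set_integrable lborel (\<Union>i. A i) f"
        unfolding set_integrable_def using A f by (intro integrable_mult_indicator) auto
    qed (use A in auto)
    then show ?case using union by simp
  qed
qed

text \<open>The Borel argument works on \<open>lborel\<close>; a Borel representative
  \<open>g\<close> of \<open>f\<close> carries it over to the completion.\<close>

lemma AE_zero_if_box_integrals_zero_lebesgue:
  fixes f :: "'a::euclidean_space \<Rightarrow> real"
  assumes f: "integrable lebesgue f"
    and zero: "\<And>a b. (LINT x|lebesgue. indicator (box a b) x * f x) = 0"
  shows "AE x in lebesgue. f x = 0"
proof -
  obtain g where g[measurable]: "g \<in> borel_measurable lborel" and ae: "AE x in lborel. f x = g x"
    using completion_ex_borel_measurable_real[OF borel_measurable_integrable[OF f]] by blast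
  have ae': "AE x in lebesgue. f x = g x" using ae by (rule AE_completion)
  have m: "f \<in> borel_measurable lebesgue" "g \<in> borel_measurable lebesgue"
    using f g by (auto intro: measurable_completion)
  have "integrable lebesgue g"
    using f ae' m integrable_cong_AE by blast
  then have "integrable lborel g" by (simp add: integrable_completion)
  moreover have "(LINT x|lborel. indicator (box a b) x * g x) = 0" for a b
  proof -
    have "(LINT x|lborel. indicator (box a b) x * g x) = (LINT x|lebesgue. indicator (box a b) x * g x)"
      by (rule integral_completion[symmetric]) measurable
    also have "\<dots> = (LINT x|lebesgue. indicator (box a b) x * f x)"
    proof (rule integral_cong_AE)
      have "(\<lambda>x. indicator (box a b) x :: real) \<in> borel_measurable lebesgue"
        by (intro borel_measurable_indicator open_sets_lebesgue open_box)
      then show "(\<lambda>x. indicator (box a b) x * g x) \<in> borel_measurable lebesgue"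
        "(\<lambda>x. indicator (box a b) x * f x) \<in> borel_measurable lebesgue"
        using m by (auto intro: borel_measurable_times)
      show "AE x in lebesgue. indicator (box a b) x * g x = indicator (box a b) x * f x"
        using ae' by (auto elim!: eventually_mono)
    qed
    finally show ?thesis using zero by simp
  qed
  ultimately have "AE x in lborel. g x = 0" by (rule AE_zero_if_box_integrals_zero)
  then have "AE x in lborel. f x = 0" using ae by eventually_elim simp
  then show ?thesis by (rule AE_completion)
qed

lemma integral_lebesgue_on_supported:
  fixes f :: "'a::euclidean_space \<Rightarrow> real"
  assumes "\<Omega> \<in> sets lebesgue" "K \<in> sets lebesgue" "K \<subseteq> \<Omega>" "\<And>x. x \<in> \<Omega> - K \<Longrightarrow> f x = 0"
  shows "(LINT x|lebesgue_on \<Omega>. f x) = (LINT x|lebesgue_on K. f x)"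
proof -
  have "(LINT x|lebesgue_on \<Omega>. f x) = (LINT x|lebesgue. indicator \<Omega> x *\<^sub>R f x)"
    using assms by (intro integral_restrict_space) auto
  also have "\<dots> = (LINT x|lebesgue. indicator K x *\<^sub>R f x)"
    using assms by (intro Bochner_Integration.integral_cong) (auto simp: indicator_def)
  also have "\<dots> = (LINT x|lebesgue_on K. f x)"
    using assms by (intro integral_restrict_space[symmetric]) auto
  finally show ?thesis .
qed

lemma test_function_continuous: "test_function \<Omega> \<phi> \<Longrightarrow> continuous_on UNIV \<phi>"
  unfolding test_function_def smooth_on_def by (metis Ck_on.simps(1))

text \<open>Test functions approximate indicators of boxes whose closure lies in \<Omega>, so
  \<open>w\<close> integrates to 0 over all of these and vanishes almost everywhere in each;
  countably many of them cover \<Omega>.\<close>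

theorem fundamental_lemma_calculus_of_variations:
  fixes w :: "'a::euclidean_space \<Rightarrow> real"
  assumes \<Omega>: "open \<Omega>" and w: "locally_integrable \<Omega> w"
    and zero: "\<And>\<phi>. test_function \<Omega> \<phi> \<Longrightarrow> (LINT x|lebesgue_on \<Omega>. w x * \<phi> x) = 0"
  shows "AE x in lebesgue_on \<Omega>. w x = 0"
proof -
  have \<Omega>L: "\<Omega> \<in> sets lebesgue" using \<Omega> by (rule open_sets_lebesgue)
  have box0: "(LINT x|lebesgue. indicator (box c d) x * w x) = 0" if cd: "cbox c d \<subseteq> \<Omega>" for c d
  proof -
    obtain \<phi> :: "nat \<Rightarrow> 'a \<Rightarrow> real" where \<phi>: "\<And>n. test_function \<Omega> (\<phi> n)"
      "\<And>n x. 0 \<le> \<phi> n x \<and> \<phi> n x \<le> 1" "\<And>n x. x \<notin> box c d \<Longrightarrow> \<phi> n x = 0"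
      "\<And>x. (\<lambda>n. \<phi> n x) \<longlonglongrightarrow> indicator (box c d) x"
      using box_approx_test_functions[OF cd] by blast
    \<comment> \<open>The limit is taken over the closed box, because \<open>w\<close> is integrable
      only over compact subsets of \<Omega>.\<close>
    let ?M = "lebesgue_on (cbox c d)"
    have wi: "integrable ?M w"
      using w cd by (auto simp: locally_integrable_def)
    have "(\<lambda>n. LINT x|?M. w x * \<phi> n x) \<longlonglongrightarrow> (LINT x|?M. w x * indicator (box c d) x)"
    proof (rule integral_dominated_convergence[where w = "\<lambda>x. \<bar>w x\<bar>"])
      have [measurable]: "w \<in> borel_measurable ?M" using wi by auto
      have [measurable]: "\<phi> n \<in> borel_measurable ?M" for n
        using test_function_continuous[OF \<phi>(1)]
        by (intro continuous_imp_measurable_on_sets_lebesgue) (auto intro: continuous_on_subset)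
      show "(\<lambda>x. w x * \<phi> n x) \<in> borel_measurable ?M" for n by measurable
      have "(\<lambda>x. indicator (box c d) x :: real) \<in> borel_measurable ?M"
        by (rule borel_measurable_LIMSEQ_real[of _ \<phi>]) (use \<phi>(4) in auto)
      then show "(\<lambda>x. w x * indicator (box c d) x) \<in> borel_measurable ?M" by measurable
      show "AE x in ?M. norm (w x * \<phi> n x) \<le> \<bar>w x\<bar>" for n
        using \<phi>(2) by (auto simp: abs_mult intro!: mult_left_le)
      show "AE x in ?M. (\<lambda>n. w x * \<phi> n x) \<longlonglongrightarrow> w x * indicator (box c d) x"
        using \<phi>(4) by (auto intro!: tendsto_intros)
    qed (use wi in auto)
    moreover have "(LINT x|?M. w x * \<phi> n x) = 0" for n
    proof -
      have "(LINT x|lebesgue_on \<Omega>. w x * \<phi> n x) = (LINT x|?M. w x * \<phi> n x)"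
        using \<Omega>L cd \<phi>(3) box_subset_cbox[of c d] by (intro integral_lebesgue_on_supported) auto
      then show ?thesis using zero[OF \<phi>(1)] by simp
    qed
    ultimately have "(\<lambda>n::nat. 0) \<longlonglongrightarrow> (LINT x|?M. w x * indicator (box c d) x)"
      by (simp only:)
    then have "(LINT x|?M. w x * indicator (box c d) x) = 0"
      by (simp add: LIMSEQ_const_iff)
    also have "(LINT x|?M. w x * indicator (box c d) x) = (LINT x|lebesgue. indicator (cbox c d) x *\<^sub>R (w x * indicator (box c d) x))"
      by (rule integral_restrict_space) auto
    also have "\<dots> = (LINT x|lebesgue. indicator (box c d) x * w x)"
      using box_subset_cbox[of c d] by (intro Bochner_Integration.integral_cong) (auto simp: indicator_def)
    finally show ?thesis .
  qed
  have cbox0: "AE x in lebesgue. x \<in> box c d \<longrightarrow> w x = 0" if cd: "cbox c d \<subseteq> \<Omega>" for c d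
  proof -
    have "integrable (lebesgue_on (cbox c d)) w"
      using w cd by (auto simp: locally_integrable_def)
    then have "integrable lebesgue (\<lambda>x. indicator (cbox c d) x *\<^sub>R w x)"
      by (rule integrable_restrict_space[THEN iffD1, rotated]) simp
    then have "integrable lebesgue (\<lambda>x. indicator (box c d) x *\<^sub>R (indicator (cbox c d) x *\<^sub>R w x))"
      by (rule integrable_mult_indicator[rotated]) (simp add: open_sets_lebesgue)
    moreover have "(\<lambda>x. indicator (box c d) x *\<^sub>R (indicator (cbox c d) x *\<^sub>R w x)) = (\<lambda>x. indicator (box c d) x * w x)"
      using box_subset_cbox[of c d] by (auto simp: indicator_def fun_eq_iff)
    ultimately have i: "integrable lebesgue (\<lambda>x. indicator (box c d) x * w x)" by simp
    have "AE x in lebesgue. indicator (box c d) x * w x = 0"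
    proof (rule AE_zero_if_box_integrals_zero_lebesgue[OF i])
      fix a b :: 'a
      \<comment> \<open>The intersection of two boxes is a box whose closure stays in
        \<open>cbox c d\<close>, hence in \<Omega>, so \<open>box0\<close> applies to it.\<close>
      let ?l = "\<Sum>i\<in>Basis. max (a\<bullet>i) (c\<bullet>i) *\<^sub>R i" and ?u = "\<Sum>i\<in>Basis. min (b\<bullet>i) (d\<bullet>i) *\<^sub>R i"
      have "cbox ?l ?u \<subseteq> cbox c d" by (auto simp: Int_interval[symmetric])
      then have "(LINT x|lebesgue. indicator (box ?l ?u) x * w x) = 0"
        using box0 cd by blast
      then show "(LINT x|lebesgue. indicator (box a b) x * (indicator (box c d) x * w x)) = 0"
        by (simp add: box_Int_box[symmetric] indicator_inter_arith mult.assoc)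
    qed
    then show ?thesis by (auto elim!: eventually_mono simp: indicator_def split: if_splits)
  qed
  \<comment> \<open>Rational corners keep the family countable, so that the exceptional null sets
    may be united.\<close>
  define I where "I = {f\<in>(Basis::'a set) \<rightarrow>\<^sub>E (\<rat> \<times> \<rat> :: (real \<times> real) set).
    cbox (\<Sum>i\<in>Basis. fst (f i) *\<^sub>R i) (\<Sum>i\<in>Basis. snd (f i) *\<^sub>R i) \<subseteq> \<Omega>}"
  have cI: "countable I"
    unfolding I_def
    by (rule countable_subset[OF Collect_restrict]) (intro countable_PiE countable_SIGMA countable_rat, simp)
  have cover: "\<exists>f\<in>I. x \<in> box (\<Sum>i\<in>Basis. fst (f i) *\<^sub>R i) (\<Sum>i\<in>Basis. snd (f i) *\<^sub>R i)" if x: "x \<in> \<Omega>" for x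
  proof -
    obtain e where e: "0 < e" "cball x e \<subseteq> \<Omega>"
      using \<Omega> x unfolding open_contains_cball by blast
    obtain a b where ab: "\<forall>i\<in>Basis. a \<bullet> i \<in> \<rat> \<and> b \<bullet> i \<in> \<rat>" "x \<in> box a b" "box a b \<subseteq> ball x e"
      using rational_boxes[OF \<open>0 < e\<close>, of x] by blast
    have "cbox a b \<subseteq> cball x e"
    proof -
      have "box a b \<noteq> {}" using ab(2) by blast
      then show ?thesis using closure_mono[OF ab(3)] e(1) by (simp add: closure_box)
    qed
    then have sub: "cbox a b \<subseteq> \<Omega>" using e(2) by blast
    define f where "f = (\<lambda>i\<in>Basis. (a \<bullet> i, b \<bullet> i))"
    have "(\<Sum>i\<in>Basis. fst (f i) *\<^sub>R i) = (\<Sum>i\<in>Basis. (a \<bullet> i) *\<^sub>R i)"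
      "(\<Sum>i\<in>Basis. snd (f i) *\<^sub>R i) = (\<Sum>i\<in>Basis. (b \<bullet> i) *\<^sub>R i)"
      by (auto simp: f_def intro!: sum.cong)
    then have f: "(\<Sum>i\<in>Basis. fst (f i) *\<^sub>R i) = a" "(\<Sum>i\<in>Basis. snd (f i) *\<^sub>R i) = b"
      by (simp_all add: euclidean_representation)
    moreover have "f \<in> Basis \<rightarrow>\<^sub>E \<rat> \<times> \<rat>" using ab(1) by (auto simp: f_def)
    ultimately have "f \<in> I" using sub by (simp add: I_def)
    then show ?thesis using f ab(2) by (intro bexI[of _ f]) simp_all
  qed
  have "AE x in lebesgue. \<forall>f\<in>I. x \<in> box (\<Sum>i\<in>Basis. fst (f i) *\<^sub>R i) (\<Sum>i\<in>Basis. snd (f i) *\<^sub>R i) \<longrightarrow> w x = 0"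
    unfolding AE_ball_countable[OF cI] using cbox0 by (auto simp: I_def)
  then have "AE x in lebesgue. x \<in> \<Omega> \<longrightarrow> w x = 0"
    by eventually_elim (use cover in blast)
  then show ?thesis using \<Omega>L by (simp add: AE_lebesgue_on_iff)
qed

section \<open>Test functions\<close>

lemma test_function_differentiable: "test_function \<Omega> \<phi> \<Longrightarrow> \<phi> differentiable (at x)"
  unfolding test_function_def smooth_on_def
  by (metis Ck_on.simps(2) UNIV_I differentiable_on_def)

lemma test_function_add:
  assumes "test_function \<Omega> \<phi>" "test_function \<Omega> \<psi>"
  shows "test_function \<Omega> (\<lambda>x. \<phi> x + \<psi> x)"
proof -
  obtain K L where "compact K" "K \<subseteq> \<Omega>" "\<forall>x. x \<notin> K \<longrightarrow> \<phi> x = 0"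
    "compact L" "L \<subseteq> \<Omega>" "\<forall>x. x \<notin> L \<longrightarrow> \<psi> x = 0"
    using assms by (auto simp: test_function_def)
  then have "\<exists>K. compact K \<and> K \<subseteq> \<Omega> \<and> (\<forall>x. x \<notin> K \<longrightarrow> \<phi> x + \<psi> x = 0)"
    by (intro exI[of _ "K \<union> L"]) auto
  then show ?thesis
    using assms by (auto simp: test_function_def smooth_on_def intro: Ck_on_add)
qed

lemma test_function_mult:
  assumes "test_function \<Omega> \<phi>" "test_function \<Omega> \<psi>"
  shows "test_function \<Omega> (\<lambda>x. \<phi> x * \<psi> x)"
proof -
  obtain K where "compact K" "K \<subseteq> \<Omega>" "\<forall>x. x \<notin> K \<longrightarrow> \<phi> x = 0"
    using assms by (auto simp: test_function_def)
  then have "\<exists>K. compact K \<and> K \<subseteq> \<Omega> \<and> (\<forall>x. x \<notin> K \<longrightarrow> \<phi> x * \<psi> x = 0)"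
    by (intro exI[of _ K]) auto
  then show ?thesis
    using assms by (auto simp: test_function_def smooth_on_def intro: Ck_on_mult)
qed

lemma test_function_scale:
  assumes "test_function \<Omega> \<phi>"
  shows "test_function \<Omega> (\<lambda>x. c * \<phi> x)"
proof -
  obtain K where "compact K" "K \<subseteq> \<Omega>" "\<forall>x. x \<notin> K \<longrightarrow> \<phi> x = 0"
    using assms by (auto simp: test_function_def)
  then have "\<exists>K. compact K \<and> K \<subseteq> \<Omega> \<and> (\<forall>x. x \<notin> K \<longrightarrow> c * \<phi> x = 0)"
    by (intro exI[of _ K]) auto
  then show ?thesis
    using assms by (auto simp: test_function_def smooth_on_def intro: Ck_on_mult Ck_on_const)
qed

lemma frechet_derivative_zero_outside:
  assumes "compact K" "\<And>x. x \<notin> K \<Longrightarrow> \<phi> x = (0::real)" "x \<notin> K"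
  shows "frechet_derivative \<phi> (at x) = (\<lambda>h. 0)"
proof -
  have "((\<lambda>x. 0::real) has_derivative (\<lambda>h. 0)) (at x)" by simp
  then have "(\<phi> has_derivative (\<lambda>h. 0)) (at x)"
    by (rule has_derivative_transform_within_open[where s = "- K"])
      (use assms in \<open>auto dest: compact_imp_closed\<close>)
  then show ?thesis using frechet_derivative_at by metis
qed

lemma test_function_partial_deriv:
  assumes \<phi>: "test_function \<Omega> \<phi>" and i: "i \<in> Basis"
  shows "test_function \<Omega> (partial_deriv i \<phi>)"
proof -
  obtain K where K: "compact K" "K \<subseteq> \<Omega>" "\<And>x. x \<notin> K \<Longrightarrow> \<phi> x = 0"
    using \<phi> by (auto simp: test_function_def)
  have "Ck_on (Suc k) \<phi> UNIV" for k
    using \<phi> unfolding test_function_def smooth_on_def by blast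
  then have "Ck_on k (partial_deriv i \<phi>) UNIV" for k using i by simp
  moreover have "partial_deriv i \<phi> x = 0" if "x \<notin> K" for x
    using frechet_derivative_zero_outside[of K \<phi> x] K that by simp
  ultimately show ?thesis
    unfolding test_function_def smooth_on_def using K by blast
qed

lemma test_function_bounded_support:
  assumes "test_function \<Omega> \<phi>"
  obtains K B where "compact K" "K \<subseteq> \<Omega>" "\<And>x. x \<notin> K \<Longrightarrow> \<phi> x = 0" "\<And>x. \<bar>\<phi> x\<bar> \<le> B" "B > 0"
proof -
  obtain K where K: "compact K" "K \<subseteq> \<Omega>" "\<And>x. x \<notin> K \<Longrightarrow> \<phi> x = 0"
    using assms by (auto simp: test_function_def)
  have "continuous_on K \<phi>"
    using test_function_continuous[OF assms] continuous_on_subset by blast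
  then have "bounded (\<phi> ` K)"
    using K compact_continuous_image compact_imp_bounded by blast
  then obtain B where B: "B > 0" "\<And>x. x \<in> K \<Longrightarrow> \<bar>\<phi> x\<bar> \<le> B"
    by (auto simp: bounded_pos)
  have "\<bar>\<phi> x\<bar> \<le> B" for x
    using B K(3) by (cases "x \<in> K") auto
  with that K B show ?thesis by blast
qed

lemma frechet_derivative_eq_sum_partial:
  fixes \<phi> :: "'a::euclidean_space \<Rightarrow> real"
  assumes "\<phi> differentiable (at x)"
  shows "frechet_derivative \<phi> (at x) z = (\<Sum>i\<in>Basis. (z \<bullet> i) * partial_deriv i \<phi> x)"
proof -
  interpret linear "frechet_derivative \<phi> (at x)"
    by (rule linear_frechet_derivative[OF assms])
  have "frechet_derivative \<phi> (at x) (\<Sum>i\<in>Basis. (z \<bullet> i) *\<^sub>R i) = (\<Sum>i\<in>Basis. (z \<bullet> i) * partial_deriv i \<phi> x)"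
    by (simp add: sum scale)
  then show ?thesis by (simp add: euclidean_representation)
qed

lemma DERIV_along_line:
  fixes \<phi> :: "'a::euclidean_space \<Rightarrow> real"
  assumes "\<And>x. \<phi> differentiable (at x)"
  shows "((\<lambda>s. \<phi> (x + s *\<^sub>R z)) has_real_derivative frechet_derivative \<phi> (at (x + s *\<^sub>R z)) z) (at s)"
proof -
  have d: "(\<phi> has_derivative frechet_derivative \<phi> (at (x + s *\<^sub>R z))) (at (x + s *\<^sub>R z))"
    using assms frechet_derivative_works by blast
  have "((\<lambda>s. x + s *\<^sub>R z) has_derivative (\<lambda>h. h *\<^sub>R z)) (at s)"
    by (auto intro!: derivative_eq_intros)
  from has_derivative_compose[OF this d]
  have "((\<lambda>s. \<phi> (x + s *\<^sub>R z)) has_derivative (\<lambda>h. frechet_derivative \<phi> (at (x + s *\<^sub>R z)) (h *\<^sub>R z))) (at s)" .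
  moreover have "frechet_derivative \<phi> (at (x + s *\<^sub>R z)) (h *\<^sub>R z) = frechet_derivative \<phi> (at (x + s *\<^sub>R z)) z * h" for h
    using linear_frechet_derivative[OF assms[of "x + s *\<^sub>R z"]] by (simp add: linear_cmul)
  ultimately show ?thesis by (simp add: has_field_derivative_def)
qed

section \<open>Integrals over the whole space\<close>

lemma integral_lebesgue_on_eq_lborel:
  fixes f :: "'a::euclidean_space \<Rightarrow> real"
  assumes "\<Omega> \<in> sets lebesgue" "f \<in> borel_measurable borel" "\<And>x. x \<notin> \<Omega> \<Longrightarrow> f x = 0"
  shows "(LINT x|lebesgue_on \<Omega>. f x) = (LINT x|lborel. f x)"
proof -
  have "(LINT x|lebesgue_on UNIV. f x) = (LINT x|lebesgue_on \<Omega>. f x)"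
    using assms by (intro integral_lebesgue_on_supported) auto
  moreover have "(LINT x|lebesgue. f x) = (LINT x|lborel. f x)"
    using assms by (intro integral_completion) auto
  ultimately show ?thesis by (simp add: lebesgue_on_UNIV_eq)
qed

lemma integral_lborel_translate:
  fixes f :: "'a::euclidean_space \<Rightarrow> real"
  assumes [measurable]: "f \<in> borel_measurable borel"
  shows "(LINT x|lborel. f (x + a)) = (LINT x|lborel. f x)"
proof -
  have "(LINT x|lborel. f x) = (LINT x|distr lborel borel ((+) a). f x)"
    by (simp add: lborel_distr_plus)
  also have "\<dots> = (LINT x|lborel. f (a + x))"
    by (rule integral_distr) auto
  finally show ?thesis by (simp add: add.commute)
qed

lemma continuous_compact_support_integrable:
  fixes f :: "'a::euclidean_space \<Rightarrow> real"
  assumes "continuous_on UNIV f" "compact K" "\<And>x. x \<notin> K \<Longrightarrow> f x = 0"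
  shows "integrable lborel f"
proof -
  have "set_integrable lborel K f"
    unfolding set_integrable_def by (rule borel_integrable_compact) (use assms in \<open>auto intro: continuous_on_subset\<close>)
  moreover have "(\<lambda>x. indicator K x *\<^sub>R f x) = f"
    using assms(3) by (auto simp: fun_eq_iff indicator_def)
  ultimately show ?thesis by (simp add: set_integrable_def)
qed

lemma borel_measurable_test_function: "test_function \<Omega> \<phi> \<Longrightarrow> \<phi> \<in> borel_measurable borel"
  by (intro borel_measurable_continuous_onI test_function_continuous)

text \<open>Difference quotients of \<phi> have integral 0 by translation invariance, and dominated
  convergence passes to the derivative. Applied to a product this is integration by parts, without
  iterated integrals.\<close>

lemma integral_partial_deriv_eq_0:
  fixes \<phi> :: "'a::euclidean_space \<Rightarrow> real"
  assumes \<phi>: "test_function \<Omega> \<phi>" and i: "i \<in> Basis"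
  shows "(LINT x|lborel. partial_deriv i \<phi> x) = 0"
proof -
  have \<phi>m [measurable]: "\<phi> \<in> borel_measurable borel"
    using \<phi> by (rule borel_measurable_test_function)
  obtain K where K: "compact K" "\<And>x. x \<notin> K \<Longrightarrow> \<phi> x = 0"
    using test_function_bounded_support[OF \<phi>] by metis
  obtain B where B: "\<And>x. \<bar>partial_deriv i \<phi> x\<bar> \<le> B" "B > 0"
    using test_function_bounded_support[OF test_function_partial_deriv[OF \<phi> i]] by metis
  obtain R where R: "\<And>x. x \<in> K \<Longrightarrow> norm x \<le> R"
    using compact_imp_bounded[OF K(1)] by (auto simp: bounded_iff)
  define q where "q = (\<lambda>n x. (\<phi> (x + (1 / real (Suc n)) *\<^sub>R i) - \<phi> x) / (1 / real (Suc n)))"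
  have "(\<lambda>n. LINT x|lborel. q n x) \<longlonglongrightarrow> (LINT x|lborel. partial_deriv i \<phi> x)"
  \<comment> \<open>The mean value theorem bounds the quotients by \<open>B\<close>; since the shift
    has length at most 1, they vanish outside the ball of radius \<open>R + 1\<close>.\<close>
  proof (rule integral_dominated_convergence[where w = "\<lambda>x. B * indicator (cball 0 (R + 1)) x"])
    show "partial_deriv i \<phi> \<in> borel_measurable lborel"
      using borel_measurable_test_function[OF test_function_partial_deriv[OF \<phi> i]] by simp
    show "q n \<in> borel_measurable lborel" for n unfolding q_def by measurable
    have "integrable lborel (\<lambda>x. indicator (cball 0 (R + 1) :: 'a set) x *\<^sub>R B)"
      using emeasure_compact_finite[of "cball 0 (R + 1) :: 'a set"] by (intro integrable_indicator) auto
    then show "integrable lborel (\<lambda>x. B * indicator (cball (0::'a) (R + 1)) x)"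
      by (simp add: mult.commute)
    have tends: "(\<lambda>n. q n x) \<longlonglongrightarrow> partial_deriv i \<phi> x" for x
    proof -
      have "(\<lambda>h. (\<phi> (x + (0 + h) *\<^sub>R i) - \<phi> (x + 0 *\<^sub>R i)) / h) \<midarrow>0\<rightarrow> partial_deriv i \<phi> (x + 0 *\<^sub>R i)"
        using DERIV_along_line[of \<phi> x i 0] test_function_differentiable[OF \<phi>]
        unfolding DERIV_def by blast
      then have *: "(\<lambda>h. (\<phi> (x + h *\<^sub>R i) - \<phi> x) / h) \<midarrow>0\<rightarrow> partial_deriv i \<phi> x" by simp
      have "filterlim (\<lambda>n. 1 / real (Suc n)) (at 0) sequentially"
        by (rule filterlim_atI[OF LIMSEQ_Suc[OF lim_1_over_n]]) simp
      from filterlim_compose[OF * this] show ?thesis by (simp add: q_def)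
    qed
    then show "AE x in lborel. (\<lambda>n. q n x) \<longlonglongrightarrow> partial_deriv i \<phi> x" by simp
    have "norm (q n x) \<le> B * indicator (cball 0 (R + 1)) x" for n x
    proof (cases "norm x \<le> R + 1")
      case True
      let ?h = "1 / real (Suc n)"
      obtain s where "\<phi> (x + ?h *\<^sub>R i) - \<phi> (x + 0 *\<^sub>R i) = (?h - 0) * partial_deriv i \<phi> (x + s *\<^sub>R i)"
        using MVT2[of 0 ?h "\<lambda>s. \<phi> (x + s *\<^sub>R i)" "\<lambda>s. partial_deriv i \<phi> (x + s *\<^sub>R i)"]
          DERIV_along_line[of \<phi> x i] test_function_differentiable[OF \<phi>] by auto
      then have "q n x = partial_deriv i \<phi> (x + s *\<^sub>R i)"
        by (simp add: q_def)
      then show ?thesis using B True by simp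
    next
      case False
      define y where "y = (1 / real (Suc n)) *\<^sub>R i"
      have "norm y \<le> 1" using i by (simp add: y_def divide_le_eq)
      moreover have "norm x \<le> norm (x + y) + norm y"
        using norm_triangle_ineq4[of "x + y" y] by simp
      ultimately have "norm (x + y) > R" "norm x > R" using False by linarith+
      then have "x + (1 / real (Suc n)) *\<^sub>R i \<notin> K" "x \<notin> K"
        using R unfolding y_def by force+
      then show ?thesis using K(2) B(2) by (simp add: q_def)
    qed
    then show "AE x in lborel. norm (q n x) \<le> B * indicator (cball 0 (R + 1)) x" for n by simp
  qed
  moreover have "(LINT x|lborel. q n x) = 0" for n
  proof -
    have i1: "integrable lborel \<phi>"
      using continuous_compact_support_integrable test_function_continuous[OF \<phi>] K by blast
    have i2: "integrable lborel (\<lambda>x. \<phi> (x + a))" for a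
    proof (rule continuous_compact_support_integrable[where K = "(\<lambda>x. - a + x) ` K"])
      show "continuous_on UNIV (\<lambda>x. \<phi> (x + a))"
        by (rule continuous_on_compose2[OF test_function_continuous[OF \<phi>]]) (auto intro!: continuous_intros)
      show "\<phi> (x + a) = 0" if "x \<notin> (\<lambda>x. - a + x) ` K" for x
      proof (rule K(2))
        show "x + a \<notin> K" using that by (metis add.commute add_diff_cancel_left' image_eqI uminus_add_conv_diff)
      qed
      show "compact ((\<lambda>x. - a + x) ` K)" using K(1) by (rule compact_translation)
    qed
    show ?thesis
      unfolding q_def using i1 i2 by (simp add: integral_lborel_translate)
  qed
  ultimately have "(\<lambda>n::nat. 0) \<longlonglongrightarrow> (LINT x|lborel. partial_deriv i \<phi> x)"
    by (simp only:)
  then show ?thesis by (simp add: LIMSEQ_const_iff)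
qed

section \<open>Weak derivatives\<close>

lemma integrable_lebesgue_on_subset:
  fixes f :: "'a::euclidean_space \<Rightarrow> real"
  assumes "integrable (lebesgue_on \<Omega>) f" "\<Omega> \<in> sets lebesgue" "K \<in> sets lebesgue" "K \<subseteq> \<Omega>"
  shows "integrable (lebesgue_on K) f"
proof -
  have "integrable lebesgue (\<lambda>x. indicator \<Omega> x *\<^sub>R f x)"
    by (rule integrable_restrict_space[THEN iffD1]) (use assms in auto)
  then have "integrable lebesgue (\<lambda>x. indicator K x *\<^sub>R (indicator \<Omega> x *\<^sub>R f x))"
    by (rule integrable_mult_indicator[rotated]) (use assms in auto)
  moreover have "(\<lambda>x. indicator K x *\<^sub>R (indicator \<Omega> x *\<^sub>R f x)) = (\<lambda>x. indicator K x *\<^sub>R f x)"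
    using assms by (auto simp: indicator_def fun_eq_iff)
  ultimately have "integrable lebesgue (\<lambda>x. indicator K x *\<^sub>R f x)" by simp
  then show ?thesis
    by (intro integrable_restrict_space[THEN iffD2]) (use assms in auto)
qed

lemma integrable_lebesgue_on_superset:
  fixes f :: "'a::euclidean_space \<Rightarrow> real"
  assumes "integrable (lebesgue_on K) f" "\<Omega> \<in> sets lebesgue" "K \<in> sets lebesgue" "K \<subseteq> \<Omega>"
    "\<And>x. x \<in> \<Omega> - K \<Longrightarrow> f x = 0"
  shows "integrable (lebesgue_on \<Omega>) f"
proof -
  have "integrable lebesgue (\<lambda>x. indicator K x *\<^sub>R f x)"
    by (rule integrable_restrict_space[THEN iffD1]) (use assms in auto)
  moreover have "(\<lambda>x. indicator K x *\<^sub>R f x) = (\<lambda>x. indicator \<Omega> x *\<^sub>R f x)"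
    using assms by (auto simp: indicator_def fun_eq_iff)
  ultimately have "integrable lebesgue (\<lambda>x. indicator \<Omega> x *\<^sub>R f x)" by simp
  then show ?thesis
    by (intro integrable_restrict_space[THEN iffD2]) (use assms in auto)
qed

lemma compact_sets_lebesgue: "compact K \<Longrightarrow> K \<in> sets lebesgue"
  using lmeasurable_compact by (rule fmeasurableD)

lemma locally_integrable_add:
  "locally_integrable \<Omega> u \<Longrightarrow> locally_integrable \<Omega> v \<Longrightarrow> locally_integrable \<Omega> (\<lambda>x. u x + v x)"
  by (simp add: locally_integrable_def)

lemma locally_integrable_scale:
  "locally_integrable \<Omega> u \<Longrightarrow> locally_integrable \<Omega> (\<lambda>x. c * u x)"
  by (simp add: locally_integrable_def)

lemma locally_integrable_diff:
  "locally_integrable \<Omega> u \<Longrightarrow> locally_integrable \<Omega> v \<Longrightarrow> locally_integrable \<Omega> (\<lambda>x. u x - v x)"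
  by (simp add: locally_integrable_def)

lemma L2_locally_integrable:
  assumes "u \<in> L2_space \<Omega>" "\<Omega> \<in> sets lebesgue"
  shows "locally_integrable \<Omega> u"
  unfolding locally_integrable_def
proof (intro allI impI)
  fix K assume K: "compact K \<and> K \<subseteq> \<Omega>"
  then have KL: "K \<in> sets lebesgue" by (simp add: compact_sets_lebesgue)
  interpret finite_measure "lebesgue_on K"
    using K by (intro finite_measure_lebesgue_on lmeasurable_compact) simp
  show "integrable (lebesgue_on K) u"
  proof (rule Bochner_Integration.integrable_bound[where f = "\<lambda>x. 1 + (u x)\<^sup>2"])
    have "integrable (lebesgue_on K) (\<lambda>x. (u x)\<^sup>2)"
      using integrable_lebesgue_on_subset[OF L2_square_integrable[OF assms(1)] assms(2) KL] K by blast
    moreover have "integrable (lebesgue_on K) (\<lambda>x. 1 :: real)"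
      by (rule integrable_const)
    ultimately show "integrable (lebesgue_on K) (\<lambda>x. 1 + (u x)\<^sup>2)" by simp
    show "u \<in> borel_measurable (lebesgue_on K)"
      using measurable_restrict_mono L2_measurable[OF assms(1)] K by blast
    have "norm (u x) \<le> norm (1 + (u x)\<^sup>2)" for x
      using sum_squares_bound[of 1 "\<bar>u x\<bar>"] by (simp add: abs_if split: if_splits)
    then show "AE x in lebesgue_on K. norm (u x) \<le> norm (1 + (u x)\<^sup>2)" by simp
  qed
qed

lemma locally_integrable_AE_cong:
  assumes u: "locally_integrable \<Omega> u" and \<Omega>: "\<Omega> \<in> sets lebesgue"
    and ae: "AE x in lebesgue_on \<Omega>. u x = v x"
  shows "locally_integrable \<Omega> v"
  unfolding locally_integrable_def
proof (intro allI impI)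
  fix K assume K: "compact K \<and> K \<subseteq> \<Omega>"
  then have KL: "K \<in> sets lebesgue" by (simp add: compact_sets_lebesgue)
  have i: "integrable (lebesgue_on K) u" using u K by (simp add: locally_integrable_def)
  have aeK: "AE x in lebesgue_on K. u x = v x"
    using ae K KL \<Omega> by (auto simp: AE_lebesgue_on_iff elim!: eventually_mono)
  have "v \<in> borel_measurable (lebesgue_on K)"
    using borel_measurable_lebesgue_on_AE[OF borel_measurable_integrable[OF i] KL aeK] .
  then show "integrable (lebesgue_on K) v"
    using i aeK integrable_cong_AE borel_measurable_integrable by blast
qed

lemma integrable_mult_test_function:
  assumes w: "locally_integrable \<Omega> w" and \<phi>: "test_function \<Omega> \<phi>" and \<Omega>: "\<Omega> \<in> sets lebesgue"
  shows "integrable (lebesgue_on \<Omega>) (\<lambda>x. w x * \<phi> x)"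
proof -
  obtain K B where K: "compact K" "K \<subseteq> \<Omega>" "\<And>x. x \<notin> K \<Longrightarrow> \<phi> x = 0" "\<And>x. \<bar>\<phi> x\<bar> \<le> B"
    using test_function_bounded_support[OF \<phi>] by metis
  have KL: "K \<in> sets lebesgue" using K by (simp add: compact_sets_lebesgue)
  have i: "integrable (lebesgue_on K) w" using w K by (simp add: locally_integrable_def)
  have "integrable (lebesgue_on K) (\<lambda>x. w x * \<phi> x)"
  proof (rule Bochner_Integration.integrable_bound[where f = "\<lambda>x. w x * B"])
    have "\<phi> \<in> borel_measurable (lebesgue_on K)"
      using test_function_continuous[OF \<phi>] KL
      by (intro continuous_imp_measurable_on_sets_lebesgue) (auto intro: continuous_on_subset)
    then show "(\<lambda>x. w x * \<phi> x) \<in> borel_measurable (lebesgue_on K)"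
      using i by (auto intro: borel_measurable_times)
    have "norm (w x * \<phi> x) \<le> norm (w x * B)" for x
      using K(4)[of x] by (auto simp: abs_mult intro!: mult_left_mono)
    then show "AE x in lebesgue_on K. norm (w x * \<phi> x) \<le> norm (w x * B)" by simp
  qed (use i in auto)
  then show ?thesis
    by (rule integrable_lebesgue_on_superset) (use \<Omega> KL K in auto)
qed

lemma has_weak_deriv_unique:
  assumes \<Omega>: "open \<Omega>" and v: "has_weak_deriv \<Omega> i u v" and w: "has_weak_deriv \<Omega> i u w"
  shows "AE x in lebesgue_on \<Omega>. v x = w x"
proof -
  have \<Omega>L: "\<Omega> \<in> sets lebesgue" using \<Omega> by (rule open_sets_lebesgue)
  have li: "locally_integrable \<Omega> v" "locally_integrable \<Omega> w"
    using v w by (auto simp: has_weak_deriv_def)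
  have "AE x in lebesgue_on \<Omega>. v x - w x = 0"
  proof (rule fundamental_lemma_calculus_of_variations[OF \<Omega>])
    show "locally_integrable \<Omega> (\<lambda>x. v x - w x)" using li by (rule locally_integrable_diff)
    fix \<phi> assume \<phi>: "test_function \<Omega> \<phi>"
    have "(LINT x|lebesgue_on \<Omega>. (v x - w x) * \<phi> x)
        = (LINT x|lebesgue_on \<Omega>. v x * \<phi> x) - (LINT x|lebesgue_on \<Omega>. w x * \<phi> x)"
      using integrable_mult_test_function[OF _ \<phi> \<Omega>L] li by (simp add: left_diff_distrib)
    also have "\<dots> = 0"
      using v w \<phi> unfolding has_weak_deriv_def by (metis add.inverse_inverse diff_self)
    finally show "(LINT x|lebesgue_on \<Omega>. (v x - w x) * \<phi> x) = 0" .
  qed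
  then show ?thesis by simp
qed

lemma has_weak_deriv_AE_cong:
  assumes u: "has_weak_deriv \<Omega> i u v" and \<Omega>: "\<Omega> \<in> sets lebesgue" and i: "i \<in> Basis"
    and ae: "AE x in lebesgue_on \<Omega>. u x = u' x" "AE x in lebesgue_on \<Omega>. v x = v' x"
  shows "has_weak_deriv \<Omega> i u' v'"
proof -
  have li: "locally_integrable \<Omega> u" "locally_integrable \<Omega> v"
    using u by (auto simp: has_weak_deriv_def)
  have li': "locally_integrable \<Omega> u'" "locally_integrable \<Omega> v'"
    using li ae \<Omega> locally_integrable_AE_cong by blast+
  have "(LINT x|lebesgue_on \<Omega>. u' x * partial_deriv i \<phi> x) = - (LINT x|lebesgue_on \<Omega>. v' x * \<phi> x)"
    if \<phi>: "test_function \<Omega> \<phi>" for \<phi>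
  proof -
    have "(LINT x|lebesgue_on \<Omega>. u' x * partial_deriv i \<phi> x) = (LINT x|lebesgue_on \<Omega>. u x * partial_deriv i \<phi> x)"
      using integrable_mult_test_function[OF _ test_function_partial_deriv[OF \<phi> i] \<Omega>] li li' ae
      by (intro integral_cong_AE) auto
    moreover have "(LINT x|lebesgue_on \<Omega>. v' x * \<phi> x) = (LINT x|lebesgue_on \<Omega>. v x * \<phi> x)"
      using integrable_mult_test_function[OF _ \<phi> \<Omega>] li li' ae
      by (intro integral_cong_AE) auto
    ultimately show ?thesis using u \<phi> by (simp add: has_weak_deriv_def)
  qed
  then show ?thesis using li' by (simp add: has_weak_deriv_def)
qed

text \<open>A true equality of functions: \<open>weak_deriv\<close> is a choice that depends only on
  the predicate \<open>has_weak_deriv \<Omega> i u\<close>, and this predicate is the same for both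
  functions.\<close>

lemma weak_deriv_AE_cong:
  assumes "\<Omega> \<in> sets lebesgue" "i \<in> Basis" "AE x in lebesgue_on \<Omega>. u x = u' x"
  shows "weak_deriv \<Omega> i u = weak_deriv \<Omega> i u'"
proof -
  have "has_weak_deriv \<Omega> i u v \<longleftrightarrow> has_weak_deriv \<Omega> i u' v" for v
  proof
    show "has_weak_deriv \<Omega> i u v \<Longrightarrow> has_weak_deriv \<Omega> i u' v"
      using has_weak_deriv_AE_cong[of \<Omega> i u v u' v] assms by simp
    have "AE x in lebesgue_on \<Omega>. u' x = u x" using assms(3) by eventually_elim simp
    then show "has_weak_deriv \<Omega> i u' v \<Longrightarrow> has_weak_deriv \<Omega> i u v"
      using has_weak_deriv_AE_cong[of \<Omega> i u' v u v] assms by simp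
  qed
  then show ?thesis by (simp add: weak_deriv_def)
qed

lemma has_weak_deriv_weak_deriv:
  "has_weak_deriv \<Omega> i u v \<Longrightarrow> has_weak_deriv \<Omega> i u (weak_deriv \<Omega> i u)"
  unfolding weak_deriv_def by (rule someI[of "has_weak_deriv \<Omega> i u"])

lemma weak_deriv_AE_eq:
  assumes "open \<Omega>" "has_weak_deriv \<Omega> i u v"
  shows "AE x in lebesgue_on \<Omega>. weak_deriv \<Omega> i u x = v x"
  using has_weak_deriv_unique[OF assms(1) has_weak_deriv_weak_deriv[OF assms(2)] assms(2)] .

lemma has_weak_deriv_lincomb:
  assumes \<Omega>: "\<Omega> \<in> sets lebesgue" and i: "i \<in> Basis"
    and u: "has_weak_deriv \<Omega> i u u'" and v: "has_weak_deriv \<Omega> i v v'"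
  shows "has_weak_deriv \<Omega> i (\<lambda>x. c * u x + d * v x) (\<lambda>x. c * u' x + d * v' x)"
proof -
  have li: "locally_integrable \<Omega> u" "locally_integrable \<Omega> v" "locally_integrable \<Omega> u'" "locally_integrable \<Omega> v'"
    using u v by (auto simp: has_weak_deriv_def)
  have lin: "(LINT x|lebesgue_on \<Omega>. (c * f x + d * g x) * \<phi> x) =
      c * (LINT x|lebesgue_on \<Omega>. f x * \<phi> x) + d * (LINT x|lebesgue_on \<Omega>. g x * \<phi> x)"
    if "locally_integrable \<Omega> f" "locally_integrable \<Omega> g" "test_function \<Omega> \<phi>" for f g \<phi>
  proof -
    have "(\<lambda>x. (c * f x + d * g x) * \<phi> x) = (\<lambda>x. c * (f x * \<phi> x) + d * (g x * \<phi> x))"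
      by (simp add: algebra_simps)
    then show ?thesis
      using integrable_mult_test_function[OF _ that(3) \<Omega>] that(1,2) by simp
  qed
  have "(LINT x|lebesgue_on \<Omega>. (c * u x + d * v x) * partial_deriv i \<phi> x)
      = - (LINT x|lebesgue_on \<Omega>. (c * u' x + d * v' x) * \<phi> x)" if \<phi>: "test_function \<Omega> \<phi>" for \<phi>
    using u v \<phi> lin[OF li(1,2) test_function_partial_deriv[OF \<phi> i]] lin[OF li(3,4) \<phi>]
    by (simp add: has_weak_deriv_def)
  then show ?thesis
    unfolding has_weak_deriv_def
    by (intro conjI locally_integrable_add locally_integrable_scale li allI impI)
qed

section \<open>The Sobolev spaces\<close>

lemma H1_L2: "u \<in> H1_space \<Omega> \<Longrightarrow> u \<in> L2_space \<Omega>"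
  by (simp add: H1_space_def)

lemma H1_has_weak_deriv:
  "u \<in> H1_space \<Omega> \<Longrightarrow> i \<in> Basis \<Longrightarrow> has_weak_deriv \<Omega> i u (weak_deriv \<Omega> i u)"
  unfolding H1_space_def using has_weak_deriv_weak_deriv by blast

lemma AE_sym: "AE x in M. f x = g x \<Longrightarrow> AE x in M. g x = f x"
  by (auto elim: eventually_mono)

lemma H1_weak_deriv_L2:
  assumes "open \<Omega>" "u \<in> H1_space \<Omega>" "i \<in> Basis"
  shows "weak_deriv \<Omega> i u \<in> L2_space \<Omega>"
proof -
  obtain v where v: "v \<in> L2_space \<Omega>" "has_weak_deriv \<Omega> i u v"
    using assms by (auto simp: H1_space_def)
  show ?thesis
    using L2_AE_cong[OF v(1) open_sets_lebesgue[OF assms(1)] AE_sym[OF weak_deriv_AE_eq[OF assms(1) v(2)]]] .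
qed

lemma H1_lincomb:
  assumes \<Omega>: "open \<Omega>" and u: "u \<in> H1_space \<Omega>" and v: "v \<in> H1_space \<Omega>"
  shows "(\<lambda>x. c * u x + d * v x) \<in> H1_space \<Omega>"
    and "i \<in> Basis \<Longrightarrow> AE x in lebesgue_on \<Omega>. weak_deriv \<Omega> i (\<lambda>x. c * u x + d * v x) x
      = c * weak_deriv \<Omega> i u x + d * weak_deriv \<Omega> i v x"
proof -
  have \<Omega>L: "\<Omega> \<in> sets lebesgue" using \<Omega> by (rule open_sets_lebesgue)
  have wd: "has_weak_deriv \<Omega> i (\<lambda>x. c * u x + d * v x) (\<lambda>x. c * weak_deriv \<Omega> i u x + d * weak_deriv \<Omega> i v x)"
    if "i \<in> Basis" for i
    using has_weak_deriv_lincomb[OF \<Omega>L that] H1_has_weak_deriv u v that by blast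
  have L: "(\<lambda>x. c * weak_deriv \<Omega> i u x + d * weak_deriv \<Omega> i v x) \<in> L2_space \<Omega>" if "i \<in> Basis" for i
    by (intro L2_add L2_scale H1_weak_deriv_L2[OF \<Omega>] u v that)
  show "(\<lambda>x. c * u x + d * v x) \<in> H1_space \<Omega>"
    unfolding H1_space_def using wd L H1_L2[OF u] H1_L2[OF v] by auto
  show "i \<in> Basis \<Longrightarrow> AE x in lebesgue_on \<Omega>. weak_deriv \<Omega> i (\<lambda>x. c * u x + d * v x) x
      = c * weak_deriv \<Omega> i u x + d * weak_deriv \<Omega> i v x"
    using weak_deriv_AE_eq[OF \<Omega> wd] .
qed

lemma H1_diff:
  assumes \<Omega>: "open \<Omega>" and u: "u \<in> H1_space \<Omega>" and v: "v \<in> H1_space \<Omega>"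
  shows "(\<lambda>x. u x - v x) \<in> H1_space \<Omega>"
    and "i \<in> Basis \<Longrightarrow> AE x in lebesgue_on \<Omega>. weak_deriv \<Omega> i (\<lambda>x. u x - v x) x
      = weak_deriv \<Omega> i u x - weak_deriv \<Omega> i v x"
  using H1_lincomb[OF assms, where c = 1 and d = "-1"] by simp_all

lemma H1_AE_cong:
  assumes \<Omega>: "open \<Omega>" and u: "u \<in> H1_space \<Omega>" and ae: "AE x in lebesgue_on \<Omega>. u x = v x"
  shows "v \<in> H1_space \<Omega>"
proof -
  have \<Omega>L: "\<Omega> \<in> sets lebesgue" using \<Omega> by (rule open_sets_lebesgue)
  have "has_weak_deriv \<Omega> i v (weak_deriv \<Omega> i u)" if "i \<in> Basis" for i
    using has_weak_deriv_AE_cong[OF H1_has_weak_deriv[OF u that] \<Omega>L that ae] by simp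
  moreover have "v \<in> L2_space \<Omega>" using L2_AE_cong[OF H1_L2[OF u] \<Omega>L ae] .
  ultimately show ?thesis
    unfolding H1_space_def using H1_weak_deriv_L2[OF \<Omega> u] by blast
qed

section \<open>Test functions as Sobolev functions\<close>

text \<open>The square of \<phi> is the locally integrable function \<phi> multiplied by the test
  function \<phi>.\<close>

lemma test_function_L2:
  assumes \<phi>: "test_function \<Omega> \<phi>" and \<Omega>: "\<Omega> \<in> sets lebesgue"
  shows "\<phi> \<in> L2_space \<Omega>"
proof -
  have m: "\<phi> \<in> borel_measurable (lebesgue_on \<Omega>)"
    using test_function_continuous[OF \<phi>] \<Omega>
    by (intro continuous_imp_measurable_on_sets_lebesgue) (auto intro: continuous_on_subset)
  have "locally_integrable \<Omega> \<phi>"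
    unfolding locally_integrable_def
  proof (intro allI impI)
    fix K assume K: "compact K \<and> K \<subseteq> \<Omega>"
    then have "integrable lborel (\<lambda>x. indicator K x *\<^sub>R \<phi> x)"
      using test_function_continuous[OF \<phi>]
      by (intro borel_integrable_compact) (auto intro: continuous_on_subset)
    then have "integrable lebesgue (\<lambda>x. indicator K x *\<^sub>R \<phi> x)"
      using integrable_completion borel_measurable_integrable by blast
    then show "integrable (lebesgue_on K) \<phi>"
      by (intro integrable_restrict_space[THEN iffD2]) (use K in \<open>auto simp: compact_sets_lebesgue\<close>)
  qed
  from integrable_mult_test_function[OF this \<phi> \<Omega>] m show ?thesis
    by (simp add: L2_space_def power2_eq_square)
qed

text \<open>The product of two test functions is a test function, so the integral of its partial
  derivative is 0; the product rule splits it into the two sides of the definition.\<close>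

lemma test_function_has_weak_deriv:
  assumes \<Omega>: "open \<Omega>" and \<phi>: "test_function \<Omega> \<phi>" and i: "i \<in> Basis"
  shows "has_weak_deriv \<Omega> i \<phi> (partial_deriv i \<phi>)"
proof -
  have \<Omega>L: "\<Omega> \<in> sets lebesgue" using \<Omega> by (rule open_sets_lebesgue)
  note \<phi>' = test_function_partial_deriv[OF \<phi> i]
  have "(LINT x|lebesgue_on \<Omega>. \<phi> x * partial_deriv i \<psi> x) = - (LINT x|lebesgue_on \<Omega>. partial_deriv i \<phi> x * \<psi> x)"
    if \<psi>: "test_function \<Omega> \<psi>" for \<psi>
  proof -
    note \<psi>' = test_function_partial_deriv[OF \<psi> i]
    note \<phi>\<psi> = test_function_mult[OF \<phi> \<psi>]
    note L = test_function_L2[OF _ \<Omega>L]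
    note d = test_function_differentiable
    have "(LINT x|lebesgue_on \<Omega>. \<phi> x * partial_deriv i \<psi> x + partial_deriv i \<phi> x * \<psi> x)
        = (LINT x|lebesgue_on \<Omega>. partial_deriv i (\<lambda>x. \<phi> x * \<psi> x) x)"
      by (simp add: partial_deriv_mult d[OF \<phi>] d[OF \<psi>])
    also have "\<dots> = (LINT x|lborel. partial_deriv i (\<lambda>x. \<phi> x * \<psi> x) x)"
    proof (rule integral_lebesgue_on_eq_lborel[OF \<Omega>L])
      show "partial_deriv i (\<lambda>x. \<phi> x * \<psi> x) \<in> borel_measurable borel"
        by (rule borel_measurable_test_function[OF test_function_partial_deriv[OF \<phi>\<psi> i]])
      show "partial_deriv i (\<lambda>x. \<phi> x * \<psi> x) x = 0" if "x \<notin> \<Omega>" for x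
        using test_function_partial_deriv[OF \<phi>\<psi> i] that by (auto simp: test_function_def)
    qed
    also have "\<dots> = 0" by (rule integral_partial_deriv_eq_0[OF \<phi>\<psi> i])
    finally show ?thesis
      using L2_mult_integrable[OF L[OF \<phi>] L[OF \<psi>']] L2_mult_integrable[OF L[OF \<phi>'] L[OF \<psi>]] by simp
  qed
  then show ?thesis
    using test_function_L2[OF \<phi> \<Omega>L] test_function_L2[OF \<phi>' \<Omega>L] L2_locally_integrable[OF _ \<Omega>L]
    by (simp add: has_weak_deriv_def)
qed

lemma test_function_weak_deriv:
  assumes "open \<Omega>" "test_function \<Omega> \<phi>" "i \<in> Basis"
  shows "AE x in lebesgue_on \<Omega>. weak_deriv \<Omega> i \<phi> x = partial_deriv i \<phi> x"
  using weak_deriv_AE_eq[OF assms(1) test_function_has_weak_deriv[OF assms]] .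

lemma test_function_H1:
  assumes "open \<Omega>" "test_function \<Omega> \<phi>"
  shows "\<phi> \<in> H1_space \<Omega>"
  unfolding H1_space_def
  using test_function_L2[OF _ open_sets_lebesgue[OF assms(1)]] assms
    test_function_has_weak_deriv test_function_partial_deriv by blast

section \<open>Convergence in H1, component by component\<close>

lemma H1_norm_nonneg: "0 \<le> H1_norm \<Omega> u"
  by (simp add: H1_norm_def sum_nonneg)

lemma Lnorm_le_H1_norm: "Lnorm \<Omega> 2 u \<le> H1_norm \<Omega> u"
  unfolding H1_norm_def by (intro real_le_rsqrt) (auto intro: sum_nonneg)

lemma Lnorm_weak_deriv_le_H1_norm:
  assumes "i \<in> Basis"
  shows "Lnorm \<Omega> 2 (weak_deriv \<Omega> i u) \<le> H1_norm \<Omega> u"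
  unfolding H1_norm_def
  using member_le_sum[OF assms, of "\<lambda>i. (Lnorm \<Omega> 2 (weak_deriv \<Omega> i u))\<^sup>2"]
  by (intro real_le_rsqrt) (auto intro: add_increasing)

lemma H1_norm_le: "H1_norm \<Omega> u \<le> Lnorm \<Omega> 2 u + (\<Sum>i\<in>Basis. Lnorm \<Omega> 2 (weak_deriv \<Omega> i u))"
proof -
  have "H1_norm \<Omega> u \<le> sqrt ((Lnorm \<Omega> 2 u)\<^sup>2) + sqrt (\<Sum>i\<in>Basis. (Lnorm \<Omega> 2 (weak_deriv \<Omega> i u))\<^sup>2)"
    unfolding H1_norm_def by (intro sqrt_add_le_add_sqrt) (auto intro: sum_nonneg)
  also have "\<dots> \<le> Lnorm \<Omega> 2 u + (\<Sum>i\<in>Basis. Lnorm \<Omega> 2 (weak_deriv \<Omega> i u))"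
    using L2_set_le_sum[of Basis "\<lambda>i. Lnorm \<Omega> 2 (weak_deriv \<Omega> i u)"] by (simp add: L2_set_def)
  finally show ?thesis .
qed

text \<open>Together with \<open>H1_norm_tendsto_0I\<close> this replaces H1 convergence by L^2
  convergence of the function and of its weak derivatives, so that later limits use L^2 calculus
  only.\<close>

lemma H1_norm_tendsto_imp:
  assumes \<Omega>: "open \<Omega>" and l: "l \<in> H1_space \<Omega>" and f: "\<forall>\<^sub>F s in F. f s \<in> H1_space \<Omega>"
    and lim: "((\<lambda>s. H1_norm \<Omega> (\<lambda>x. f s x - l x)) \<longlongrightarrow> 0) F"
  shows "L2_tendsto \<Omega> f l F"
    and "i \<in> Basis \<Longrightarrow> L2_tendsto \<Omega> (\<lambda>s. weak_deriv \<Omega> i (f s)) (weak_deriv \<Omega> i l) F"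
proof -
  have "((\<lambda>s. Lnorm \<Omega> 2 (\<lambda>x. f s x - l x)) \<longlongrightarrow> 0) F"
    by (rule tendsto_0_Lnorm_le[OF _ lim]) (simp add: Lnorm_le_H1_norm)
  moreover have "\<forall>\<^sub>F s in F. f s \<in> L2_space \<Omega>" using f by eventually_elim (rule H1_L2)
  ultimately show "L2_tendsto \<Omega> f l F"
    using H1_L2[OF l] by (simp add: L2_tendsto_def)
  show "L2_tendsto \<Omega> (\<lambda>s. weak_deriv \<Omega> i (f s)) (weak_deriv \<Omega> i l) F" if i: "i \<in> Basis"
  proof -
    have "((\<lambda>s. Lnorm \<Omega> 2 (\<lambda>x. weak_deriv \<Omega> i (f s) x - weak_deriv \<Omega> i l x)) \<longlongrightarrow> 0) F"
    proof (rule tendsto_0_Lnorm_le[OF _ lim])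
      show "\<forall>\<^sub>F s in F. Lnorm \<Omega> 2 (\<lambda>x. weak_deriv \<Omega> i (f s) x - weak_deriv \<Omega> i l x)
          \<le> H1_norm \<Omega> (\<lambda>x. f s x - l x)"
        using f
      proof eventually_elim
        case (elim s)
        have "Lnorm \<Omega> 2 (\<lambda>x. weak_deriv \<Omega> i (f s) x - weak_deriv \<Omega> i l x)
            = Lnorm \<Omega> 2 (weak_deriv \<Omega> i (\<lambda>x. f s x - l x))"
          using H1_weak_deriv_L2[OF \<Omega> _ i] elim l
          by (intro Lnorm_2_AE_cong AE_sym[OF H1_diff(2)] open_sets_lebesgue \<Omega> i) auto
        then show ?case using Lnorm_weak_deriv_le_H1_norm[OF i] by simp
      qed
    qed
    moreover have "\<forall>\<^sub>F s in F. weak_deriv \<Omega> i (f s) \<in> L2_space \<Omega>"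
      using f by eventually_elim (rule H1_weak_deriv_L2[OF \<Omega> _ i])
    ultimately show ?thesis
      using H1_weak_deriv_L2[OF \<Omega> l i] by (simp add: L2_tendsto_def)
  qed
qed

lemma H1_norm_tendsto_0I:
  assumes \<Omega>: "open \<Omega>" and l: "l \<in> H1_space \<Omega>" and f: "\<forall>\<^sub>F s in F. f s \<in> H1_space \<Omega>"
    and 0: "L2_tendsto \<Omega> f l F"
    and 1: "\<And>i. i \<in> Basis \<Longrightarrow> L2_tendsto \<Omega> (\<lambda>s. weak_deriv \<Omega> i (f s)) (weak_deriv \<Omega> i l) F"
  shows "((\<lambda>s. H1_norm \<Omega> (\<lambda>x. f s x - l x)) \<longlongrightarrow> 0) F"
proof (rule tendsto_sandwich[OF _ _ tendsto_const])
  show "\<forall>\<^sub>F s in F. 0 \<le> H1_norm \<Omega> (\<lambda>x. f s x - l x)"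
    by (simp add: H1_norm_def sum_nonneg)
  show "\<forall>\<^sub>F s in F. H1_norm \<Omega> (\<lambda>x. f s x - l x) \<le> Lnorm \<Omega> 2 (\<lambda>x. f s x - l x) +
      (\<Sum>i\<in>Basis. Lnorm \<Omega> 2 (\<lambda>x. weak_deriv \<Omega> i (f s) x - weak_deriv \<Omega> i l x))"
    using f
  proof eventually_elim
    case (elim s)
    have "Lnorm \<Omega> 2 (weak_deriv \<Omega> i (\<lambda>x. f s x - l x))
        = Lnorm \<Omega> 2 (\<lambda>x. weak_deriv \<Omega> i (f s) x - weak_deriv \<Omega> i l x)" if i: "i \<in> Basis" for i
      using H1_weak_deriv_L2[OF \<Omega> H1_diff(1)[OF \<Omega> elim l] i]
      by (intro Lnorm_2_AE_cong H1_diff(2) open_sets_lebesgue \<Omega> i elim l) auto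
    then show ?case using H1_norm_le[of \<Omega> "\<lambda>x. f s x - l x"] by simp
  qed
  have "((\<lambda>s. Lnorm \<Omega> 2 (\<lambda>x. f s x - l x) +
      (\<Sum>i\<in>Basis. Lnorm \<Omega> 2 (\<lambda>x. weak_deriv \<Omega> i (f s) x - weak_deriv \<Omega> i l x))) \<longlongrightarrow> 0 + (\<Sum>i\<in>(Basis::'a set). 0)) F"
    using 0 1 by (intro tendsto_add tendsto_sum) (auto simp: L2_tendsto_def)
  then show "((\<lambda>s. Lnorm \<Omega> 2 (\<lambda>x. f s x - l x) +
      (\<Sum>i\<in>Basis. Lnorm \<Omega> 2 (\<lambda>x. weak_deriv \<Omega> i (f s) x - weak_deriv \<Omega> i l x))) \<longlongrightarrow> 0) F" by simp
qed

section \<open>The space H01\<close>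

lemma H01_H1: "u \<in> H01_space \<Omega> \<Longrightarrow> u \<in> H1_space \<Omega>"
  by (simp add: H01_space_def)

lemma H01_L2: "u \<in> H01_space \<Omega> \<Longrightarrow> u \<in> L2_space \<Omega>"
  by (simp add: H01_H1 H1_L2)

lemma H01_iff:
  assumes \<Omega>: "open \<Omega>"
  shows "u \<in> H01_space \<Omega> \<longleftrightarrow> u \<in> H1_space \<Omega> \<and> (\<exists>\<phi>. (\<forall>n. test_function \<Omega> (\<phi> n)) \<and>
    L2_tendsto \<Omega> \<phi> u sequentially \<and>
    (\<forall>i\<in>Basis. L2_tendsto \<Omega> (\<lambda>n. weak_deriv \<Omega> i (\<phi> n)) (weak_deriv \<Omega> i u) sequentially))"
proof -
  have "((\<lambda>n. H1_norm \<Omega> (\<lambda>x. \<phi> n x - u x)) \<longlonglongrightarrow> 0) \<longleftrightarrow> L2_tendsto \<Omega> \<phi> u sequentially \<and>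
      (\<forall>i\<in>Basis. L2_tendsto \<Omega> (\<lambda>n. weak_deriv \<Omega> i (\<phi> n)) (weak_deriv \<Omega> i u) sequentially)"
    if u: "u \<in> H1_space \<Omega>" and \<phi>: "\<forall>n. test_function \<Omega> (\<phi> n)" for \<phi> :: "nat \<Rightarrow> 'a \<Rightarrow> real"
  proof -
    have ev: "\<forall>\<^sub>F n in sequentially. \<phi> n \<in> H1_space \<Omega>"
      using \<phi> test_function_H1[OF \<Omega>] by simp
    show ?thesis
      using H1_norm_tendsto_imp[OF \<Omega> u ev] H1_norm_tendsto_0I[OF \<Omega> u ev] by blast
  qed
  then show ?thesis
    unfolding H01_space_def by blast
qed

lemma H01_lincomb:
  assumes \<Omega>: "open \<Omega>" and u: "u \<in> H01_space \<Omega>" and v: "v \<in> H01_space \<Omega>"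
  shows "(\<lambda>x. c * u x + d * v x) \<in> H01_space \<Omega>"
proof -
  have \<Omega>L: "\<Omega> \<in> sets lebesgue" using \<Omega> by (rule open_sets_lebesgue)
  obtain \<phi> \<psi> where \<phi>: "\<And>n. test_function \<Omega> (\<phi> n)" "L2_tendsto \<Omega> \<phi> u sequentially"
    "\<And>i. i \<in> Basis \<Longrightarrow> L2_tendsto \<Omega> (\<lambda>n. weak_deriv \<Omega> i (\<phi> n)) (weak_deriv \<Omega> i u) sequentially"
    and \<psi>: "\<And>n. test_function \<Omega> (\<psi> n)" "L2_tendsto \<Omega> \<psi> v sequentially"
    "\<And>i. i \<in> Basis \<Longrightarrow> L2_tendsto \<Omega> (\<lambda>n. weak_deriv \<Omega> i (\<psi> n)) (weak_deriv \<Omega> i v) sequentially"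
    using u v unfolding H01_iff[OF \<Omega>] by metis
  note H = H01_H1[OF u] H01_H1[OF v]
  have "L2_tendsto \<Omega> (\<lambda>n. weak_deriv \<Omega> i (\<lambda>x. c * \<phi> n x + d * \<psi> n x))
      (weak_deriv \<Omega> i (\<lambda>x. c * u x + d * v x)) sequentially" if i: "i \<in> Basis" for i
  proof (rule L2_tendsto_AE_cong[OF L2_tendsto_add[OF L2_tendsto_scale_const[OF \<phi>(3)[OF i]]
        L2_tendsto_scale_const[OF \<psi>(3)[OF i]]] \<Omega>L])
    show "\<forall>\<^sub>F n in sequentially. AE x in lebesgue_on \<Omega>.
        c * weak_deriv \<Omega> i (\<phi> n) x + d * weak_deriv \<Omega> i (\<psi> n) x = weak_deriv \<Omega> i (\<lambda>x. c * \<phi> n x + d * \<psi> n x) x"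
      by (intro always_eventually allI AE_sym[OF H1_lincomb(2)] test_function_H1 \<Omega> \<phi> \<psi> i)
    show "AE x in lebesgue_on \<Omega>. c * weak_deriv \<Omega> i u x + d * weak_deriv \<Omega> i v x = weak_deriv \<Omega> i (\<lambda>x. c * u x + d * v x) x"
      by (intro AE_sym[OF H1_lincomb(2)] \<Omega> H i)
  qed
  moreover have "L2_tendsto \<Omega> (\<lambda>n x. c * \<phi> n x + d * \<psi> n x) (\<lambda>x. c * u x + d * v x) sequentially"
    by (intro L2_tendsto_add L2_tendsto_scale_const \<phi> \<psi>)
  moreover have "test_function \<Omega> (\<lambda>x. c * \<phi> n x + d * \<psi> n x)" for n
    by (intro test_function_add test_function_scale \<phi> \<psi>)
  moreover have "(\<lambda>x. c * u x + d * v x) \<in> H1_space \<Omega>" by (rule H1_lincomb(1)[OF \<Omega> H])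
  ultimately show ?thesis
    unfolding H01_iff[OF \<Omega>] by (intro conjI exI[of _ "\<lambda>n x. c * \<phi> n x + d * \<psi> n x"]) auto
qed

lemma H01_scale: "open \<Omega> \<Longrightarrow> u \<in> H01_space \<Omega> \<Longrightarrow> (\<lambda>x. c * u x) \<in> H01_space \<Omega>"
  using H01_lincomb[of \<Omega> u u c 0] by simp

lemma H01_diff:
  "open \<Omega> \<Longrightarrow> u \<in> H01_space \<Omega> \<Longrightarrow> v \<in> H01_space \<Omega> \<Longrightarrow> (\<lambda>x. u x - v x) \<in> H01_space \<Omega>"
  using H01_lincomb[where c = 1 and d = "-1"] by force

lemma test_function_H01:
  assumes "open \<Omega>" "test_function \<Omega> \<phi>"
  shows "\<phi> \<in> H01_space \<Omega>"
  unfolding H01_iff[OF assms(1)]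
  using assms test_function_H1[OF assms]
  by (intro conjI exI[of _ "\<lambda>n. \<phi>"] ballI L2_tendsto_const) (auto intro: H1_L2 H1_weak_deriv_L2)

text \<open>Time derivatives of a solution are determined only up to null sets; this moves
  membership from one representative to another.\<close>

lemma H01_AE_cong:
  assumes \<Omega>: "open \<Omega>" and u: "u \<in> H01_space \<Omega>" and ae: "AE x in lebesgue_on \<Omega>. u x = v x"
  shows "v \<in> H01_space \<Omega>"
proof -
  have \<Omega>L: "\<Omega> \<in> sets lebesgue" using \<Omega> by (rule open_sets_lebesgue)
  obtain \<phi> where \<phi>: "\<forall>n. test_function \<Omega> (\<phi> n)" "L2_tendsto \<Omega> \<phi> u sequentially"
    "\<forall>i\<in>Basis. L2_tendsto \<Omega> (\<lambda>n. weak_deriv \<Omega> i (\<phi> n)) (weak_deriv \<Omega> i u) sequentially"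
    using u unfolding H01_iff[OF \<Omega>] by blast
  have "L2_tendsto \<Omega> \<phi> v sequentially"
    by (rule L2_tendsto_AE_cong[OF \<phi>(2) \<Omega>L _ ae]) simp
  moreover have "v \<in> H1_space \<Omega>" using H1_AE_cong[OF \<Omega> H01_H1[OF u] ae] .
  ultimately show ?thesis
    unfolding H01_iff[OF \<Omega>] using \<phi>(1,3) weak_deriv_AE_cong[OF \<Omega>L _ ae] by auto
qed

text \<open>For a fixed test function both sides of the defining identity are L^2 inner products,
  hence continuous under L^2 convergence.\<close>

lemma has_weak_deriv_limit:
  fixes u :: "nat \<Rightarrow> 'a::euclidean_space \<Rightarrow> real"
  assumes \<Omega>: "open \<Omega>" and i: "i \<in> Basis" and u: "\<And>n. has_weak_deriv \<Omega> i (u n) (v n)"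
    and lim: "L2_tendsto \<Omega> u l sequentially" "L2_tendsto \<Omega> v m sequentially"
  shows "has_weak_deriv \<Omega> i l m"
proof -
  have \<Omega>L: "\<Omega> \<in> sets lebesgue" using \<Omega> by (rule open_sets_lebesgue)
  have "L2_inner \<Omega> l (partial_deriv i \<phi>) = - L2_inner \<Omega> m \<phi>" if \<phi>: "test_function \<Omega> \<phi>" for \<phi>
  proof -
    note L = test_function_L2[OF _ \<Omega>L]
    have "(\<lambda>n. L2_inner \<Omega> (u n) (partial_deriv i \<phi>)) \<longlonglongrightarrow> L2_inner \<Omega> l (partial_deriv i \<phi>)"
      by (intro L2_tendsto_inner L2_tendsto_const L lim test_function_partial_deriv \<phi> i)
    moreover have "(\<lambda>n. - L2_inner \<Omega> (v n) \<phi>) \<longlonglongrightarrow> - L2_inner \<Omega> m \<phi>"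
      by (intro tendsto_minus L2_tendsto_inner L2_tendsto_const L lim \<phi>)
    moreover have "L2_inner \<Omega> (u n) (partial_deriv i \<phi>) = - L2_inner \<Omega> (v n) \<phi>" for n
      using u \<phi> by (simp add: has_weak_deriv_def L2_inner_def)
    ultimately show ?thesis using LIMSEQ_unique by simp
  qed
  moreover have "locally_integrable \<Omega> l" "locally_integrable \<Omega> m"
    using lim L2_locally_integrable[OF _ \<Omega>L] by (auto simp: L2_tendsto_def)
  ultimately show ?thesis by (simp add: has_weak_deriv_def L2_inner_def)
qed

text \<open>A diagonal argument: test functions approximating the members of the sequence with
  errors tending to 0 also approximate the limit.\<close>

lemma H01_closed:
  fixes u :: "nat \<Rightarrow> 'a::euclidean_space \<Rightarrow> real"
  assumes \<Omega>: "open \<Omega>" and u: "\<And>n. u n \<in> H01_space \<Omega>" and lim: "L2_tendsto \<Omega> u l sequentially"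
    and lim': "\<And>i. i \<in> Basis \<Longrightarrow> L2_tendsto \<Omega> (\<lambda>n. weak_deriv \<Omega> i (u n)) (m i) sequentially"
  shows "l \<in> H01_space \<Omega>"
    and "i \<in> Basis \<Longrightarrow> AE x in lebesgue_on \<Omega>. weak_deriv \<Omega> i l x = m i x"
proof -
  have \<Omega>L: "\<Omega> \<in> sets lebesgue" using \<Omega> by (rule open_sets_lebesgue)
  have wd: "has_weak_deriv \<Omega> i l (m i)" if "i \<in> Basis" for i
    using has_weak_deriv_limit[OF \<Omega> that _ lim lim'[OF that]]
      H1_has_weak_deriv[OF H01_H1[OF u] that] by blast
  show ae: "AE x in lebesgue_on \<Omega>. weak_deriv \<Omega> i l x = m i x" if "i \<in> Basis" for i
    using weak_deriv_AE_eq[OF \<Omega> wd[OF that]] .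
  have l: "l \<in> H1_space \<Omega>"
    unfolding H1_space_def using wd lim lim' by (auto simp: L2_tendsto_def)
  have wdlim: "L2_tendsto \<Omega> (\<lambda>n. weak_deriv \<Omega> i (u n)) (weak_deriv \<Omega> i l) sequentially"
    if "i \<in> Basis" for i
    by (rule L2_tendsto_AE_cong[OF lim'[OF that] \<Omega>L _ AE_sym[OF ae[OF that]]]) simp
  \<comment> \<open>One test function is picked for each \<open>n\<close>, at distance below 1/(n +
    1) from \<open>u n\<close>.\<close>
  have "\<exists>\<phi>. test_function \<Omega> \<phi> \<and> H1_norm \<Omega> (\<lambda>x. \<phi> x - u n x) < 1 / real (Suc n)" for n
  proof -
    obtain \<phi> where \<phi>: "\<forall>k. test_function \<Omega> (\<phi> k)" and lim0: "(\<lambda>k. H1_norm \<Omega> (\<lambda>x. \<phi> k x - u n x)) \<longlonglongrightarrow> 0"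
      using u[of n] by (auto simp: H01_space_def)
    have "\<forall>\<^sub>F k in sequentially. H1_norm \<Omega> (\<lambda>x. \<phi> k x - u n x) < 1 / real (Suc n)"
      by (rule order_tendstoD(2)[OF lim0]) simp
    then obtain k where "H1_norm \<Omega> (\<lambda>x. \<phi> k x - u n x) < 1 / real (Suc n)"
      by (auto simp: eventually_sequentially simp del: of_nat_Suc)
    then show ?thesis using \<phi> by blast
  qed
  then obtain \<phi> where \<phi>: "\<And>n. test_function \<Omega> (\<phi> n)"
    and close: "\<And>n. H1_norm \<Omega> (\<lambda>x. \<phi> n x - u n x) < 1 / real (Suc n)" by metis
  note \<phi>H = test_function_H1[OF \<Omega> \<phi>]
  have small: "(\<lambda>n. H1_norm \<Omega> (\<lambda>x. \<phi> n x - u n x)) \<longlonglongrightarrow> 0"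
    by (rule tendsto_sandwich[OF _ _ tendsto_const LIMSEQ_Suc[OF lim_1_over_n]])
      (intro always_eventually allI H1_norm_nonneg less_imp_le close)+
  \<comment> \<open>The errors are treated as a sequence with H1 limit 0. The chosen weak derivative
    of the zero function is itself known to be 0 only almost everywhere.\<close>
  have z: "(\<lambda>x. 0) \<in> H1_space \<Omega>" using H1_lincomb(1)[OF \<Omega> l l, of 0 0] by simp
  have z': "AE x in lebesgue_on \<Omega>. weak_deriv \<Omega> i (\<lambda>x. 0) x = 0" if "i \<in> Basis" for i
    using H1_lincomb(2)[OF \<Omega> l l that, of 0 0] by simp
  have dH: "(\<lambda>x. \<phi> n x - u n x) \<in> H1_space \<Omega>" for n
    by (rule H1_diff(1)[OF \<Omega> \<phi>H H01_H1[OF u]])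
  have small': "(\<lambda>n. H1_norm \<Omega> (\<lambda>x. \<phi> n x - u n x - 0)) \<longlonglongrightarrow> 0" using small by simp
  note d = H1_norm_tendsto_imp[OF \<Omega> z always_eventually[OF allI[OF dH]] small']
  have "L2_tendsto \<Omega> (\<lambda>n x. (\<phi> n x - u n x) + u n x) (\<lambda>x. 0 + l x) sequentially"
    by (rule L2_tendsto_add[OF d(1) lim])
  then have "L2_tendsto \<Omega> \<phi> l sequentially" by simp
  moreover have "L2_tendsto \<Omega> (\<lambda>n. weak_deriv \<Omega> i (\<phi> n)) (weak_deriv \<Omega> i l) sequentially"
    if i: "i \<in> Basis" for i
  proof (rule L2_tendsto_AE_cong[OF L2_tendsto_add[OF d(2)[OF i] wdlim[OF i]] \<Omega>L])
    show "\<forall>\<^sub>F n in sequentially. AE x in lebesgue_on \<Omega>.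
        weak_deriv \<Omega> i (\<lambda>x. \<phi> n x - u n x) x + weak_deriv \<Omega> i (u n) x = weak_deriv \<Omega> i (\<phi> n) x"
    proof (rule always_eventually, rule allI)
      fix n
      show "AE x in lebesgue_on \<Omega>. weak_deriv \<Omega> i (\<lambda>x. \<phi> n x - u n x) x + weak_deriv \<Omega> i (u n) x = weak_deriv \<Omega> i (\<phi> n) x"
        using H1_diff(2)[OF \<Omega> \<phi>H[of n] H01_H1[OF u[of n]] i] by eventually_elim simp
    qed
    show "AE x in lebesgue_on \<Omega>. weak_deriv \<Omega> i (\<lambda>x. 0) x + weak_deriv \<Omega> i l x = weak_deriv \<Omega> i l x"
      using z'[OF i] by eventually_elim simp
  qed
  ultimately show "l \<in> H01_space \<Omega>"
    unfolding H01_iff[OF \<Omega>] using l \<phi> by blast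
qed

text \<open>For a test function in place of \<open>u\<close> this is the definition of the weak
  derivative of \<open>v\<close>; both sides are continuous along the approximation of
  \<open>u\<close>. The boundary term is absent because one factor lies in
  \<open>H01_space\<close>.\<close>

lemma H01_H1_integration_by_parts:
  assumes \<Omega>: "open \<Omega>" and u: "u \<in> H01_space \<Omega>" and v: "v \<in> H1_space \<Omega>" and i: "i \<in> Basis"
  shows "L2_inner \<Omega> u (weak_deriv \<Omega> i v) = - L2_inner \<Omega> (weak_deriv \<Omega> i u) v"
proof -
  have \<Omega>L: "\<Omega> \<in> sets lebesgue" using \<Omega> by (rule open_sets_lebesgue)
  obtain \<phi> where \<phi>: "\<And>n. test_function \<Omega> (\<phi> n)" "L2_tendsto \<Omega> \<phi> u sequentially"
    "\<And>i. i \<in> Basis \<Longrightarrow> L2_tendsto \<Omega> (\<lambda>n. weak_deriv \<Omega> i (\<phi> n)) (weak_deriv \<Omega> i u) sequentially"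
    using u unfolding H01_iff[OF \<Omega>] by blast
  have "L2_inner \<Omega> (\<phi> n) (weak_deriv \<Omega> i v) = - L2_inner \<Omega> (weak_deriv \<Omega> i (\<phi> n)) v" for n
  proof -
    have "L2_inner \<Omega> v (partial_deriv i (\<phi> n)) = - L2_inner \<Omega> (weak_deriv \<Omega> i v) (\<phi> n)"
      using H1_has_weak_deriv[OF v i] \<phi>(1) by (simp add: has_weak_deriv_def L2_inner_def)
    moreover have "L2_inner \<Omega> v (partial_deriv i (\<phi> n)) = L2_inner \<Omega> v (weak_deriv \<Omega> i (\<phi> n))"
      by (rule L2_inner_AE_cong[OF H1_L2[OF v]
            test_function_L2[OF test_function_partial_deriv[OF \<phi>(1) i] \<Omega>L] \<Omega>L
            _ AE_sym[OF test_function_weak_deriv[OF \<Omega> \<phi>(1) i]]]) simp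
    ultimately show ?thesis
      using L2_inner_commute[of \<Omega> "\<phi> n" "weak_deriv \<Omega> i v"]
        L2_inner_commute[of \<Omega> "weak_deriv \<Omega> i (\<phi> n)" v] by simp
  qed
  moreover have "(\<lambda>n. L2_inner \<Omega> (\<phi> n) (weak_deriv \<Omega> i v)) \<longlonglongrightarrow> L2_inner \<Omega> u (weak_deriv \<Omega> i v)"
    by (intro L2_tendsto_inner L2_tendsto_const \<phi> H1_weak_deriv_L2 \<Omega> v i)
  moreover have "(\<lambda>n. - L2_inner \<Omega> (weak_deriv \<Omega> i (\<phi> n)) v) \<longlonglongrightarrow> - L2_inner \<Omega> (weak_deriv \<Omega> i u) v"
    by (intro tendsto_minus L2_tendsto_inner L2_tendsto_const \<phi> H1_L2 v i)
  ultimately show ?thesis using LIMSEQ_unique by simp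
qed

section \<open>The Dirichlet form\<close>

text \<open>The integral of the product of the gradients, written in coordinates so that scalar L^2
  calculus applies; \<open>integral_weak_grad_inner\<close> connects it with
  \<open>weak_grad\<close>.\<close>

definition grad_inner :: "'a::euclidean_space set \<Rightarrow> ('a \<Rightarrow> real) \<Rightarrow> ('a \<Rightarrow> real) \<Rightarrow> real"
  where "grad_inner \<Omega> u v = (\<Sum>i\<in>Basis. L2_inner \<Omega> (weak_deriv \<Omega> i u) (weak_deriv \<Omega> i v))"

lemma grad_inner_commute: "grad_inner \<Omega> u v = grad_inner \<Omega> v u"
  unfolding grad_inner_def by (intro sum.cong L2_inner_commute refl)

lemma grad_inner_self_nonneg [simp]: "0 \<le> grad_inner \<Omega> u u"
  by (simp add: grad_inner_def sum_nonneg)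

lemma grad_inner_lincomb_left:
  assumes \<Omega>: "open \<Omega>" and u: "u \<in> H1_space \<Omega>" and v: "v \<in> H1_space \<Omega>" and w: "w \<in> H1_space \<Omega>"
  shows "grad_inner \<Omega> (\<lambda>x. c * u x + d * v x) w = c * grad_inner \<Omega> u w + d * grad_inner \<Omega> v w"
proof -
  have "L2_inner \<Omega> (weak_deriv \<Omega> i (\<lambda>x. c * u x + d * v x)) (weak_deriv \<Omega> i w) =
      c * L2_inner \<Omega> (weak_deriv \<Omega> i u) (weak_deriv \<Omega> i w) + d * L2_inner \<Omega> (weak_deriv \<Omega> i v) (weak_deriv \<Omega> i w)"
    if i: "i \<in> Basis" for i
  proof -
    note L = H1_weak_deriv_L2[OF \<Omega> _ i]
    have "L2_inner \<Omega> (weak_deriv \<Omega> i (\<lambda>x. c * u x + d * v x)) (weak_deriv \<Omega> i w) =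
        L2_inner \<Omega> (\<lambda>x. c * weak_deriv \<Omega> i u x + d * weak_deriv \<Omega> i v x) (weak_deriv \<Omega> i w)"
      by (intro L2_inner_AE_cong L w open_sets_lebesgue \<Omega> H1_lincomb u v i) auto
    then show ?thesis
      by (simp add: L2_inner_add_left L2_inner_scale_left L2_scale L u v w)
  qed
  then show ?thesis by (simp add: grad_inner_def sum.distrib sum_distrib_left)
qed

lemma grad_inner_sq_lincomb:
  assumes \<Omega>: "open \<Omega>" and u: "u \<in> H1_space \<Omega>" and v: "v \<in> H1_space \<Omega>"
  shows "grad_inner \<Omega> (\<lambda>x. c * u x + d * v x) (\<lambda>x. c * u x + d * v x) =
    c\<^sup>2 * grad_inner \<Omega> u u + 2 * c * d * grad_inner \<Omega> u v + d\<^sup>2 * grad_inner \<Omega> v v"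
proof -
  let ?w = "\<lambda>x. c * u x + d * v x"
  have "grad_inner \<Omega> ?w ?w = c * grad_inner \<Omega> ?w u + d * grad_inner \<Omega> ?w v"
    using grad_inner_lincomb_left[OF \<Omega> u v H1_lincomb(1)[OF \<Omega> u v], of c d c d]
    by (simp only: grad_inner_commute[of \<Omega> u ?w] grad_inner_commute[of \<Omega> v ?w])
  also have "\<dots> = c\<^sup>2 * grad_inner \<Omega> u u + 2 * c * d * grad_inner \<Omega> u v + d\<^sup>2 * grad_inner \<Omega> v v"
    unfolding grad_inner_lincomb_left[OF \<Omega> u v u] grad_inner_lincomb_left[OF \<Omega> u v v]
      grad_inner_commute[of \<Omega> v u]
    by (simp add: power2_eq_square algebra_simps)
  finally show ?thesis .
qed

lemma grad_inner_scale:
  assumes \<Omega>: "open \<Omega>" and u: "u \<in> H1_space \<Omega>"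
  shows "grad_inner \<Omega> (\<lambda>x. c * u x) (\<lambda>x. c * u x) = c\<^sup>2 * grad_inner \<Omega> u u"
  using grad_inner_sq_lincomb[OF \<Omega> u u, of c 0] by simp

lemma grad_inner_AE_cong:
  assumes "\<Omega> \<in> sets lebesgue" "AE x in lebesgue_on \<Omega>. u x = u' x" "AE x in lebesgue_on \<Omega>. v x = v' x"
  shows "grad_inner \<Omega> u v = grad_inner \<Omega> u' v'"
  unfolding grad_inner_def using weak_deriv_AE_cong[OF assms(1) _ assms(2)] weak_deriv_AE_cong[OF assms(1) _ assms(3)]
  by (intro sum.cong) simp_all

lemma weak_grad_inner_Basis: "j \<in> Basis \<Longrightarrow> weak_grad \<Omega> u x \<bullet> j = weak_deriv \<Omega> j u x"
  by (simp add: weak_grad_def inner_sum_left inner_Basis if_distrib sum.If_cases cong: if_cong)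

lemma integral_weak_grad_inner:
  assumes \<Omega>: "open \<Omega>" and u: "u \<in> H1_space \<Omega>" and v: "v \<in> H1_space \<Omega>"
  shows "(LINT x|lebesgue_on \<Omega>. weak_grad \<Omega> u x \<bullet> weak_grad \<Omega> v x) = grad_inner \<Omega> u v"
proof -
  have "(LINT x|lebesgue_on \<Omega>. weak_grad \<Omega> u x \<bullet> weak_grad \<Omega> v x)
      = (LINT x|lebesgue_on \<Omega>. (\<Sum>i\<in>Basis. weak_deriv \<Omega> i u x * weak_deriv \<Omega> i v x))"
  proof (intro Bochner_Integration.integral_cong refl)
    fix x
    have "weak_grad \<Omega> u x \<bullet> weak_grad \<Omega> v x
        = (\<Sum>i\<in>Basis. (weak_grad \<Omega> u x \<bullet> i) * (weak_grad \<Omega> v x \<bullet> i))"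
      by (rule euclidean_inner)
    also have "\<dots> = (\<Sum>i\<in>Basis. weak_deriv \<Omega> i u x * weak_deriv \<Omega> i v x)"
      by (intro sum.cong) (simp_all only: weak_grad_inner_Basis)
    finally show "weak_grad \<Omega> u x \<bullet> weak_grad \<Omega> v x
        = (\<Sum>i\<in>Basis. weak_deriv \<Omega> i u x * weak_deriv \<Omega> i v x)" .
  qed
  also have "\<dots> = grad_inner \<Omega> u v"
    unfolding grad_inner_def L2_inner_def
    by (intro Bochner_Integration.integral_sum L2_mult_integrable H1_weak_deriv_L2 \<Omega> u v)
  finally show ?thesis .
qed

lemma Lnorm_weak_grad_sq:
  assumes "open \<Omega>" "u \<in> H1_space \<Omega>"
  shows "(Lnorm \<Omega> 2 (weak_grad \<Omega> u))\<^sup>2 = grad_inner \<Omega> u u"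
proof -
  have "(Lnorm \<Omega> 2 (weak_grad \<Omega> u))\<^sup>2 = (LINT x|lebesgue_on \<Omega>. (norm (weak_grad \<Omega> u x))\<^sup>2)"
    by (simp add: Lnorm_2_eq)
  then show ?thesis
    using integral_weak_grad_inner[OF assms(1,2,2)] by (simp only: power2_norm_eq_inner)
qed

text \<open>Each first derivative of \<open>u\<close> lies in H1, so integration by parts against
  \<open>v\<close> applies coordinate by coordinate.\<close>

lemma weak_laplacian_green:
  assumes \<Omega>: "open \<Omega>" and u: "u \<in> H2_space \<Omega>" and v: "v \<in> H01_space \<Omega>"
  shows "weak_laplacian \<Omega> u \<in> L2_space \<Omega>" "L2_inner \<Omega> (weak_laplacian \<Omega> u) v = - grad_inner \<Omega> u v"
proof -
  have H: "weak_deriv \<Omega> i u \<in> H1_space \<Omega>" if "i \<in> Basis" for i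
    using u that by (simp add: H2_space_def)
  have L: "weak_deriv \<Omega> i (weak_deriv \<Omega> i u) \<in> L2_space \<Omega>" if "i \<in> Basis" for i
    using H1_weak_deriv_L2[OF \<Omega> H that] that by blast
  then show "weak_laplacian \<Omega> u \<in> L2_space \<Omega>"
    unfolding weak_laplacian_def[abs_def] by (rule L2_sum)
  have "L2_inner \<Omega> (weak_laplacian \<Omega> u) v = (\<Sum>i\<in>Basis. L2_inner \<Omega> (weak_deriv \<Omega> i (weak_deriv \<Omega> i u)) v)"
    unfolding weak_laplacian_def[abs_def] by (rule L2_inner_sum_left[OF L H01_L2[OF v]])
  also have "\<dots> = (\<Sum>i\<in>Basis. - L2_inner \<Omega> (weak_deriv \<Omega> i u) (weak_deriv \<Omega> i v))"
    using H01_H1_integration_by_parts[OF \<Omega> v H] by (intro sum.cong) (auto simp: L2_inner_commute)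
  finally show "L2_inner \<Omega> (weak_laplacian \<Omega> u) v = - grad_inner \<Omega> u v"
    by (simp add: grad_inner_def sum_negf)
qed

section \<open>Translation estimate\<close>

lemma test_function_integrable: "test_function \<Omega> \<phi> \<Longrightarrow> integrable lborel \<phi>"
  using continuous_compact_support_integrable test_function_continuous test_function_bounded_support
  by metis

lemma nn_integral_test_function_sq:
  assumes \<Omega>: "open \<Omega>" and \<phi>: "test_function \<Omega> \<phi>"
  shows "(\<integral>\<^sup>+x. ennreal ((\<phi> x)\<^sup>2) \<partial>lborel) = ennreal (L2_inner \<Omega> \<phi> \<phi>)"
proof -
  note t = test_function_mult[OF \<phi> \<phi>]
  have "(\<integral>\<^sup>+x. ennreal (\<phi> x * \<phi> x) \<partial>lborel) = ennreal (LINT x|lborel. \<phi> x * \<phi> x)"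
    using test_function_integrable[OF t] by (intro nn_integral_eq_integral) auto
  also have "(LINT x|lborel. \<phi> x * \<phi> x) = (LINT x|lebesgue_on \<Omega>. \<phi> x * \<phi> x)"
    using borel_measurable_test_function[OF t] \<phi>
    by (intro integral_lebesgue_on_eq_lborel[symmetric] open_sets_lebesgue \<Omega>) (auto simp: test_function_def)
  finally show ?thesis by (simp add: power2_eq_square L2_inner_def)
qed

lemma grad_inner_test_function:
  assumes \<Omega>: "open \<Omega>" and \<phi>: "test_function \<Omega> \<phi>"
  shows "grad_inner \<Omega> \<phi> \<phi> = (\<Sum>i\<in>Basis. L2_inner \<Omega> (partial_deriv i \<phi>) (partial_deriv i \<phi>))"
  unfolding grad_inner_def
proof (rule sum.cong[OF refl])
  fix i :: 'a assume i: "i \<in> Basis"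
  have w: "weak_deriv \<Omega> i \<phi> \<in> L2_space \<Omega>"
    by (rule H1_weak_deriv_L2[OF \<Omega> test_function_H1[OF \<Omega> \<phi>] i])
  show "L2_inner \<Omega> (weak_deriv \<Omega> i \<phi>) (weak_deriv \<Omega> i \<phi>) = L2_inner \<Omega> (partial_deriv i \<phi>) (partial_deriv i \<phi>)"
    by (rule L2_inner_AE_cong[OF w w open_sets_lebesgue[OF \<Omega>]]) (rule test_function_weak_deriv[OF \<Omega> \<phi> i])+
qed

lemma nn_integral_grad_test_function:
  assumes \<Omega>: "open \<Omega>" and \<phi>: "test_function \<Omega> \<phi>"
  shows "(\<integral>\<^sup>+x. ennreal (\<Sum>i\<in>Basis. (partial_deriv i \<phi> x)\<^sup>2) \<partial>lborel) = ennreal (grad_inner \<Omega> \<phi> \<phi>)"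
proof -
  have m: "partial_deriv i \<phi> \<in> borel_measurable borel" if "i \<in> Basis" for i
    by (rule borel_measurable_test_function[OF test_function_partial_deriv[OF \<phi> that]])
  have "(\<integral>\<^sup>+x. ennreal (\<Sum>i\<in>Basis. (partial_deriv i \<phi> x)\<^sup>2) \<partial>lborel)
      = (\<integral>\<^sup>+x. (\<Sum>i\<in>Basis. ennreal ((partial_deriv i \<phi> x)\<^sup>2)) \<partial>lborel)"
    by (simp add: sum_ennreal)
  also have "\<dots> = (\<Sum>i\<in>Basis. \<integral>\<^sup>+x. ennreal ((partial_deriv i \<phi> x)\<^sup>2) \<partial>lborel)"
    using m by (intro nn_integral_sum) (simp add: borel_measurable_power)
  also have "\<dots> = (\<Sum>i\<in>Basis. ennreal (L2_inner \<Omega> (partial_deriv i \<phi>) (partial_deriv i \<phi>)))"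
    by (intro sum.cong nn_integral_test_function_sq[OF \<Omega>] test_function_partial_deriv[OF \<phi>] refl)
  also have "\<dots> = ennreal (grad_inner \<Omega> \<phi> \<phi>)"
    by (simp add: grad_inner_test_function[OF \<Omega> \<phi>] sum_ennreal)
  finally show ?thesis .
qed

lemma nn_integral_lborel_translate:
  fixes f :: "'a::euclidean_space \<Rightarrow> ennreal"
  assumes [measurable]: "f \<in> borel_measurable borel"
  shows "(\<integral>\<^sup>+x. f (x + a) \<partial>lborel) = (\<integral>\<^sup>+x. f x \<partial>lborel)"
proof -
  have "(\<integral>\<^sup>+x. f x \<partial>lborel) = (\<integral>\<^sup>+x. f x \<partial>distr lborel borel ((+) a))"
    by (simp add: lborel_distr_plus)
  also have "\<dots> = (\<integral>\<^sup>+x. f (a + x) \<partial>lborel)"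
    by (rule nn_integral_distr) auto
  finally show ?thesis by (simp add: add.commute)
qed

lemma sum_Basis_inner_sq: "(\<Sum>i\<in>Basis. (z \<bullet> i)\<^sup>2) = (norm z)\<^sup>2"
  unfolding power2_norm_eq_inner by (subst euclidean_inner) (simp add: power2_eq_square)

text \<open>Jensen's inequality on the unit interval, from expanding the nonnegative integral of (g
  - c)^2, where c is the mean of g. The \<open>ennreal\<close> form prepares the exchange of
  integrals by Tonelli.\<close>

lemma sq_increment_le_integral:
  fixes g :: "real \<Rightarrow> real"
  assumes F: "\<And>s. (F has_real_derivative g s) (at s)" and g: "continuous_on UNIV g"
  shows "ennreal ((F 1 - F 0)\<^sup>2) \<le> (\<integral>\<^sup>+s. ennreal (indicator {0..1} s * (g s)\<^sup>2) \<partial>lborel)"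
proof -
  define c where "c = F 1 - F 0"
  have int: "integrable lborel (\<lambda>s. indicator {0..1::real} s *\<^sub>R f s)" if "continuous_on UNIV f" for f :: "real \<Rightarrow> real"
    using borel_integrable_compact[of "{0..1::real}" f] that by (auto intro: continuous_on_subset)
  have Ig: "(LINT s|lborel. indicator {0..1} s *\<^sub>R g s) = c"
    unfolding c_def
  proof (rule integral_FTC_atLeastAtMost)
    show "(F has_vector_derivative g x) (at x within {0..1})" for x
      using F[of x] has_field_derivative_at_within has_real_derivative_iff_has_vector_derivative by blast
  qed (use g in \<open>auto intro: continuous_on_subset\<close>)
  have I1: "(LINT s|lborel. indicator {0..1::real} s *\<^sub>R (1::real)) = 1" by simp
  have i1: "integrable lborel (\<lambda>s. indicator {0..1::real} s *\<^sub>R (1::real))" by (rule int) simp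
  have i2: "integrable lborel (\<lambda>s. indicator {0..1::real} s *\<^sub>R (g s)\<^sup>2)"
    using g by (intro int) (auto intro!: continuous_intros)
  have "0 \<le> (LINT s|lborel. indicator {0..1} s *\<^sub>R (g s - c)\<^sup>2)"
    by (intro integral_nonneg_AE AE_I2) simp
  also have "\<dots> = (LINT s|lborel. indicator {0..1} s *\<^sub>R (g s)\<^sup>2
      - 2 * c * (indicator {0..1} s *\<^sub>R g s) + c\<^sup>2 * (indicator {0..1} s *\<^sub>R 1))"
    by (intro Bochner_Integration.integral_cong) (auto simp: power2_eq_square algebra_simps)
  also have "\<dots> = (LINT s|lborel. indicator {0..1} s *\<^sub>R (g s)\<^sup>2) - 2 * c * c + c\<^sup>2 * 1"
    using int[OF g] i1 i2 Ig I1 by simp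
  finally have "c\<^sup>2 \<le> (LINT s|lborel. indicator {0..1} s * (g s)\<^sup>2)"
    by (simp add: power2_eq_square)
  moreover have "(\<integral>\<^sup>+s. ennreal (indicator {0..1} s * (g s)\<^sup>2) \<partial>lborel)
      = ennreal (LINT s|lborel. indicator {0..1} s * (g s)\<^sup>2)"
    using i2 by (intro nn_integral_eq_integral) auto
  ultimately show ?thesis by (simp add: c_def ennreal_leI)
qed

text \<open>The squared increment is at most the integral of the squared directional derivative
  along the segment; after Tonelli, translation invariance removes the position on the segment, and
  Cauchy-Schwarz extracts |z|^2. Integration runs over the whole space, where \<phi> is extended by
  0, so shifts across the boundary do no harm.\<close>

lemma translation_estimate:
  assumes \<Omega>: "open \<Omega>" and \<phi>: "test_function \<Omega> \<phi>"
  shows "(\<integral>\<^sup>+x. ennreal ((\<phi> (x + z) - \<phi> x)\<^sup>2) \<partial>lborel) \<le> ennreal ((norm z)\<^sup>2 * grad_inner \<Omega> \<phi> \<phi>)"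
proof -
  define G where "G = (\<lambda>y. frechet_derivative \<phi> (at y) z)"
  have G_eq: "G y = (\<Sum>i\<in>Basis. (z \<bullet> i) * partial_deriv i \<phi> y)" for y
    unfolding G_def by (rule frechet_derivative_eq_sum_partial[OF test_function_differentiable[OF \<phi>]])
  have Gc: "continuous_on UNIV G"
    unfolding G_eq[abs_def]
    using test_function_continuous[OF test_function_partial_deriv[OF \<phi>]]
    by (intro continuous_on_sum continuous_on_mult continuous_on_const) auto
  then have [measurable]: "G \<in> borel_measurable borel" by (rule borel_measurable_continuous_onI)
  have [measurable]: "\<phi> \<in> borel_measurable borel" using \<phi> by (rule borel_measurable_test_function)
  have "(\<integral>\<^sup>+x. ennreal ((\<phi> (x + z) - \<phi> x)\<^sup>2) \<partial>lborel)
      \<le> (\<integral>\<^sup>+x. \<integral>\<^sup>+s. ennreal (indicator {0..1} s * (G (x + s *\<^sub>R z))\<^sup>2) \<partial>lborel \<partial>lborel)"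
  proof (rule nn_integral_mono)
    fix x
    have "continuous_on UNIV (\<lambda>s. G (x + s *\<^sub>R z))"
      by (rule continuous_on_compose2[OF Gc]) (auto intro!: continuous_intros)
    from sq_increment_le_integral[OF _ this, of "\<lambda>s. \<phi> (x + s *\<^sub>R z)"]
    show "ennreal ((\<phi> (x + z) - \<phi> x)\<^sup>2) \<le> (\<integral>\<^sup>+s. ennreal (indicator {0..1} s * (G (x + s *\<^sub>R z))\<^sup>2) \<partial>lborel)"
      using DERIV_along_line[of \<phi> x z] test_function_differentiable[OF \<phi>] by (simp add: G_def)
  qed
  also have "\<dots> = (\<integral>\<^sup>+s. \<integral>\<^sup>+x. ennreal (indicator {0..1} s * (G (x + s *\<^sub>R z))\<^sup>2) \<partial>lborel \<partial>lborel)"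
    by (rule lborel_pair.Fubini') measurable
  also have "\<dots> = (\<integral>\<^sup>+s. indicator {0..1::real} s * (\<integral>\<^sup>+x. ennreal ((G x)\<^sup>2) \<partial>lborel) \<partial>lborel)"
  proof (rule nn_integral_cong)
    fix s :: real
    have "(\<integral>\<^sup>+x. ennreal (indicator {0..1} s * (G (x + s *\<^sub>R z))\<^sup>2) \<partial>lborel)
        = (\<integral>\<^sup>+x. indicator {0..1} s * ennreal ((G (x + s *\<^sub>R z))\<^sup>2) \<partial>lborel)"
      by (intro nn_integral_cong) (auto simp: indicator_def)
    also have "\<dots> = indicator {0..1} s * (\<integral>\<^sup>+x. ennreal ((G (x + s *\<^sub>R z))\<^sup>2) \<partial>lborel)"
      by (rule nn_integral_cmult) measurable
    also have "(\<integral>\<^sup>+x. ennreal ((G (x + s *\<^sub>R z))\<^sup>2) \<partial>lborel) = (\<integral>\<^sup>+x. ennreal ((G x)\<^sup>2) \<partial>lborel)"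
      by (rule nn_integral_lborel_translate) measurable
    finally show "(\<integral>\<^sup>+x. ennreal (indicator {0..1} s * (G (x + s *\<^sub>R z))\<^sup>2) \<partial>lborel)
        = indicator {0..1} s * (\<integral>\<^sup>+x. ennreal ((G x)\<^sup>2) \<partial>lborel)" .
  qed
  also have "\<dots> = (\<integral>\<^sup>+x. ennreal ((G x)\<^sup>2) \<partial>lborel)"
    by (simp add: nn_integral_multc)
  also have "\<dots> \<le> (\<integral>\<^sup>+x. ennreal ((norm z)\<^sup>2) * ennreal (\<Sum>i\<in>Basis. (partial_deriv i \<phi> x)\<^sup>2) \<partial>lborel)"
  proof (rule nn_integral_mono)
    fix x
    have "(G x)\<^sup>2 \<le> (\<Sum>i\<in>Basis. (z \<bullet> i)\<^sup>2) * (\<Sum>i\<in>Basis. (partial_deriv i \<phi> x)\<^sup>2)"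
      unfolding G_eq by (rule Cauchy_Schwarz_ineq_sum)
    also have "(\<Sum>i\<in>Basis. (z \<bullet> i)\<^sup>2) = (norm z)\<^sup>2"
      by (rule sum_Basis_inner_sq)
    finally show "ennreal ((G x)\<^sup>2) \<le> ennreal ((norm z)\<^sup>2) * ennreal (\<Sum>i\<in>Basis. (partial_deriv i \<phi> x)\<^sup>2)"
      by (simp add: ennreal_mult'[symmetric] ennreal_leI)
  qed
  also have "\<dots> = ennreal ((norm z)\<^sup>2) * ennreal (grad_inner \<Omega> \<phi> \<phi>)"
  proof -
    have [measurable]: "partial_deriv i \<phi> \<in> borel_measurable borel" if "i \<in> Basis" for i
      by (rule borel_measurable_test_function[OF test_function_partial_deriv[OF \<phi> that]])
    have "(\<lambda>x. \<Sum>i\<in>Basis. (partial_deriv i \<phi> x)\<^sup>2) \<in> borel_measurable lborel"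
      by (intro borel_measurable_sum) measurable
    then show ?thesis
      by (subst nn_integral_cmult) (simp_all add: nn_integral_grad_test_function[OF \<Omega> \<phi>])
  qed
  also have "\<dots> = ennreal ((norm z)\<^sup>2 * grad_inner \<Omega> \<phi> \<phi>)" by (simp add: ennreal_mult)
  finally show ?thesis .
qed

text \<open>A translation longer than the diameter of the domain separates the supports.\<close>

lemma poincare_test_function:
  fixes \<Omega> :: "'a::euclidean_space set"
  assumes \<Omega>: "open \<Omega>" and R: "\<And>x. x \<in> \<Omega> \<Longrightarrow> norm x \<le> R" "R > 0" and \<phi>: "test_function \<Omega> \<phi>"
  shows "L2_inner \<Omega> \<phi> \<phi> \<le> (2 * R + 1)\<^sup>2 * grad_inner \<Omega> \<phi> \<phi>"
proof -
  obtain i :: 'a where i: "i \<in> Basis" using nonempty_Basis by blast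
  define z where "z = (2 * R + 1) *\<^sub>R i"
  have nz: "norm z = 2 * R + 1" using i R(2) by (simp add: z_def)
  have zero: "\<phi> x = 0" if "x \<notin> \<Omega>" for x using \<phi> that by (auto simp: test_function_def)
  have sep: "\<phi> (x + z) * \<phi> x = 0" for x
  proof (rule ccontr)
    assume "\<phi> (x + z) * \<phi> x \<noteq> 0"
    then have "norm (x + z) \<le> R" "norm x \<le> R" using zero R(1) by force+
    then show False using norm_triangle_ineq4[of "x + z" x] nz by simp
  qed
  have "ennreal (L2_inner \<Omega> \<phi> \<phi>) = (\<integral>\<^sup>+x. ennreal ((\<phi> x)\<^sup>2) \<partial>lborel)"
    by (rule nn_integral_test_function_sq[OF \<Omega> \<phi>, symmetric])
  also have "\<dots> \<le> (\<integral>\<^sup>+x. ennreal ((\<phi> (x + z) - \<phi> x)\<^sup>2) \<partial>lborel)"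
  proof (rule nn_integral_mono)
    fix x
    have "(\<phi> (x + z) - \<phi> x)\<^sup>2 = (\<phi> (x + z))\<^sup>2 + (\<phi> x)\<^sup>2 - 2 * (\<phi> (x + z) * \<phi> x)"
      by (simp add: power2_eq_square algebra_simps)
    then show "ennreal ((\<phi> x)\<^sup>2) \<le> ennreal ((\<phi> (x + z) - \<phi> x)\<^sup>2)"
      using sep[of x] by (intro ennreal_leI) simp
  qed
  also have "\<dots> \<le> ennreal ((2 * R + 1)\<^sup>2 * grad_inner \<Omega> \<phi> \<phi>)"
    using translation_estimate[OF \<Omega> \<phi>, of z] nz by simp
  finally show ?thesis by (simp add: ennreal_le_iff)
qed

section \<open>Rellich's theorem\<close>

text \<open>Half-open cubes of side \<open>h\<close> for positive \<open>h\<close>: the floor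
  function puts every point into exactly one of them. Only the values of \<open>k\<close> on
  \<open>Basis\<close> matter, so index sets are later taken to be extensional.\<close>

definition grid_cell :: "real \<Rightarrow> ('a::euclidean_space \<Rightarrow> int) \<Rightarrow> 'a set"
  where "grid_cell h k = {x. \<forall>i\<in>Basis. \<lfloor>(x \<bullet> i) / h\<rfloor> = k i}"

lemma grid_cell_borel [measurable]: "grid_cell h (k :: 'a::euclidean_space \<Rightarrow> int) \<in> sets borel"
proof -
  have "grid_cell h k = (\<Inter>i\<in>Basis. {x \<in> space borel. \<lfloor>(x \<bullet> i) / h\<rfloor> = k i})"
    by (auto simp: grid_cell_def)
  also have "\<dots> \<in> sets borel"
    by (intro sets.finite_INT) (auto simp: nonempty_Basis)
  finally show ?thesis .
qed

lemma grid_cell_iff: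
  assumes "h > 0"
  shows "x \<in> grid_cell h k \<longleftrightarrow> (\<forall>i\<in>Basis. h * k i \<le> x \<bullet> i \<and> x \<bullet> i < h * k i + h)"
  using assms by (auto simp: grid_cell_def floor_eq_iff field_simps)

lemma emeasure_grid_cell:
  fixes k :: "'a::euclidean_space \<Rightarrow> int"
  assumes h: "h > 0"
  shows "emeasure lborel (grid_cell h k) = ennreal (h ^ DIM('a))"
proof -
  define l u :: 'a where "l = (\<Sum>i\<in>Basis. (h * k i) *\<^sub>R i)" and "u = (\<Sum>i\<in>Basis. (h * k i + h) *\<^sub>R i)"
  have lu: "l \<bullet> i = h * k i" "u \<bullet> i = h * k i + h" if "i \<in> Basis" for i
    using that by (simp_all add: l_def u_def)
  have "(\<Prod>b\<in>Basis. (u - l) \<bullet> b) = h ^ DIM('a)"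
    using lu by (simp add: inner_diff_left)
  then have e: "emeasure lborel (box l u) = ennreal (h ^ DIM('a))" "emeasure lborel (cbox l u) = ennreal (h ^ DIM('a))"
    using lu h by (subst emeasure_lborel_box emeasure_lborel_cbox; simp)+
  have "box l u \<subseteq> grid_cell h k" "grid_cell h k \<subseteq> cbox l u"
    using lu by (fastforce simp: grid_cell_iff[OF h] mem_box)+
  then show ?thesis
    using emeasure_mono[of "box l u" "grid_cell h k" lborel] emeasure_mono[of "grid_cell h k" "cbox l u" lborel] e
    by (auto intro!: antisym)
qed

text \<open>Expanding the square shows that twice the variance of \<phi> on a cell, up to the volume
  factor, is a double integral of squared increments, which translations control. So the cell
  averages determine the L^2 norm up to an error of gradient type.\<close>

lemma grid_cell_variance:
  fixes \<phi> :: "'a::euclidean_space \<Rightarrow> real" and k :: "'a \<Rightarrow> int" and h :: real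
  assumes h: "h > 0" and \<phi>: "test_function \<Omega> \<phi>"
  defines "m \<equiv> LINT x|lborel. indicator (grid_cell h k) x * \<phi> x"
    and "s \<equiv> LINT x|lborel. indicator (grid_cell h k) x * (\<phi> x)\<^sup>2" and "V \<equiv> h ^ DIM('a)"
  shows "(\<integral>\<^sup>+x. \<integral>\<^sup>+y. ennreal (indicator (grid_cell h k) x * (indicator (grid_cell h k) y * (\<phi> y - \<phi> x)\<^sup>2)) \<partial>lborel \<partial>lborel)
    = ennreal (2 * V * s - 2 * m\<^sup>2)"
proof -
  let ?Q = "grid_cell h k"
  have [measurable]: "\<phi> \<in> borel_measurable borel" using \<phi> by (rule borel_measurable_test_function)
  have V: "V > 0" using h by (simp add: V_def)
  have I1: "(LINT x|lborel. indicator ?Q x) = V"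
    using emeasure_grid_cell[OF h, of k] V by (simp add: measure_def V_def)
  have i1: "integrable lborel (\<lambda>x. indicator ?Q x :: real)"
    using emeasure_grid_cell[OF h, of k] by (intro integrable_real_indicator) auto
  have i2: "integrable lborel (\<lambda>x. indicator ?Q x * \<phi> x)"
    using integrable_mult_indicator[OF _ test_function_integrable[OF \<phi>], of ?Q] by simp
  have i3: "integrable lborel (\<lambda>x. indicator ?Q x * (\<phi> x)\<^sup>2)"
    using integrable_mult_indicator[OF _ test_function_integrable[OF test_function_mult[OF \<phi> \<phi>]], of ?Q]
    by (simp add: power2_eq_square)
  have inner: "(\<integral>\<^sup>+y. ennreal (indicator ?Q x * (indicator ?Q y * (\<phi> y - \<phi> x)\<^sup>2)) \<partial>lborel)
      = ennreal (indicator ?Q x * (s - 2 * \<phi> x * m + (\<phi> x)\<^sup>2 * V))"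
    and inner_nn: "0 \<le> s - 2 * \<phi> x * m + (\<phi> x)\<^sup>2 * V" for x
  proof -
    have eq: "(\<lambda>y. indicator ?Q y * (\<phi> y - \<phi> x)\<^sup>2) = (\<lambda>y. indicator ?Q y * (\<phi> y)\<^sup>2
        - 2 * \<phi> x * (indicator ?Q y * \<phi> y) + (\<phi> x)\<^sup>2 * indicator ?Q y)"
      by (auto simp: power2_eq_square algebra_simps)
    have int: "integrable lborel (\<lambda>y. indicator ?Q y * (\<phi> y - \<phi> x)\<^sup>2)"
      unfolding eq using i1 i2 i3 by auto
    have val: "(LINT y|lborel. indicator ?Q y * (\<phi> y - \<phi> x)\<^sup>2) = s - 2 * \<phi> x * m + (\<phi> x)\<^sup>2 * V"
      unfolding eq using i1 i2 i3 I1 by (simp add: m_def s_def)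
    show "0 \<le> s - 2 * \<phi> x * m + (\<phi> x)\<^sup>2 * V"
      unfolding val[symmetric] by (intro integral_nonneg_AE AE_I2) simp
    have "(\<integral>\<^sup>+y. ennreal (indicator ?Q x * (indicator ?Q y * (\<phi> y - \<phi> x)\<^sup>2)) \<partial>lborel)
        = ennreal (LINT y|lborel. indicator ?Q x * (indicator ?Q y * (\<phi> y - \<phi> x)\<^sup>2))"
      using int by (intro nn_integral_eq_integral) auto
    then show "(\<integral>\<^sup>+y. ennreal (indicator ?Q x * (indicator ?Q y * (\<phi> y - \<phi> x)\<^sup>2)) \<partial>lborel)
      = ennreal (indicator ?Q x * (s - 2 * \<phi> x * m + (\<phi> x)\<^sup>2 * V))"
      by (simp add: val)
  qed
  have eq: "(\<lambda>x. indicator ?Q x * (s - 2 * \<phi> x * m + (\<phi> x)\<^sup>2 * V)) =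
      (\<lambda>x. s * indicator ?Q x - 2 * m * (indicator ?Q x * \<phi> x) + V * (indicator ?Q x * (\<phi> x)\<^sup>2))"
    by (auto simp: algebra_simps)
  have int: "integrable lborel (\<lambda>x. indicator ?Q x * (s - 2 * \<phi> x * m + (\<phi> x)\<^sup>2 * V))"
    unfolding eq using i1 i2 i3 by auto
  have val: "(LINT x|lborel. indicator ?Q x * (s - 2 * \<phi> x * m + (\<phi> x)\<^sup>2 * V)) = 2 * V * s - 2 * m\<^sup>2"
    unfolding eq using i1 i2 i3 I1 by (simp add: m_def[symmetric] s_def[symmetric]) (simp add: power2_eq_square)
  have "(\<integral>\<^sup>+x. ennreal (indicator ?Q x * (s - 2 * \<phi> x * m + (\<phi> x)\<^sup>2 * V)) \<partial>lborel) = ennreal (2 * V * s - 2 * m\<^sup>2)"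
    unfolding val[symmetric] using int inner_nn by (intro nn_integral_eq_integral) auto
  then show ?thesis unfolding inner .
qed

text \<open>Two points of one cell differ by a vector of the cube \<open>C\<close> of side 2h. The
  sum is thus at most an integral over z in \<open>C\<close> of squared translation increments;
  \<open>C\<close> has volume (2h)^n, and |z|^2 \<le> n h^2 on it, with n the dimension.\<close>

lemma sum_grid_cell_variance_le:
  fixes \<phi> :: "'a::euclidean_space \<Rightarrow> real" and h :: real
  assumes h: "h > 0" and \<Omega>: "open \<Omega>" and \<phi>: "test_function \<Omega> \<phi>"
    and I: "finite I" "I \<subseteq> extensional Basis"
  shows "(\<Sum>k\<in>I. \<integral>\<^sup>+x. \<integral>\<^sup>+y. ennreal (indicator (grid_cell h k) x * (indicator (grid_cell h k) y * (\<phi> y - \<phi> x)\<^sup>2)) \<partial>lborel \<partial>lborel)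
    \<le> ennreal ((2 * h) ^ DIM('a) * (DIM('a) * h\<^sup>2 * grad_inner \<Omega> \<phi> \<phi>))"
proof -
  have m\<phi> [measurable]: "\<phi> \<in> borel_measurable borel" using \<phi> by (rule borel_measurable_test_function)
  define C :: "'a set" where "C = cbox (- (h *\<^sub>R One)) (h *\<^sub>R One)"
  have C_iff: "z \<in> C \<longleftrightarrow> (\<forall>i\<in>Basis. \<bar>z \<bullet> i\<bar> \<le> h)" for z
    by (force simp: C_def mem_box abs_le_iff)
  have [measurable]: "C \<in> sets borel" by (simp add: C_def)
  have eC: "emeasure lborel C = ennreal ((2 * h) ^ DIM('a))"
  proof -
    have "(\<Prod>b\<in>Basis. (h *\<^sub>R One - - (h *\<^sub>R (One::'a))) \<bullet> b) = (\<Prod>b\<in>(Basis::'a set). 2 * h)"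
      by (intro prod.cong) (simp_all add: inner_diff_left inner_add_left)
    then show ?thesis
      unfolding C_def using h by (subst emeasure_lborel_cbox) (simp_all only: prod_constant, simp)
  qed
  have nC: "(norm z)\<^sup>2 \<le> DIM('a) * h\<^sup>2" if "z \<in> C" for z
  proof -
    have "(norm z)\<^sup>2 = (\<Sum>i\<in>Basis. (z \<bullet> i)\<^sup>2)"
      by (rule sum_Basis_inner_sq[symmetric])
    also have "\<dots> \<le> (\<Sum>i\<in>(Basis::'a set). h\<^sup>2)"
      using that h by (intro sum_mono) (auto simp: C_iff abs_le_square_iff[symmetric])
    finally show ?thesis by simp
  qed
  have "(\<Sum>k\<in>I. \<integral>\<^sup>+x. \<integral>\<^sup>+y. ennreal (indicator (grid_cell h k) x * (indicator (grid_cell h k) y * (\<phi> y - \<phi> x)\<^sup>2)) \<partial>lborel \<partial>lborel)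
      = (\<integral>\<^sup>+x. \<integral>\<^sup>+y. (\<Sum>k\<in>I. ennreal (indicator (grid_cell h k) x * (indicator (grid_cell h k) y * (\<phi> y - \<phi> x)\<^sup>2))) \<partial>lborel \<partial>lborel)"
    by (subst nn_integral_sum, measurable)+
  also have "\<dots> \<le> (\<integral>\<^sup>+x. \<integral>\<^sup>+y. indicator C (y - x) * ennreal ((\<phi> y - \<phi> x)\<^sup>2) \<partial>lborel \<partial>lborel)"
  proof (intro nn_integral_mono)
    fix x y :: 'a
    \<comment> \<open>The only extensional index whose cell contains \<open>x\<close>; the sum over
      cells collapses to at most one term.\<close>
    define k0 where "k0 = (\<lambda>i\<in>Basis. \<lfloor>(x \<bullet> i) / h\<rfloor>)"
    have only: "k = k0" if "k \<in> I" "x \<in> grid_cell h k" for k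
      using that I(2) by (intro extensionalityI[of _ Basis]) (auto simp: k0_def grid_cell_def)
    have near: "y - x \<in> C" if "x \<in> grid_cell h k0" "y \<in> grid_cell h k0"
      using that by (force simp: C_iff grid_cell_iff[OF h] inner_diff_left abs_le_iff)
    have "(\<Sum>k\<in>I. ennreal (indicator (grid_cell h k) x * (indicator (grid_cell h k) y * (\<phi> y - \<phi> x)\<^sup>2)))
        = (\<Sum>k\<in>I \<inter> {k0}. ennreal (indicator (grid_cell h k) x * (indicator (grid_cell h k) y * (\<phi> y - \<phi> x)\<^sup>2)))"
      using I(1) only by (intro sum.mono_neutral_right) (auto simp: indicator_def)
    also have "\<dots> \<le> indicator C (y - x) * ennreal ((\<phi> y - \<phi> x)\<^sup>2)"
    proof (cases "k0 \<in> I")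
      case True
      then have "I \<inter> {k0} = {k0}" by auto
      then show ?thesis
        using near by (cases "x \<in> grid_cell h k0"; cases "y \<in> grid_cell h k0") simp_all
    qed simp
    finally show "(\<Sum>k\<in>I. ennreal (indicator (grid_cell h k) x * (indicator (grid_cell h k) y * (\<phi> y - \<phi> x)\<^sup>2)))
        \<le> indicator C (y - x) * ennreal ((\<phi> y - \<phi> x)\<^sup>2)" .
  qed
  also have "\<dots> = (\<integral>\<^sup>+x. \<integral>\<^sup>+z. indicator C z * ennreal ((\<phi> (x + z) - \<phi> x)\<^sup>2) \<partial>lborel \<partial>lborel)"
  proof (rule nn_integral_cong)
    fix x :: 'a
    have "(\<integral>\<^sup>+y. indicator C (y - x) * ennreal ((\<phi> y - \<phi> x)\<^sup>2) \<partial>lborel)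
        = (\<integral>\<^sup>+z. indicator C (z + x - x) * ennreal ((\<phi> (z + x) - \<phi> x)\<^sup>2) \<partial>lborel)"
      by (rule nn_integral_lborel_translate[symmetric]) measurable
    then show "(\<integral>\<^sup>+y. indicator C (y - x) * ennreal ((\<phi> y - \<phi> x)\<^sup>2) \<partial>lborel)
        = (\<integral>\<^sup>+z. indicator C z * ennreal ((\<phi> (x + z) - \<phi> x)\<^sup>2) \<partial>lborel)"
      by (simp add: add.commute)
  qed
  also have "\<dots> = (\<integral>\<^sup>+z. \<integral>\<^sup>+x. indicator C z * ennreal ((\<phi> (x + z) - \<phi> x)\<^sup>2) \<partial>lborel \<partial>lborel)"
    by (rule lborel_pair.Fubini') measurable
  also have "\<dots> \<le> (\<integral>\<^sup>+z. indicator C z * ennreal (DIM('a) * h\<^sup>2 * grad_inner \<Omega> \<phi> \<phi>) \<partial>lborel)"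
  proof (rule nn_integral_mono)
    fix z
    have "(\<integral>\<^sup>+x. indicator C z * ennreal ((\<phi> (x + z) - \<phi> x)\<^sup>2) \<partial>lborel)
        = indicator C z * (\<integral>\<^sup>+x. ennreal ((\<phi> (x + z) - \<phi> x)\<^sup>2) \<partial>lborel)"
      by (rule nn_integral_cmult) measurable
    also have "\<dots> \<le> indicator C z * ennreal (DIM('a) * h\<^sup>2 * grad_inner \<Omega> \<phi> \<phi>)"
    proof (cases "z \<in> C")
      case True
      have "(\<integral>\<^sup>+x. ennreal ((\<phi> (x + z) - \<phi> x)\<^sup>2) \<partial>lborel) \<le> ennreal ((norm z)\<^sup>2 * grad_inner \<Omega> \<phi> \<phi>)"
        by (rule translation_estimate[OF \<Omega> \<phi>])
      also have "\<dots> \<le> ennreal (DIM('a) * h\<^sup>2 * grad_inner \<Omega> \<phi> \<phi>)"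
        using nC[OF True] by (intro ennreal_leI mult_right_mono) auto
      finally show ?thesis using True by simp
    qed simp
    finally show "(\<integral>\<^sup>+x. indicator C z * ennreal ((\<phi> (x + z) - \<phi> x)\<^sup>2) \<partial>lborel)
        \<le> indicator C z * ennreal (DIM('a) * h\<^sup>2 * grad_inner \<Omega> \<phi> \<phi>)" .
  qed
  also have "\<dots> = ennreal ((2 * h) ^ DIM('a)) * ennreal (DIM('a) * h\<^sup>2 * grad_inner \<Omega> \<phi> \<phi>)"
    by (subst nn_integral_multc) (simp_all add: eC)
  also have "\<dots> = ennreal ((2 * h) ^ DIM('a) * (DIM('a) * h\<^sup>2 * grad_inner \<Omega> \<phi> \<phi>))"
    using h by (intro ennreal_mult[symmetric]) auto
  finally show ?thesis .
qed

section \<open>Approximation, Poincare inequality and compactness inequality\<close>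

lemma grad_inner_tendsto:
  assumes "\<And>i. i \<in> Basis \<Longrightarrow> L2_tendsto \<Omega> (\<lambda>s. weak_deriv \<Omega> i (f s)) (weak_deriv \<Omega> i u) F"
    and "\<And>i. i \<in> Basis \<Longrightarrow> L2_tendsto \<Omega> (\<lambda>s. weak_deriv \<Omega> i (g s)) (weak_deriv \<Omega> i v) F"
  shows "((\<lambda>s. grad_inner \<Omega> (f s) (g s)) \<longlongrightarrow> grad_inner \<Omega> u v) F"
  unfolding grad_inner_def by (intro tendsto_sum L2_tendsto_inner assms)

lemma H01_approximation:
  assumes "open \<Omega>" "u \<in> H01_space \<Omega>"
  obtains \<phi> where "\<And>n. test_function \<Omega> (\<phi> n)" "L2_tendsto \<Omega> \<phi> u sequentially"
    "(\<lambda>n. grad_inner \<Omega> (\<phi> n) (\<phi> n)) \<longlonglongrightarrow> grad_inner \<Omega> u u"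
  using assms(2) grad_inner_tendsto[of \<Omega>] unfolding H01_iff[OF assms(1)] by metis

lemma finite_measure_lebesgue_on_bounded_open:
  "open \<Omega> \<Longrightarrow> bounded \<Omega> \<Longrightarrow> finite_measure (lebesgue_on \<Omega>)"
  by (intro finite_measure_lebesgue_on lmeasurable_open)

text \<open>The constant is crude; it serves to show that the infimum of the Rayleigh quotient is
  positive.\<close>

lemma H01_poincare:
  assumes \<Omega>: "open \<Omega>" "bounded \<Omega>"
  obtains C where "C > 0" "\<And>u. u \<in> H01_space \<Omega> \<Longrightarrow> L2_inner \<Omega> u u \<le> C * grad_inner \<Omega> u u"
proof -
  obtain R where R: "\<And>x. x \<in> \<Omega> \<Longrightarrow> norm x \<le> R" "R > 0"
    using \<Omega>(2) by (auto simp: bounded_pos)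
  have "L2_inner \<Omega> u u \<le> (2 * R + 1)\<^sup>2 * grad_inner \<Omega> u u" if u: "u \<in> H01_space \<Omega>" for u
  proof -
    obtain \<phi> where \<phi>: "\<And>n. test_function \<Omega> (\<phi> n)" "L2_tendsto \<Omega> \<phi> u sequentially"
      "(\<lambda>n. grad_inner \<Omega> (\<phi> n) (\<phi> n)) \<longlonglongrightarrow> grad_inner \<Omega> u u"
      using H01_approximation[OF \<Omega>(1) u] by blast
    have "(\<lambda>n. L2_inner \<Omega> (\<phi> n) (\<phi> n)) \<longlonglongrightarrow> L2_inner \<Omega> u u"
      by (intro L2_tendsto_inner \<phi>)
    moreover have "(\<lambda>n. (2 * R + 1)\<^sup>2 * grad_inner \<Omega> (\<phi> n) (\<phi> n)) \<longlonglongrightarrow> (2 * R + 1)\<^sup>2 * grad_inner \<Omega> u u"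
      by (intro tendsto_intros \<phi>)
    ultimately show ?thesis
      by (rule LIMSEQ_le) (use poincare_test_function[OF \<Omega>(1) R \<phi>(1)] in auto)
  qed
  then show ?thesis using that[of "(2 * R + 1)\<^sup>2"] R(2) by simp
qed

text \<open>The averages over a sufficiently fine grid control the \<open>L\<^sup>2\<close> norm up to a small multiple
  of the Dirichlet form; this quantitative form of compactness is stable under \<open>H\<^sup>1\<close> limits.\<close>

lemma rellich_inequality:
  fixes \<Omega> :: "'a::euclidean_space set"
  assumes \<Omega>: "open \<Omega>" "bounded \<Omega>" and e: "e > 0"
  obtains I :: "('a \<Rightarrow> int) set" and w c where "finite I" "\<And>k. k \<in> I \<Longrightarrow> w k \<in> L2_space \<Omega>" "c \<ge> 0"
    "\<And>u. u \<in> H01_space \<Omega> \<Longrightarrow>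
      L2_inner \<Omega> u u \<le> e * grad_inner \<Omega> u u + c * (\<Sum>k\<in>I. (L2_inner \<Omega> (w k) u)\<^sup>2)"
proof -
  have \<Omega>L: "\<Omega> \<in> sets lebesgue" using \<Omega>(1) by (rule open_sets_lebesgue)
  obtain R where R: "\<And>x. x \<in> \<Omega> \<Longrightarrow> norm x \<le> R" "R > 0"
    using \<Omega>(2) by (auto simp: bounded_pos)
  \<comment> \<open>Chosen so that the factor (2h)^n n h^2 of the cell estimate is the cell volume
    \<open>V\<close> times d h^2; then \<open>h\<close> is adjusted to make d h^2 equal to
    \<open>e\<close>.\<close>
  define d where "d = 2 ^ DIM('a) * real DIM('a)"
  have d: "d > 0" by (simp add: d_def)
  define h where "h = sqrt (e / d)"
  have h: "h > 0" and hd: "d * h\<^sup>2 = e" using e d by (simp_all add: h_def)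
  define V where "V = h ^ DIM('a)"
  have V: "V > 0" using h by (simp add: V_def)
  \<comment> \<open>\<Omega> lies in the ball of radius \<open>R\<close>, so the cells with indices
    between \<open>- N\<close> and \<open>N\<close> cover it.\<close>
  define N where "N = \<lceil>R / h\<rceil> + 1"
  define I :: "('a \<Rightarrow> int) set" where "I = (Basis \<rightarrow>\<^sub>E {- N..N})"
  have I: "finite I" "I \<subseteq> extensional Basis"
    unfolding I_def by (intro finite_PiE finite_Basis finite_atLeastAtMost_int) (simp add: PiE_def)
  define w :: "('a \<Rightarrow> int) \<Rightarrow> 'a \<Rightarrow> real" where "w k = indicator (grid_cell h k)" for k
  interpret finite_measure "lebesgue_on \<Omega>"
    using \<Omega> by (rule finite_measure_lebesgue_on_bounded_open)
  have wL: "w k \<in> L2_space \<Omega>" for k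
  proof -
    have "(\<lambda>x. indicator (grid_cell h k) x :: real) \<in> borel_measurable lborel" by simp
    then have m: "(\<lambda>x. indicator (grid_cell h k) x :: real) \<in> borel_measurable (lebesgue_on \<Omega>)"
      by (intro measurable_restrict_space1 measurable_completion)
    have "integrable (lebesgue_on \<Omega>) (\<lambda>x. (w k x)\<^sup>2)"
      using m by (intro integrable_const_bound[of _ 1]) (auto simp: w_def indicator_def)
    then show ?thesis using m by (simp add: L2_space_def w_def)
  qed
  have one_cell: "(\<Sum>k\<in>I. w k x) = 1" if x: "x \<in> \<Omega>" for x
  proof -
    define k0 where "k0 = (\<lambda>i\<in>Basis. \<lfloor>(x \<bullet> i) / h\<rfloor>)"
    have k0: "k0 \<in> I"
    proof -
      have "- N \<le> \<lfloor>(x \<bullet> i) / h\<rfloor> \<and> \<lfloor>(x \<bullet> i) / h\<rfloor> \<le> N" if i: "i \<in> Basis" for i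
      proof -
        have "\<bar>x \<bullet> i\<bar> \<le> R" using Basis_le_norm[OF i, of x] R(1)[OF x] by simp
        then have "- (R / h) \<le> (x \<bullet> i) / h" "(x \<bullet> i) / h \<le> R / h"
          using h by (auto simp: field_simps abs_le_iff)
        then show ?thesis unfolding N_def by linarith
      qed
      then show ?thesis by (auto simp: I_def k0_def)
    qed
    have only: "k = k0" if "k \<in> I" "x \<in> grid_cell h k" for k
      using that I(2) by (intro extensionalityI[of _ Basis]) (auto simp: k0_def grid_cell_def)
    have "x \<in> grid_cell h k0" by (auto simp: k0_def grid_cell_def)
    then have "w k x = (if k = k0 then 1 else 0)" if "k \<in> I" for k
      using only[OF that] by (cases "x \<in> grid_cell h k") (auto simp: w_def)
    then show ?thesis using I(1) k0 by simp
  qed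
  have test: "L2_inner \<Omega> \<phi> \<phi> \<le> e * grad_inner \<Omega> \<phi> \<phi> + 1 / V * (\<Sum>k\<in>I. (L2_inner \<Omega> (w k) \<phi>)\<^sup>2)"
    if \<phi>: "test_function \<Omega> \<phi>" for \<phi>
  proof -
    have m\<phi> [measurable]: "\<phi> \<in> borel_measurable borel" using \<phi> by (rule borel_measurable_test_function)
    have zero: "\<phi> x = 0" if "x \<notin> \<Omega>" for x using \<phi> that by (auto simp: test_function_def)
    define m where "m k = (LINT x|lborel. indicator (grid_cell h k) x * \<phi> x)" for k
    define s where "s k = (LINT x|lborel. indicator (grid_cell h k) x * (\<phi> x)\<^sup>2)" for k
    have m_eq: "m k = L2_inner \<Omega> (w k) \<phi>" for k
      unfolding m_def L2_inner_def w_def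
      by (intro integral_lebesgue_on_eq_lborel[symmetric] \<Omega>L) (auto simp: zero)
    have "(\<Sum>k\<in>I. s k) = (LINT x|lborel. (\<Sum>k\<in>I. indicator (grid_cell h k) x * (\<phi> x)\<^sup>2))"
      unfolding s_def
    proof (rule Bochner_Integration.integral_sum[symmetric])
      show "integrable lborel (\<lambda>x. indicator (grid_cell h k) x * (\<phi> x)\<^sup>2)" for k
        using integrable_mult_indicator[OF _ test_function_integrable[OF test_function_mult[OF \<phi> \<phi>]], of "grid_cell h k"]
        by (simp add: power2_eq_square)
    qed
    also have "\<dots> = (LINT x|lborel. \<phi> x * \<phi> x)"
    proof (rule Bochner_Integration.integral_cong[OF refl])
      fix x
      show "(\<Sum>k\<in>I. indicator (grid_cell h k) x * (\<phi> x)\<^sup>2) = \<phi> x * \<phi> x"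
        using one_cell[of x] zero[of x]
        by (cases "x \<in> \<Omega>") (simp_all add: sum_distrib_right[symmetric] w_def power2_eq_square)
    qed
    also have "\<dots> = L2_inner \<Omega> \<phi> \<phi>"
      unfolding L2_inner_def by (intro integral_lebesgue_on_eq_lborel[symmetric] \<Omega>L) (auto simp: zero)
    finally have s_sum: "(\<Sum>k\<in>I. s k) = L2_inner \<Omega> \<phi> \<phi>" .
    have "(\<Sum>k\<in>I. ennreal (2 * V * s k - 2 * (m k)\<^sup>2)) \<le> ennreal ((2 * h) ^ DIM('a) * (DIM('a) * h\<^sup>2 * grad_inner \<Omega> \<phi> \<phi>))"
      using sum_grid_cell_variance_le[OF h \<Omega>(1) \<phi> I]
      unfolding grid_cell_variance[OF h \<phi>] m_def s_def V_def .
    also have "(2 * h) ^ DIM('a) * (DIM('a) * h\<^sup>2 * grad_inner \<Omega> \<phi> \<phi>) = V * (e * grad_inner \<Omega> \<phi> \<phi>)"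
      unfolding V_def hd[symmetric] d_def by (simp add: power_mult_distrib)
    finally have le: "(\<Sum>k\<in>I. ennreal (2 * V * s k - 2 * (m k)\<^sup>2)) \<le> ennreal (V * (e * grad_inner \<Omega> \<phi> \<phi>))" .
    \<comment> \<open>As \<open>ennreal\<close> truncates negative numbers to 0, the real sum is
      compared with the sum of the positive parts.\<close>
    have "ennreal (\<Sum>k\<in>I. 2 * V * s k - 2 * (m k)\<^sup>2) \<le> ennreal (\<Sum>k\<in>I. max 0 (2 * V * s k - 2 * (m k)\<^sup>2))"
      by (intro ennreal_leI sum_mono) simp
    also have "\<dots> = (\<Sum>k\<in>I. ennreal (max 0 (2 * V * s k - 2 * (m k)\<^sup>2)))"
      by (rule sum_ennreal[symmetric]) simp
    also have "\<dots> = (\<Sum>k\<in>I. ennreal (2 * V * s k - 2 * (m k)\<^sup>2))"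
      by (intro sum.cong) (auto simp: max_def ennreal_neg)
    finally have "(\<Sum>k\<in>I. 2 * V * s k - 2 * (m k)\<^sup>2) \<le> V * (e * grad_inner \<Omega> \<phi> \<phi>)"
      using le V e by (meson ennreal_le_iff grad_inner_self_nonneg less_imp_le mult_nonneg_nonneg order_trans)
    then have "2 * V * (\<Sum>k\<in>I. s k) \<le> V * (e * grad_inner \<Omega> \<phi> \<phi>) + 2 * (\<Sum>k\<in>I. (m k)\<^sup>2)"
      by (simp add: sum_subtractf sum_distrib_left)
    \<comment> \<open>Halving this leaves only half of the gradient term; the other half is given
      away.\<close>
    then have "2 * (\<Sum>k\<in>I. s k) \<le> e * grad_inner \<Omega> \<phi> \<phi> + 2 * (1 / V * (\<Sum>k\<in>I. (m k)\<^sup>2))"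
      using V by (simp add: field_simps)
    moreover have "0 \<le> e * grad_inner \<Omega> \<phi> \<phi>" using e by simp
    ultimately show ?thesis by (simp add: s_sum m_eq)
  qed
  have "L2_inner \<Omega> u u \<le> e * grad_inner \<Omega> u u + 1 / V * (\<Sum>k\<in>I. (L2_inner \<Omega> (w k) u)\<^sup>2)"
    if u: "u \<in> H01_space \<Omega>" for u
  proof -
    obtain \<phi> where \<phi>: "\<And>n. test_function \<Omega> (\<phi> n)" "L2_tendsto \<Omega> \<phi> u sequentially"
      "(\<lambda>n. grad_inner \<Omega> (\<phi> n) (\<phi> n)) \<longlonglongrightarrow> grad_inner \<Omega> u u"
      using H01_approximation[OF \<Omega>(1) u] by blast
    have "(\<lambda>n. L2_inner \<Omega> (\<phi> n) (\<phi> n)) \<longlonglongrightarrow> L2_inner \<Omega> u u"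
      by (intro L2_tendsto_inner \<phi>)
    moreover have "(\<lambda>n. e * grad_inner \<Omega> (\<phi> n) (\<phi> n) + 1 / V * (\<Sum>k\<in>I. (L2_inner \<Omega> (w k) (\<phi> n))\<^sup>2))
        \<longlonglongrightarrow> e * grad_inner \<Omega> u u + 1 / V * (\<Sum>k\<in>I. (L2_inner \<Omega> (w k) u)\<^sup>2)"
      by (intro tendsto_add tendsto_mult tendsto_const tendsto_sum tendsto_power L2_tendsto_inner
          L2_tendsto_const wL \<phi>)
    ultimately show ?thesis
      by (rule LIMSEQ_le) (use test[OF \<phi>(1)] in auto)
  qed
  then show ?thesis using that[of I w "1 / V"] I(1) wL V by simp
qed

section \<open>Completeness of \<open>L2_space\<close>\<close>

text \<open>The Riesz-Fischer argument: on a set of finite measure an L^2 Cauchy sequence is L^1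
  Cauchy, so a subsequence converges almost everywhere, and Fatou's lemma turns its limit into the
  L^2 limit.\<close>

lemma L2_complete:
  fixes f :: "nat \<Rightarrow> 'a::euclidean_space \<Rightarrow> real"
  assumes \<Omega>: "open \<Omega>" "bounded \<Omega>" and f: "\<And>n. f n \<in> L2_space \<Omega>"
    and cauchy: "\<And>e. e > 0 \<Longrightarrow> \<exists>N. \<forall>m\<ge>N. \<forall>n\<ge>N. Lnorm \<Omega> 2 (\<lambda>x. f m x - f n x) < e"
  obtains l where "L2_tendsto \<Omega> f l sequentially"
proof -
  interpret finite_measure "lebesgue_on \<Omega>"
    using \<Omega> by (rule finite_measure_lebesgue_on_bounded_open)
  have one: "(\<lambda>x. 1) \<in> L2_space \<Omega>" by (simp add: L2_space_def)
  have L1_le: "(LINT x|lebesgue_on \<Omega>. norm (g x)) \<le> Lnorm \<Omega> 2 (\<lambda>x. 1 :: real) * Lnorm \<Omega> 2 g"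
    if g: "g \<in> L2_space \<Omega>" for g :: "'a \<Rightarrow> real"
  proof -
    have ag: "(\<lambda>x. \<bar>g x\<bar>) \<in> L2_space \<Omega>" using g by (auto simp: L2_space_def)
    have "(LINT x|lebesgue_on \<Omega>. norm (g x)) = L2_inner \<Omega> (\<lambda>x. 1) (\<lambda>x. \<bar>g x\<bar>)"
      by (simp add: L2_inner_def)
    also have "\<dots> \<le> Lnorm \<Omega> 2 (\<lambda>x. 1 :: real) * Lnorm \<Omega> 2 (\<lambda>x. \<bar>g x\<bar>)"
      using L2_Cauchy_Schwarz[OF one ag] by simp
    also have "Lnorm \<Omega> 2 (\<lambda>x. \<bar>g x\<bar>) = Lnorm \<Omega> 2 g" by (simp add: Lnorm_2_eq)
    finally show ?thesis .
  qed
  have int1: "integrable (lebesgue_on \<Omega>) (f n)" for n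
    using L2_mult_integrable[OF one f[of n]] by simp
  obtain r where r: "strict_mono r" and ae: "AE x in lebesgue_on \<Omega>. Cauchy (\<lambda>i. f (r i) x)"
  proof (rule cauchy_L1_AE_cauchy_subseq[of "lebesgue_on \<Omega>" f])
    fix e :: real assume e: "e > 0"
    \<comment> \<open>The L^2 norm of 1 is the constant of the embedding into L^1; adding 1 makes it
      positive.\<close>
    define K where "K = Lnorm \<Omega> 2 (\<lambda>x. 1 :: real) + 1"
    have K: "K > 0" using Lnorm_nonneg[of \<Omega> 2 "\<lambda>x. 1 :: real"] by (simp add: K_def del: Lnorm_nonneg)
    obtain N where N: "\<forall>m\<ge>N. \<forall>n\<ge>N. Lnorm \<Omega> 2 (\<lambda>x. f m x - f n x) < e / K"
      using cauchy[of "e / K"] e K by auto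
    have "(LINT x|lebesgue_on \<Omega>. norm (f m x - f n x)) < e" if "m \<ge> N" "n \<ge> N" for m n
    proof -
      have "(LINT x|lebesgue_on \<Omega>. norm (f m x - f n x)) \<le> K * Lnorm \<Omega> 2 (\<lambda>x. f m x - f n x)"
        using L1_le[OF L2_diff[OF f[of m] f[of n]]] Lnorm_nonneg[of \<Omega> 2 "\<lambda>x. f m x - f n x"]
        by (simp add: K_def distrib_right del: Lnorm_nonneg)
      also have "\<dots> < K * (e / K)" using N that K by (intro mult_strict_left_mono) auto
      finally show ?thesis using K by simp
    qed
    then show "\<exists>N. \<forall>i\<ge>N. \<forall>j\<ge>N. (LINT x|lebesgue_on \<Omega>. norm (f i x - f j x)) < e" by blast
  qed (use int1 in auto)
  define l where "l = (\<lambda>x. lim (\<lambda>i. f (r i) x))"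
  have [measurable]: "f n \<in> borel_measurable (lebesgue_on \<Omega>)" for n using f by (rule L2_measurable)
  have lm [measurable]: "l \<in> borel_measurable (lebesgue_on \<Omega>)"
    unfolding l_def by (rule borel_measurable_lim_metric) measurable
  have lim: "AE x in lebesgue_on \<Omega>. (\<lambda>i. f (r i) x) \<longlonglongrightarrow> l x"
    using ae by eventually_elim (simp add: l_def Cauchy_convergent_iff convergent_LIMSEQ_iff)
  \<comment> \<open>Here \<open>n\<close> stays fixed and the other index tends to infinity along
    the subsequence.\<close>
  have fatou: "integrable (lebesgue_on \<Omega>) (\<lambda>x. (f n x - l x)\<^sup>2) \<and> Lnorm \<Omega> 2 (\<lambda>x. f n x - l x) \<le> e"
    if e: "e > 0" and n: "\<And>m. m \<ge> n \<Longrightarrow> Lnorm \<Omega> 2 (\<lambda>x. f n x - f m x) < e" for n e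
  proof -
    have "(\<integral>\<^sup>+x. ennreal ((f n x - l x)\<^sup>2) \<partial>lebesgue_on \<Omega>)
        = (\<integral>\<^sup>+x. liminf (\<lambda>i. ennreal ((f n x - f (r i) x)\<^sup>2)) \<partial>lebesgue_on \<Omega>)"
    proof (rule nn_integral_cong_AE)
      show "AE x in lebesgue_on \<Omega>. ennreal ((f n x - l x)\<^sup>2) = liminf (\<lambda>i. ennreal ((f n x - f (r i) x)\<^sup>2))"
        using lim
      proof eventually_elim
        case (elim x)
        then have "(\<lambda>i. ennreal ((f n x - f (r i) x)\<^sup>2)) \<longlonglongrightarrow> ennreal ((f n x - l x)\<^sup>2)"
          by (intro tendsto_ennrealI tendsto_intros)
        from lim_imp_Liminf[OF sequentially_bot this] show ?case by simp
      qed
    qed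
    also have "\<dots> \<le> liminf (\<lambda>i. \<integral>\<^sup>+x. ennreal ((f n x - f (r i) x)\<^sup>2) \<partial>lebesgue_on \<Omega>)"
      by (rule nn_integral_liminf) measurable
    also have "\<dots> \<le> ennreal (e\<^sup>2)"
    proof (rule Liminf_le)
      have "(\<integral>\<^sup>+x. ennreal ((f n x - f (r i) x)\<^sup>2) \<partial>lebesgue_on \<Omega>) \<le> ennreal (e\<^sup>2)" if i: "i \<ge> n" for i
      proof -
        have "r i \<ge> n" using seq_suble[OF r, of i] i by simp
        then have "(Lnorm \<Omega> 2 (\<lambda>x. f n x - f (r i) x))\<^sup>2 \<le> e\<^sup>2"
          using n[of "r i"] by (intro power_mono) auto
        moreover have "(\<integral>\<^sup>+x. ennreal ((f n x - f (r i) x)\<^sup>2) \<partial>lebesgue_on \<Omega>)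
            = ennreal (LINT x|lebesgue_on \<Omega>. (f n x - f (r i) x)\<^sup>2)"
          using L2_square_integrable[OF L2_diff[OF f[of n] f[of "r i"]]]
          by (intro nn_integral_eq_integral) auto
        ultimately show ?thesis by (simp add: Lnorm_2_eq ennreal_leI)
      qed
      then show "\<forall>\<^sub>F i in sequentially. (\<integral>\<^sup>+x. ennreal ((f n x - f (r i) x)\<^sup>2) \<partial>lebesgue_on \<Omega>) \<le> ennreal (e\<^sup>2)"
        by (auto simp: eventually_sequentially)
    qed simp
    finally have le: "(\<integral>\<^sup>+x. ennreal ((f n x - l x)\<^sup>2) \<partial>lebesgue_on \<Omega>) \<le> ennreal (e\<^sup>2)" .
    have int: "integrable (lebesgue_on \<Omega>) (\<lambda>x. (f n x - l x)\<^sup>2)"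
      using le by (intro integrableI_bounded) (auto simp: le_less_trans)
    moreover have "(LINT x|lebesgue_on \<Omega>. (f n x - l x)\<^sup>2) \<le> e\<^sup>2"
      using le nn_integral_eq_integral[OF int] by (simp add: ennreal_le_iff)
    ultimately show ?thesis
      using e by (simp add: Lnorm_2_eq real_le_lsqrt)
  qed
  have ev: "\<exists>N. \<forall>n\<ge>N. (\<lambda>x. f n x - l x) \<in> L2_space \<Omega> \<and> Lnorm \<Omega> 2 (\<lambda>x. f n x - l x) \<le> e" if e: "e > 0" for e
  proof -
    obtain N where N: "\<forall>m\<ge>N. \<forall>n\<ge>N. Lnorm \<Omega> 2 (\<lambda>x. f m x - f n x) < e" using cauchy[OF e] by blast
    have "(\<lambda>x. f n x - l x) \<in> L2_space \<Omega> \<and> Lnorm \<Omega> 2 (\<lambda>x. f n x - l x) \<le> e" if "n \<ge> N" for n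
      using fatou[OF e, of n] N that by (auto simp: L2_space_def)
    then show ?thesis by blast
  qed
  have "l \<in> L2_space \<Omega>"
  proof -
    obtain n where "(\<lambda>x. f n x - l x) \<in> L2_space \<Omega>" using ev[of 1] by auto
    from L2_diff[OF f[of n] this] show ?thesis by simp
  qed
  moreover have "(\<lambda>n. Lnorm \<Omega> 2 (\<lambda>x. f n x - l x)) \<longlonglongrightarrow> 0"
  proof (rule LIMSEQ_I)
    fix e :: real assume e: "e > 0"
    obtain N where "\<forall>n\<ge>N. Lnorm \<Omega> 2 (\<lambda>x. f n x - l x) \<le> e / 2" using ev[of "e / 2"] e by auto
    then show "\<exists>N. \<forall>n\<ge>N. norm (Lnorm \<Omega> 2 (\<lambda>x. f n x - l x) - 0) < e"
      using e by (intro exI[of _ N]) force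
  qed
  ultimately have "L2_tendsto \<Omega> f l sequentially"
    using f by (simp add: L2_tendsto_def)
  then show ?thesis using that by blast
qed

text \<open>For each accuracy 1/(j + 1) the compactness inequality involves finitely many
  functionals, countably many in all. A diagonal subsequence makes all of them converge, and the
  inequality applied to differences shows that it is Cauchy in L^2.\<close>

lemma H01_bounded_Cauchy_subseq:
  fixes u :: "nat \<Rightarrow> 'a::euclidean_space \<Rightarrow> real"
  assumes \<Omega>: "open \<Omega>" "bounded \<Omega>" and u: "\<And>n. u n \<in> H01_space \<Omega>"
    and bd: "\<And>n. Lnorm \<Omega> 2 (u n) \<le> 1" "\<And>n. grad_inner \<Omega> (u n) (u n) \<le> B"
  obtains r where "strict_mono (r :: nat \<Rightarrow> nat)"
    "\<And>e. e > 0 \<Longrightarrow> \<exists>N. \<forall>m\<ge>N. \<forall>n\<ge>N. Lnorm \<Omega> 2 (\<lambda>x. u (r m) x - u (r n) x) < e"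
proof -
  have "\<exists>(I :: ('a \<Rightarrow> int) set) w c. finite I \<and> (\<forall>k\<in>I. w k \<in> L2_space \<Omega>) \<and> 0 \<le> c \<and> (\<forall>u\<in>H01_space \<Omega>.
      L2_inner \<Omega> u u \<le> 1 / real (Suc j) * grad_inner \<Omega> u u + c * (\<Sum>k\<in>I. (L2_inner \<Omega> (w k) u)\<^sup>2))"
    for j :: nat
  proof (rule rellich_inequality[OF \<Omega>, of "1 / real (Suc j)"])
    fix I :: "('a \<Rightarrow> int) set" and w c
    assume "finite I" "\<And>k. k \<in> I \<Longrightarrow> w k \<in> L2_space \<Omega>" "c \<ge> 0"
      "\<And>u. u \<in> H01_space \<Omega> \<Longrightarrow> L2_inner \<Omega> u u \<le>
        1 / real (Suc j) * grad_inner \<Omega> u u + c * (\<Sum>k\<in>I. (L2_inner \<Omega> (w k) u)\<^sup>2)"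
    then show ?thesis by (intro exI[of _ I] exI[of _ w] exI[of _ c]) simp
  qed simp
  then obtain I :: "nat \<Rightarrow> ('a \<Rightarrow> int) set" and w c where I: "\<And>j. finite (I j)"
    and w: "\<And>j k. k \<in> I j \<Longrightarrow> w j k \<in> L2_space \<Omega>" and c: "\<And>j. 0 \<le> c j"
    and rellich: "\<And>j u. u \<in> H01_space \<Omega> \<Longrightarrow> L2_inner \<Omega> u u \<le>
      1 / real (Suc j) * grad_inner \<Omega> u u + c j * (\<Sum>k\<in>I j. (L2_inner \<Omega> (w j k) u)\<^sup>2)"
    by metis
  define S where "S = (SIGMA j:UNIV. I j)"
  \<comment> \<open>The division gives the uniform bound 1 required for the diagonal extraction;
    adding 1 avoids a zero denominator.\<close>
  define a where "a n = (\<lambda>(j, k). L2_inner \<Omega> (w j k) (u n) / (Lnorm \<Omega> 2 (w j k) + 1))" for n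
  have cS: "countable S" unfolding S_def using I by (intro countable_SIGMA) (auto intro: countable_finite)
  have bdS: "norm (a n x) \<le> 1" if xS: "x \<in> S" for n x
  proof -
    obtain j k where x: "x = (j, k)" "k \<in> I j" using xS by (auto simp: S_def)
    have "\<bar>L2_inner \<Omega> (w j k) (u n)\<bar> \<le> Lnorm \<Omega> 2 (w j k) * Lnorm \<Omega> 2 (u n)"
      by (rule L2_Cauchy_Schwarz[OF w[OF x(2)] H01_L2[OF u]])
    also have "\<dots> \<le> Lnorm \<Omega> 2 (w j k) * 1"
      using bd(1) by (intro mult_left_mono) auto
    finally have "\<bar>L2_inner \<Omega> (w j k) (u n)\<bar> \<le> Lnorm \<Omega> 2 (w j k) + 1" by simp
    moreover have "0 < Lnorm \<Omega> 2 (w j k) + 1" using Lnorm_nonneg[of \<Omega> 2 "w j k"] by linarith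
    ultimately show ?thesis by (simp add: a_def x(1) abs_divide divide_le_eq)
  qed
  obtain r where r: "strict_mono (r :: nat \<Rightarrow> nat)" and conv: "\<And>x. x \<in> S \<Longrightarrow> \<exists>l. (\<lambda>n. a (r n) x) \<longlonglongrightarrow> l"
    by (rule function_convergent_subsequence[where f = a and M = 1, OF cS bdS]) (assumption, blast)
  have conv': "Cauchy (\<lambda>n. L2_inner \<Omega> (w j k) (u (r n)))" if k: "k \<in> I j" for j k
  proof -
    obtain l where "(\<lambda>n. a (r n) (j, k)) \<longlonglongrightarrow> l" using conv[of "(j, k)"] k by (auto simp: S_def)
    then have "(\<lambda>n. a (r n) (j, k) * (Lnorm \<Omega> 2 (w j k) + 1)) \<longlonglongrightarrow> l * (Lnorm \<Omega> 2 (w j k) + 1)"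
      by (rule tendsto_mult_right)
    moreover have "Lnorm \<Omega> 2 (w j k) + 1 \<noteq> 0" using Lnorm_nonneg[of \<Omega> 2 "w j k"] by linarith
    ultimately have "(\<lambda>n. L2_inner \<Omega> (w j k) (u (r n))) \<longlonglongrightarrow> l * (Lnorm \<Omega> 2 (w j k) + 1)"
      by (simp add: a_def)
    then show ?thesis by (rule LIMSEQ_imp_Cauchy)
  qed
  \<comment> \<open>|x - y|^2 \<le> 2 |x|^2 + 2 |y|^2 for the Dirichlet form.\<close>
  have grad_diff: "grad_inner \<Omega> (\<lambda>x. u m x - u n x) (\<lambda>x. u m x - u n x) \<le> 4 * B" for m n
  proof -
    note H = H01_H1[OF u[of m]] H01_H1[OF u[of n]]
    have "grad_inner \<Omega> (\<lambda>x. u m x - u n x) (\<lambda>x. u m x - u n x)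
        = grad_inner \<Omega> (u m) (u m) - 2 * grad_inner \<Omega> (u m) (u n) + grad_inner \<Omega> (u n) (u n)"
      using grad_inner_sq_lincomb[OF \<Omega>(1) H, of 1 "-1"] by simp
    moreover have "0 \<le> grad_inner \<Omega> (u m) (u m) + 2 * grad_inner \<Omega> (u m) (u n) + grad_inner \<Omega> (u n) (u n)"
      using grad_inner_sq_lincomb[OF \<Omega>(1) H, of 1 1] grad_inner_self_nonneg[of \<Omega> "\<lambda>x. u m x + u n x"]
      by simp
    ultimately show ?thesis using bd(2)[of m] bd(2)[of n] by linarith
  qed
  have B: "B \<ge> 0" using bd(2)[of 0] grad_inner_self_nonneg[of \<Omega> "u 0"] by linarith
  have "\<exists>N. \<forall>m\<ge>N. \<forall>n\<ge>N. Lnorm \<Omega> 2 (\<lambda>x. u (r m) x - u (r n) x) < e" if e: "e > 0" for e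
  proof -
    \<comment> \<open>The accuracy \<open>j\<close> is fixed so that the gradient part takes less
      than half of e^2; the finitely many functionals of that \<open>j\<close> get the other
      half.\<close>
    obtain j :: nat where j: "(4 * B + 1) * 2 / e\<^sup>2 < real j" using reals_Archimedean2 by blast
    have gj: "1 / real (Suc j) * (4 * B) < e\<^sup>2 / 2"
    proof -
      have "(4 * B + 1) * 2 < real j * e\<^sup>2" using j e by (simp add: divide_less_eq)
      also have "\<dots> \<le> real (Suc j) * e\<^sup>2" by (intro mult_right_mono) auto
      finally have "4 * B < real (Suc j) * (e\<^sup>2 / 2)" using B by (simp add: algebra_simps)
      then show ?thesis by (simp add: divide_less_eq mult.commute del: of_nat_Suc)
    qed
    define s where "s n k = L2_inner \<Omega> (w j k) (u (r n))" for n k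
    \<comment> \<open>The share of each functional: \<open>card (I j)\<close> of them, weighted by
      \<open>c j\<close>, contribute at most e^2/2. The summands 1 exclude division by 0.\<close>
    define d where "d = e\<^sup>2 / (2 * (c j + 1) * (real (card (I j)) + 1))"
    have d: "d > 0" using e c[of j] by (auto simp: d_def intro!: divide_pos_pos mult_pos_pos)
    have "\<exists>N. \<forall>m\<ge>N. \<forall>n\<ge>N. (s m k - s n k)\<^sup>2 < d" if k: "k \<in> I j" for k
    proof -
      obtain N where N: "\<forall>m\<ge>N. \<forall>n\<ge>N. norm (s m k - s n k) < sqrt d"
        using CauchyD[OF conv'[OF k], of "sqrt d"] d unfolding s_def by auto
      have "(s m k - s n k)\<^sup>2 < d" if "m \<ge> N" "n \<ge> N" for m n
      proof -
        have "\<bar>s m k - s n k\<bar>\<^sup>2 < (sqrt d)\<^sup>2" using N that by (intro power_strict_mono) auto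
        then show ?thesis using d by simp
      qed
      then show ?thesis by blast
    qed
    then obtain N where N: "\<And>k m n. k \<in> I j \<Longrightarrow> m \<ge> N k \<Longrightarrow> n \<ge> N k \<Longrightarrow> (s m k - s n k)\<^sup>2 < d" by metis
    define M where "M = Max (insert 0 (N ` I j))"
    have "Lnorm \<Omega> 2 (\<lambda>x. u (r m) x - u (r n) x) < e" if mn: "m \<ge> M" "n \<ge> M" for m n
    proof -
      let ?v = "\<lambda>x. u (r m) x - u (r n) x"
      have NM: "N k \<le> M" if "k \<in> I j" for k unfolding M_def using I that by (intro Max_ge) auto
      have "(\<Sum>k\<in>I j. (L2_inner \<Omega> (w j k) ?v)\<^sup>2) \<le> (\<Sum>k\<in>I j. d)"
      proof (rule sum_mono)
        fix k assume k: "k \<in> I j"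
        have "L2_inner \<Omega> (w j k) ?v = s m k - s n k"
          unfolding s_def by (rule L2_inner_diff_right[OF H01_L2[OF u] H01_L2[OF u] w[OF k]])
        then show "(L2_inner \<Omega> (w j k) ?v)\<^sup>2 \<le> d"
          using N[OF k, of m n] NM[OF k] mn by simp
      qed
      then have "c j * (\<Sum>k\<in>I j. (L2_inner \<Omega> (w j k) ?v)\<^sup>2) \<le> c j * (real (card (I j)) * d)"
        using c by (intro mult_left_mono) auto
      also have "\<dots> \<le> (c j + 1) * ((real (card (I j)) + 1) * d)"
        using c[of j] d by (intro mult_mono) auto
      also have "\<dots> = e\<^sup>2 / 2"
      proof -
        have "2 * (c j + 1) * (real (card (I j)) + 1) \<noteq> 0" using c[of j] by simp
        then show ?thesis unfolding d_def by (simp add: field_simps)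
      qed
      finally have "c j * (\<Sum>k\<in>I j. (L2_inner \<Omega> (w j k) ?v)\<^sup>2) \<le> e\<^sup>2 / 2" .
      moreover have "1 / real (Suc j) * grad_inner \<Omega> ?v ?v \<le> 1 / real (Suc j) * (4 * B)"
        by (rule mult_left_mono[OF grad_diff]) simp
      ultimately have "L2_inner \<Omega> ?v ?v < e\<^sup>2"
        using rellich[OF H01_diff[OF \<Omega>(1) u[of "r m"] u[of "r n"]], of j] gj by linarith
      then have "(Lnorm \<Omega> 2 ?v)\<^sup>2 < e\<^sup>2" by (simp add: Lnorm_2_sq)
      then show ?thesis using e power_less_imp_less_base[of "Lnorm \<Omega> 2 ?v" 2 e] by simp
    qed
    then show ?thesis by blast
  qed
  with r that show ?thesis by blast
qed

section \<open>The principal eigenvalue\<close>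

text \<open>A bump on a box in \<Omega> is continuous and positive at some point, hence nonzero on a
  nonempty open set, which is not a null set.\<close>

lemma H01_nontrivial:
  fixes \<Omega> :: "'a::euclidean_space set"
  assumes \<Omega>: "open \<Omega>" "\<Omega> \<noteq> {}"
  obtains u where "u \<in> H01_space \<Omega>" "L2_inner \<Omega> u u > 0"
proof -
  obtain x where x: "x \<in> \<Omega>" using \<Omega>(2) by blast
  obtain a b where ab: "cbox a b \<subseteq> \<Omega>" "x \<in> box a b"
    using open_contains_cbox[OF \<Omega>(1) x] by metis
  obtain \<phi> :: "nat \<Rightarrow> 'a \<Rightarrow> real" where \<phi>: "\<And>n. test_function \<Omega> (\<phi> n)"
    "\<And>x. (\<lambda>n. \<phi> n x) \<longlonglongrightarrow> indicator (box a b) x"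
    using box_approx_test_functions[OF ab(1)] by metis
  have "\<forall>\<^sub>F n in sequentially. \<phi> n x > 1 / 2"
    using \<phi>(2)[of x] ab(2) by (intro order_tendstoD(1)) auto
  then obtain n where n: "\<phi> n x > 1 / 2" by (auto simp: eventually_sequentially)
  have "\<not> zero_on \<Omega> (\<phi> n)"
  proof
    assume "zero_on \<Omega> (\<phi> n)"
    then have "AE y in lebesgue. y \<in> \<Omega> \<longrightarrow> \<phi> n y = 0"
      using AE_lebesgue_on_iff[OF open_sets_lebesgue[OF \<Omega>(1)]] by (simp add: zero_on_def)
    then have neg: "{y. \<not> (y \<in> \<Omega> \<longrightarrow> \<phi> n y = 0)} \<in> null_sets lebesgue"
      by (simp add: completion.AE_iff_null_sets)
    let ?U = "{y. \<phi> n y \<noteq> 0} \<inter> \<Omega>"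
    have "open ?U"
    proof (rule open_Int[OF _ \<Omega>(1)])
      have "open (\<phi> n -` (- {0}))"
        by (rule open_vimage[OF _ test_function_continuous[OF \<phi>(1)]]) auto
      then show "open {y. \<phi> n y \<noteq> 0}" by (simp add: vimage_def)
    qed
    moreover have "x \<in> ?U" using n x by simp
    moreover have "?U = {y. \<not> (y \<in> \<Omega> \<longrightarrow> \<phi> n y = 0)}" by auto
    ultimately show False
      using neg open_not_negligible[of ?U] by (auto simp: negligible_iff_null_sets)
  qed
  then have "L2_inner \<Omega> (\<phi> n) (\<phi> n) \<noteq> 0"
    using L2_inner_self_eq_0_iff[OF test_function_L2[OF \<phi>(1) open_sets_lebesgue[OF \<Omega>(1)]]] by blast
  then have "L2_inner \<Omega> (\<phi> n) (\<phi> n) > 0"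
    using L2_inner_self_nonneg[of \<Omega> "\<phi> n"] by linarith
  then show ?thesis using that test_function_H01[OF \<Omega>(1) \<phi>(1)] by blast
qed

text \<open>\<open>principal_eigenvalue\<close> is a \<open>LEAST\<close>, which says something only
  once a smallest eigenvalue is known to exist. The direct method provides it: the infimum \<mu> of
  the Rayleigh quotient is attained, the minimizer is an eigenfunction, and no eigenvalue lies below
  \<mu>.\<close>

theorem principal_eigenvalue_characterization:
  fixes \<Omega> :: "'a::euclidean_space set"
  assumes \<Omega>: "open \<Omega>" "bounded \<Omega>" "\<Omega> \<noteq> {}"
  shows "principal_eigenvalue \<Omega> > 0"
    and "w \<in> H01_space \<Omega> \<Longrightarrow> principal_eigenvalue \<Omega> * L2_inner \<Omega> w w \<le> grad_inner \<Omega> w w"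
proof -
  have \<Omega>L: "\<Omega> \<in> sets lebesgue" using \<Omega>(1) by (rule open_sets_lebesgue)
  define S where "S = {grad_inner \<Omega> u u | u. u \<in> H01_space \<Omega> \<and> L2_inner \<Omega> u u = 1}"
  define \<mu> where "\<mu> = Inf S"
  have normalize: "\<exists>v\<in>H01_space \<Omega>. L2_inner \<Omega> v v = 1 \<and> grad_inner \<Omega> v v = grad_inner \<Omega> u u / L2_inner \<Omega> u u"
    if u: "u \<in> H01_space \<Omega>" "L2_inner \<Omega> u u > 0" for u
  proof -
    define c where "c = 1 / sqrt (L2_inner \<Omega> u u)"
    have c: "c\<^sup>2 = 1 / L2_inner \<Omega> u u" using u(2) by (simp add: c_def power_divide)
    have "L2_inner \<Omega> (\<lambda>x. c * u x) (\<lambda>x. c * u x) = c\<^sup>2 * L2_inner \<Omega> u u"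
      by (simp add: L2_inner_scale_left L2_inner_scale_right power2_eq_square)
    then have "L2_inner \<Omega> (\<lambda>x. c * u x) (\<lambda>x. c * u x) = 1" using c u(2) by simp
    moreover have "grad_inner \<Omega> (\<lambda>x. c * u x) (\<lambda>x. c * u x) = grad_inner \<Omega> u u / L2_inner \<Omega> u u"
      using grad_inner_scale[OF \<Omega>(1) H01_H1[OF u(1)], of c] c by simp
    ultimately show ?thesis using H01_scale[OF \<Omega>(1) u(1)] by blast
  qed
  have S_ne: "S \<noteq> {}"
  proof -
    obtain u where "u \<in> H01_space \<Omega>" "L2_inner \<Omega> u u > 0" using H01_nontrivial[OF \<Omega>(1,3)] by blast
    then show ?thesis using normalize unfolding S_def by blast
  qed
  have S_bdd: "bdd_below S" by (rule bdd_belowI[of _ 0]) (auto simp: S_def)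
  have \<mu>_nonneg: "\<mu> \<ge> 0" unfolding \<mu>_def by (rule cInf_greatest[OF S_ne]) (auto simp: S_def)
  have \<mu>_le: "\<mu> * L2_inner \<Omega> u u \<le> grad_inner \<Omega> u u" if u: "u \<in> H01_space \<Omega>" for u
  proof (cases "L2_inner \<Omega> u u > 0")
    case True
    obtain v where v: "v \<in> H01_space \<Omega>" "L2_inner \<Omega> v v = 1"
      "grad_inner \<Omega> v v = grad_inner \<Omega> u u / L2_inner \<Omega> u u"
      using normalize[OF u True] by blast
    have "\<mu> \<le> grad_inner \<Omega> v v"
      unfolding \<mu>_def
    proof (rule cInf_lower[OF _ S_bdd])
      show "grad_inner \<Omega> v v \<in> S" unfolding S_def using v(1,2) by blast
    qed
    then show ?thesis using v(3) True by (simp add: le_divide_eq)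
  next
    case False
    then have "L2_inner \<Omega> u u = 0" using L2_inner_self_nonneg[of \<Omega> u] by linarith
    then show ?thesis by simp
  qed
  have "\<exists>u\<in>H01_space \<Omega>. L2_inner \<Omega> u u = 1 \<and> grad_inner \<Omega> u u < \<mu> + 1 / real (Suc n)" for n
  proof -
    have "\<mu> < \<mu> + 1 / real (Suc n)" by simp
    then obtain x where "x \<in> S" "x < \<mu> + 1 / real (Suc n)"
      unfolding \<mu>_def using cInf_lessD[OF S_ne] by blast
    then show ?thesis by (auto simp: S_def)
  qed
  then obtain u where u: "\<And>n. u n \<in> H01_space \<Omega>" "\<And>n. L2_inner \<Omega> (u n) (u n) = 1"
    "\<And>n. grad_inner \<Omega> (u n) (u n) < \<mu> + 1 / real (Suc n)" by metis
  have u_grad: "grad_inner \<Omega> (u n) (u n) \<le> \<mu> + 1" for n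
  proof -
    have "1 / real (Suc n) \<le> 1" by simp
    then show ?thesis using u(3)[of n] by linarith
  qed
  have u_norm: "Lnorm \<Omega> 2 (u n) \<le> 1" for n by (simp add: Lnorm_2_real u(2))
  obtain r where r: "strict_mono (r :: nat \<Rightarrow> nat)" and L2_cauchy:
    "\<And>e. e > 0 \<Longrightarrow> \<exists>N. \<forall>m\<ge>N. \<forall>n\<ge>N. Lnorm \<Omega> 2 (\<lambda>x. u (r m) x - u (r n) x) < e"
    by (rule H01_bounded_Cauchy_subseq[where u = u, OF \<Omega>(1,2) u(1) u_norm u_grad]) blast
  define v where "v n = u (r n)" for n
  have v: "v n \<in> H01_space \<Omega>" "L2_inner \<Omega> (v n) (v n) = 1" "grad_inner \<Omega> (v n) (v n) < \<mu> + 1 / real (Suc n)" for n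
  proof -
    have "1 / real (Suc (r n)) \<le> 1 / real (Suc n)"
      using seq_suble[OF r, of n] by (intro divide_left_mono) auto
    then show "grad_inner \<Omega> (v n) (v n) < \<mu> + 1 / real (Suc n)"
      using u(3)[of "r n"] by (simp add: v_def)
  qed (use u in \<open>auto simp: v_def\<close>)
  note vH = H01_H1[OF v(1)]
  text \<open>The parallelogram law turns \<open>L\<^sup>2\<close> convergence of a minimizing sequence into \<open>H\<^sup>1\<close> convergence.\<close>
  have grad_diff: "grad_inner \<Omega> (\<lambda>x. v m x - v n x) (\<lambda>x. v m x - v n x)
      \<le> 2 / real (Suc m) + 2 / real (Suc n) + \<mu> * (Lnorm \<Omega> 2 (\<lambda>x. v m x - v n x))\<^sup>2" for m n
  proof -
    have 1: "grad_inner \<Omega> (\<lambda>x. v m x - v n x) (\<lambda>x. v m x - v n x)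
        = grad_inner \<Omega> (v m) (v m) - 2 * grad_inner \<Omega> (v m) (v n) + grad_inner \<Omega> (v n) (v n)"
      using grad_inner_sq_lincomb[OF \<Omega>(1) vH[of m] vH[of n], of 1 "-1"] by simp
    have 2: "grad_inner \<Omega> (\<lambda>x. v m x + v n x) (\<lambda>x. v m x + v n x)
        = grad_inner \<Omega> (v m) (v m) + 2 * grad_inner \<Omega> (v m) (v n) + grad_inner \<Omega> (v n) (v n)"
      using grad_inner_sq_lincomb[OF \<Omega>(1) vH[of m] vH[of n], of 1 1] by simp
    have 3: "L2_inner \<Omega> (\<lambda>x. v m x + v n x) (\<lambda>x. v m x + v n x) = 2 + 2 * L2_inner \<Omega> (v m) (v n)"
      using L2_inner_sq_add[OF H01_L2[OF v(1)[of m]] H01_L2[OF v(1)[of n]], of 1] v(2) by simp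
    have 4: "(Lnorm \<Omega> 2 (\<lambda>x. v m x - v n x))\<^sup>2 = 2 - 2 * L2_inner \<Omega> (v m) (v n)"
      using L2_inner_sq_add[OF H01_L2[OF v(1)[of m]] H01_L2[OF v(1)[of n]], of "-1"] v(2) by (simp add: Lnorm_2_sq)
    have 5: "\<mu> * (2 + 2 * L2_inner \<Omega> (v m) (v n)) \<le> grad_inner \<Omega> (\<lambda>x. v m x + v n x) (\<lambda>x. v m x + v n x)"
      using \<mu>_le[OF H01_lincomb[OF \<Omega>(1) v(1)[of m] v(1)[of n], of 1 1]] 3 by simp
    show ?thesis using 1 2 5 v(3)[of m] v(3)[of n] unfolding 4 by (simp add: algebra_simps)
  qed
  have grad_cauchy: "\<exists>N. \<forall>m\<ge>N. \<forall>n\<ge>N. Lnorm \<Omega> 2 (\<lambda>x. weak_deriv \<Omega> i (v m) x - weak_deriv \<Omega> i (v n) x) < e"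
    if e: "e > 0" and i: "i \<in> Basis" for e i
  proof -
    \<comment> \<open>With this bound the term containing \<mu> is at most e^2/4; \<open>N2\<close>
      makes each of the other two less than e^2/8.\<close>
    obtain N1 where N1: "\<And>m n. m \<ge> N1 \<Longrightarrow> n \<ge> N1 \<Longrightarrow> Lnorm \<Omega> 2 (\<lambda>x. v m x - v n x) < e / sqrt (4 * (\<mu> + 1))"
      using L2_cauchy[of "e / sqrt (4 * (\<mu> + 1))"] e \<mu>_nonneg unfolding v_def by (auto simp: divide_pos_pos)
    obtain N2 :: nat where N2: "16 / e\<^sup>2 < real N2" using reals_Archimedean2 by blast
    have "Lnorm \<Omega> 2 (\<lambda>x. weak_deriv \<Omega> i (v m) x - weak_deriv \<Omega> i (v n) x) < e"
      if mn: "m \<ge> max N1 N2" "n \<ge> max N1 N2" for m n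
    proof -
      let ?d = "\<lambda>x. v m x - v n x"
      have small: "2 / real (Suc k) < e\<^sup>2 / 8" if "k \<ge> N2" for k
      proof -
        have "16 < real N2 * e\<^sup>2" using N2 e by (simp add: divide_less_eq)
        also have "\<dots> \<le> real (Suc k) * e\<^sup>2" using that by (intro mult_right_mono) auto
        finally show ?thesis by (simp add: divide_less_eq mult.commute del: of_nat_Suc)
      qed
      have "(Lnorm \<Omega> 2 ?d)\<^sup>2 \<le> (e / sqrt (4 * (\<mu> + 1)))\<^sup>2"
        using N1[of m n] mn by (intro power_mono) auto
      then have "\<mu> * (Lnorm \<Omega> 2 ?d)\<^sup>2 \<le> \<mu> * (e\<^sup>2 / (4 * (\<mu> + 1)))"
        using \<mu>_nonneg by (intro mult_left_mono) (simp_all add: power_divide)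
      also have "\<dots> \<le> e\<^sup>2 / 4" using \<mu>_nonneg by (simp add: field_simps)
      finally have small': "\<mu> * (Lnorm \<Omega> 2 ?d)\<^sup>2 \<le> e\<^sup>2 / 4" .
      have "2 / real (Suc m) < e\<^sup>2 / 8" "2 / real (Suc n) < e\<^sup>2 / 8" using small mn by simp_all
      moreover have "e\<^sup>2 > 0" using e by simp
      ultimately have g: "grad_inner \<Omega> ?d ?d < e\<^sup>2"
        using grad_diff[of m n] small' by linarith
      have "Lnorm \<Omega> 2 (\<lambda>x. weak_deriv \<Omega> i (v m) x - weak_deriv \<Omega> i (v n) x) = Lnorm \<Omega> 2 (weak_deriv \<Omega> i ?d)"
        using H1_weak_deriv_L2[OF \<Omega>(1) vH i]
        by (intro Lnorm_2_AE_cong AE_sym[OF H1_diff(2)] \<Omega>(1) \<Omega>L vH i) auto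
      then have "(Lnorm \<Omega> 2 (\<lambda>x. weak_deriv \<Omega> i (v m) x - weak_deriv \<Omega> i (v n) x))\<^sup>2
          = L2_inner \<Omega> (weak_deriv \<Omega> i ?d) (weak_deriv \<Omega> i ?d)" by (simp add: Lnorm_2_sq)
      also have "\<dots> \<le> grad_inner \<Omega> ?d ?d"
        unfolding grad_inner_def by (rule member_le_sum[OF i]) auto
      finally show ?thesis
        using g e power_less_imp_less_base[of _ 2 e] by (meson le_less_trans less_imp_le)
    qed
    then show ?thesis by blast
  qed
  obtain e where e: "L2_tendsto \<Omega> v e sequentially"
    by (rule L2_complete[where f = v, OF \<Omega>(1,2) H01_L2[OF v(1)] L2_cauchy[folded v_def]]) blast
  have "\<exists>m. L2_tendsto \<Omega> (\<lambda>n. weak_deriv \<Omega> i (v n)) m sequentially" if i: "i \<in> Basis" for i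
    by (rule L2_complete[where f = "\<lambda>n. weak_deriv \<Omega> i (v n)",
          OF \<Omega>(1,2) H1_weak_deriv_L2[OF \<Omega>(1) vH i] grad_cauchy[OF _ i]]) (assumption, rule exI)
  then obtain m where m: "\<And>i. i \<in> Basis \<Longrightarrow> L2_tendsto \<Omega> (\<lambda>n. weak_deriv \<Omega> i (v n)) (m i) sequentially"
    by metis
  have eH: "e \<in> H01_space \<Omega>" by (rule H01_closed(1)[OF \<Omega>(1) v(1) e m])
  have wd: "L2_tendsto \<Omega> (\<lambda>n. weak_deriv \<Omega> i (v n)) (weak_deriv \<Omega> i e) sequentially" if i: "i \<in> Basis" for i
    by (rule L2_tendsto_AE_cong[OF m[OF i] \<Omega>L _ AE_sym[OF H01_closed(2)[OF \<Omega>(1) v(1) e m i]]]) auto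
  have e1: "L2_inner \<Omega> e e = 1"
    using L2_tendsto_inner[OF e e] v(2) by (simp add: LIMSEQ_const_iff)
  have "grad_inner \<Omega> e e \<le> \<mu>"
  proof (rule LIMSEQ_le[OF grad_inner_tendsto[OF wd wd]])
    have "(\<lambda>n. \<mu> + 1 / real (Suc n)) \<longlonglongrightarrow> \<mu> + 0"
      by (intro tendsto_add tendsto_const LIMSEQ_Suc[OF lim_1_over_n])
    then show "(\<lambda>n. \<mu> + 1 / real (Suc n)) \<longlonglongrightarrow> \<mu>" by simp
    show "\<exists>N. \<forall>n\<ge>N. grad_inner \<Omega> (v n) (v n) \<le> \<mu> + 1 / real (Suc n)"
      using v(3) less_imp_le by blast
  qed
  then have eg: "grad_inner \<Omega> e e = \<mu>" using \<mu>_le[OF eH] e1 by simp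
  \<comment> \<open>The Euler-Lagrange equation: the variation \<open>e + t w\<close> turns
    minimality into nonnegativity of 2 t p + t^2 q for all \<open>t\<close>, which forces p =
    0.\<close>
  have weak: "grad_inner \<Omega> e w = \<mu> * L2_inner \<Omega> e w" if w: "w \<in> H01_space \<Omega>" for w
  proof (rule ccontr)
    define p where "p = grad_inner \<Omega> e w - \<mu> * L2_inner \<Omega> e w"
    define q where "q = grad_inner \<Omega> w w - \<mu> * L2_inner \<Omega> w w"
    have q: "q \<ge> 0" using \<mu>_le[OF w] by (simp add: q_def)
    assume "grad_inner \<Omega> e w \<noteq> \<mu> * L2_inner \<Omega> e w"
    then have p: "p \<noteq> 0" by (simp add: p_def)
    have pos: "0 \<le> 2 * t * p + t\<^sup>2 * q" for t
    proof -
      have "\<mu> * L2_inner \<Omega> (\<lambda>x. e x + t * w x) (\<lambda>x. e x + t * w x)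
          \<le> grad_inner \<Omega> (\<lambda>x. e x + t * w x) (\<lambda>x. e x + t * w x)"
        using \<mu>_le[OF H01_lincomb[OF \<Omega>(1) eH w, of 1 t]] by simp
      moreover have "grad_inner \<Omega> (\<lambda>x. e x + t * w x) (\<lambda>x. e x + t * w x)
          = \<mu> + 2 * t * grad_inner \<Omega> e w + t\<^sup>2 * grad_inner \<Omega> w w"
        using grad_inner_sq_lincomb[OF \<Omega>(1) H01_H1[OF eH] H01_H1[OF w], of 1 t] eg by simp
      moreover have "L2_inner \<Omega> (\<lambda>x. e x + t * w x) (\<lambda>x. e x + t * w x)
          = 1 + 2 * t * L2_inner \<Omega> e w + t\<^sup>2 * L2_inner \<Omega> w w"
        using L2_inner_sq_add[OF H01_L2[OF eH] H01_L2[OF w], of t] e1 by simp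
      ultimately show ?thesis by (simp add: p_def q_def algebra_simps)
    qed
    \<comment> \<open>Nearly the minimizer of 2 t p + t^2 q; the summand 1 admits q = 0. The value
      there is at most -p^2/(q + 1).\<close>
    define t where "t = - p / (q + 1)"
    have q1: "q + 1 > 0" using q by simp
    have "t\<^sup>2 * (q + 1) = p\<^sup>2 / (q + 1)"
      using q1 by (simp add: t_def power2_eq_square)
    moreover have "t * p = - (p\<^sup>2 / (q + 1))" by (simp add: t_def power2_eq_square)
    moreover have "t\<^sup>2 * q \<le> t\<^sup>2 * (q + 1)" by (intro mult_left_mono) auto
    moreover have "p\<^sup>2 / (q + 1) > 0" using p q1 by simp
    ultimately show False using pos[of t] by linarith
  qed
  have "dirichlet_eigenvalue \<Omega> \<mu>"
    unfolding dirichlet_eigenvalue_def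
  proof (intro bexI[of _ e] conjI ballI)
    show "\<not> zero_on \<Omega> e" using L2_inner_self_eq_0_iff[OF H01_L2[OF eH]] e1 by simp
    fix w assume w: "w \<in> H01_space \<Omega>"
    show "(LINT x|lebesgue_on \<Omega>. weak_grad \<Omega> e x \<bullet> weak_grad \<Omega> w x) = \<mu> * (LINT x|lebesgue_on \<Omega>. e x * w x)"
      using weak[OF w] integral_weak_grad_inner[OF \<Omega>(1) H01_H1[OF eH] H01_H1[OF w]]
      by (simp add: L2_inner_def)
  qed (rule eH)
  \<comment> \<open>An eigenfunction tested against itself has Rayleigh quotient \<nu>.\<close>
  moreover have "\<mu> \<le> \<nu>" if \<nu>: "dirichlet_eigenvalue \<Omega> \<nu>" for \<nu>
  proof -
    obtain f where f: "f \<in> H01_space \<Omega>" "\<not> zero_on \<Omega> f"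
      "(LINT x|lebesgue_on \<Omega>. weak_grad \<Omega> f x \<bullet> weak_grad \<Omega> f x) = \<nu> * (LINT x|lebesgue_on \<Omega>. f x * f x)"
      using \<nu> unfolding dirichlet_eigenvalue_def by blast
    have "grad_inner \<Omega> f f = \<nu> * L2_inner \<Omega> f f"
      using f(3) integral_weak_grad_inner[OF \<Omega>(1) H01_H1[OF f(1)] H01_H1[OF f(1)]] by (simp add: L2_inner_def)
    then have "\<mu> * L2_inner \<Omega> f f \<le> \<nu> * L2_inner \<Omega> f f" using \<mu>_le[OF f(1)] by simp
    moreover have "L2_inner \<Omega> f f > 0"
      using L2_inner_self_eq_0_iff[OF H01_L2[OF f(1)]] f(2) L2_inner_self_nonneg[of \<Omega> f] by linarith
    ultimately show ?thesis by simp
  qed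
  ultimately have pe: "principal_eigenvalue \<Omega> = \<mu>"
    unfolding principal_eigenvalue_def by (rule Least_equality)
  obtain C where C: "C > 0" "\<And>u. u \<in> H01_space \<Omega> \<Longrightarrow> L2_inner \<Omega> u u \<le> C * grad_inner \<Omega> u u"
    using H01_poincare[OF \<Omega>(1,2)] by blast
  \<comment> \<open>The Poincare inequality for the normalized minimizer excludes \<mu> = 0.\<close>
  have "1 \<le> C * \<mu>" using C(2)[OF eH] e1 eg by simp
  then show "principal_eigenvalue \<Omega> > 0"
    unfolding pe using C(1) \<mu>_nonneg by (metis less_eq_real_def mult_zero_right not_one_le_zero)
  show "w \<in> H01_space \<Omega> \<Longrightarrow> principal_eigenvalue \<Omega> * L2_inner \<Omega> w w \<le> grad_inner \<Omega> w w"
    unfolding pe by (rule \<mu>_le)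
qed

section \<open>Time derivatives\<close>

text \<open>The right endpoint is excluded, so every time has later times of the interval
  arbitrarily close to it. Uniqueness of time derivatives depends on this.\<close>

lemma time_interval_within_not_bot:
  assumes "t \<in> time_interval T"
  shows "at t within time_interval T \<noteq> bot"
proof -
  have t: "0 \<le> t" "ereal t < T" using assms by (auto simp: time_interval_def)
  obtain r where r: "ereal t < ereal r" "ereal r < T" using ereal_dense2[OF t(2)] by blast
  have "{t..r} \<subseteq> time_interval T"
    using t r by (auto simp: time_interval_def intro: le_less_trans[of _ "ereal r"])
  then have "at t within {t..r} \<le> at t within time_interval T" by (rule at_le)
  moreover have "at t within {t..r} \<noteq> bot" using r by (simp add: at_within_Icc_at_right)
  ultimately show ?thesis using bot.extremum_uniqueI by fastforce
qed

lemma convex_time_interval: "convex (time_interval T)"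
proof -
  have "is_interval (time_interval T)"
    unfolding is_interval_1 time_interval_def by (auto intro: le_less_trans[of "ereal _" "ereal _"])
  then show ?thesis by (simp add: is_interval_convex)
qed

lemma L2_tendsto_compose:
  assumes "L2_tendsto \<Omega> f l F" "filterlim g F G"
  shows "L2_tendsto \<Omega> (\<lambda>n. f (g n)) l G"
  using assms filterlim_iff[of g F G] filterlim_compose[of _ "nhds 0" F g G]
  unfolding L2_tendsto_def by blast

lemma L2_tendsto_cong:
  assumes "\<forall>\<^sub>F s in F. f s = g s" "L2_tendsto \<Omega> f l F"
  shows "L2_tendsto \<Omega> g l F"
proof -
  have "\<forall>\<^sub>F s in F. g s \<in> L2_space \<Omega>"
    using assms by (auto simp: L2_tendsto_def elim: eventually_elim2)
  moreover have "((\<lambda>s. Lnorm \<Omega> 2 (\<lambda>x. g s x - l x)) \<longlongrightarrow> 0) F"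
    using assms(2) unfolding L2_tendsto_def
    by (elim conjE) (erule Lim_transform_eventually, use assms(1) in \<open>auto elim: eventually_mono\<close>)
  ultimately show ?thesis using assms(2) by (simp add: L2_tendsto_def)
qed

text \<open>The derivative at a single time, stated with \<open>L2_tendsto\<close>, so that it
  applies equally to the solution, to its velocity and to its weak space derivatives.\<close>

definition L2_deriv ::
    "'a::euclidean_space set \<Rightarrow> (real \<Rightarrow> 'a \<Rightarrow> real) \<Rightarrow> ('a \<Rightarrow> real) \<Rightarrow> real \<Rightarrow> real set \<Rightarrow> bool"
  where "L2_deriv \<Omega> f f' t J \<longleftrightarrow> f t \<in> L2_space \<Omega> \<and>
    L2_tendsto \<Omega> (\<lambda>s x. (f s x - f t x) / (s - t)) f' (at t within J)"

lemma L2_deriv_continuous: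
  assumes "L2_deriv \<Omega> f f' t J"
  shows "L2_tendsto \<Omega> f (f t) (at t within J)"
proof -
  have "((\<lambda>s. s - t) \<longlongrightarrow> t - t) (at t within J)" by (intro tendsto_intros)
  then have "L2_tendsto \<Omega> (\<lambda>s x. f t x + (s - t) * ((f s x - f t x) / (s - t)))
      (\<lambda>x. f t x + (t - t) * f' x) (at t within J)"
    using assms unfolding L2_deriv_def
    by (intro L2_tendsto_add L2_tendsto_const L2_tendsto_scale) auto
  then have "L2_tendsto \<Omega> (\<lambda>s x. f t x + (s - t) * ((f s x - f t x) / (s - t))) (f t) (at t within J)"
    by simp
  then show ?thesis
    by (rule L2_tendsto_cong[rotated]) (auto simp: eventually_at_filter fun_eq_iff)
qed

lemma L2_inner_has_derivative:
  assumes f: "L2_deriv \<Omega> f f' t J" and g: "L2_deriv \<Omega> g g' t J"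
  shows "((\<lambda>s. L2_inner \<Omega> (f s) (g s)) has_real_derivative
    L2_inner \<Omega> f' (g t) + L2_inner \<Omega> (f t) g') (at t within J)"
proof -
  note fc = L2_deriv_continuous[OF f] and gc = L2_deriv_continuous[OF g]
  have L: "f t \<in> L2_space \<Omega>" "g t \<in> L2_space \<Omega>"
    using f g by (auto simp: L2_deriv_def)
  have "((\<lambda>s. L2_inner \<Omega> (\<lambda>x. (f s x - f t x) / (s - t)) (g s)
        + L2_inner \<Omega> (f t) (\<lambda>x. (g s x - g t x) / (s - t)))
      \<longlongrightarrow> L2_inner \<Omega> f' (g t) + L2_inner \<Omega> (f t) g') (at t within J)"
    using f g gc L unfolding L2_deriv_def
    by (intro tendsto_add L2_tendsto_inner L2_tendsto_const) auto
  moreover have "\<forall>\<^sub>F s in at t within J. L2_inner \<Omega> (\<lambda>x. (f s x - f t x) / (s - t)) (g s)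
        + L2_inner \<Omega> (f t) (\<lambda>x. (g s x - g t x) / (s - t))
      = (L2_inner \<Omega> (f s) (g s) - L2_inner \<Omega> (f t) (g t)) / (s - t)"
  proof -
    have "\<forall>\<^sub>F s in at t within J. f s \<in> L2_space \<Omega> \<and> g s \<in> L2_space \<Omega>"
      using fc gc by (auto simp: L2_tendsto_def eventually_conj_iff)
    then show ?thesis
      by eventually_elim
        (use L in \<open>simp add: L2_inner_divide_left L2_inner_divide_right L2_inner_diff_left
          L2_inner_diff_right L2_diff flip: add_divide_distrib\<close>)
  qed
  ultimately show ?thesis
    unfolding has_field_derivative_iff by (rule Lim_transform_eventually)
qed

section \<open>The power nonlinearity\<close>

abbreviation signed_power :: "real \<Rightarrow> real \<Rightarrow> real"
  where "signed_power p s \<equiv> \<bar>s\<bar> powr (p - 1) * s"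

lemma signed_power_mult:
  "signed_power p s * s = \<bar>s\<bar> powr (p + 1)"
proof (cases "s = 0")
  case False
  have "\<bar>s\<bar> powr (p + 1) = \<bar>s\<bar> powr (p - 1) * s\<^sup>2"
    using powr_add[of "\<bar>s\<bar>" "p - 1" 2] False by (simp add: add.commute)
  then show ?thesis by (simp add: power2_eq_square)
qed simp

lemma continuous_on_signed_power:
  assumes "p > 1"
  shows "continuous_on UNIV (signed_power p)"
  using assms by (intro continuous_intros continuous_on_powr') auto

text \<open>The graph of |s|^(p + 1)/(p + 1) lies above its tangent at \<open>a\<close>, whose slope
  is the signed power. It follows from Young's inequality with exponents (p + 1)/p and p +
  1.\<close>

lemma signed_power_convexity:
  assumes p: "p > 1"
  shows "signed_power p a * (b - a) \<le> (\<bar>b\<bar> powr (p + 1) - \<bar>a\<bar> powr (p + 1)) / (p + 1)"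
proof -
  have "\<bar>a\<bar> powr p * \<bar>b\<bar> \<le> (\<bar>a\<bar> powr p) powr ((p + 1) / p) / ((p + 1) / p) + \<bar>b\<bar> powr (p + 1) / (p + 1)"
    using p by (intro Youngs_inequality) (auto simp: field_simps)
  also have "(\<bar>a\<bar> powr p) powr ((p + 1) / p) = \<bar>a\<bar> powr (p + 1)"
    using p by (simp add: powr_powr)
  finally have young: "\<bar>a\<bar> powr p * \<bar>b\<bar> \<le> p / (p + 1) * \<bar>a\<bar> powr (p + 1) + \<bar>b\<bar> powr (p + 1) / (p + 1)"
    by (simp add: field_simps)
  have abs_eq: "\<bar>a\<bar> powr (p - 1) * \<bar>a\<bar> = \<bar>a\<bar> powr p"
    by (cases "a = 0") (simp_all add: powr_mult_base' powr_diff)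
  have "signed_power p a * b \<le> \<bar>signed_power p a * b\<bar>" by simp
  also have "\<dots> = \<bar>a\<bar> powr p * \<bar>b\<bar>" by (simp add: abs_mult abs_eq)
  finally have "signed_power p a * (b - a) \<le> \<bar>a\<bar> powr p * \<bar>b\<bar> - \<bar>a\<bar> powr (p + 1)"
    using signed_power_mult[where p = p and s = a] by (simp add: algebra_simps)
  also have "\<dots> \<le> p / (p + 1) * \<bar>a\<bar> powr (p + 1) + \<bar>b\<bar> powr (p + 1) / (p + 1) - \<bar>a\<bar> powr (p + 1)"
    using young by simp
  also have "\<dots> = (\<bar>b\<bar> powr (p + 1) - \<bar>a\<bar> powr (p + 1)) / (p + 1)"
  proof -
    have "p / (p + 1) = 1 - 1 / (p + 1)" using p by (simp add: field_simps)
    then show ?thesis by (simp add: left_diff_distrib diff_divide_distrib)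
  qed
  finally show ?thesis .
qed

lemma L2_inner_signed_power:
  "L2_inner \<Omega> (\<lambda>x. signed_power p (u x)) u = (LINT x|lebesgue_on \<Omega>. \<bar>u x\<bar> powr (p + 1))"
  by (simp add: L2_inner_def signed_power_mult)

lemma Lnorm_powr:
  assumes "q > 0"
  shows "Lnorm \<Omega> q (u :: 'a::euclidean_space \<Rightarrow> real) powr q = (LINT x|lebesgue_on \<Omega>. \<bar>u x\<bar> powr q)"
  using assms by (simp add: Lnorm_def powr_powr integral_nonneg_AE)

lemma power_integral_convexity:
  assumes p: "p > 1" and u: "u \<in> L2_space \<Omega>" "(\<lambda>x. signed_power p (u x)) \<in> L2_space \<Omega>"
    and v: "v \<in> L2_space \<Omega>" "(\<lambda>x. signed_power p (v x)) \<in> L2_space \<Omega>"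
  shows "L2_inner \<Omega> (\<lambda>x. signed_power p (u x)) (\<lambda>x. v x - u x)
    \<le> ((LINT x|lebesgue_on \<Omega>. \<bar>v x\<bar> powr (p + 1)) - (LINT x|lebesgue_on \<Omega>. \<bar>u x\<bar> powr (p + 1))) / (p + 1)"
proof -
  have int: "integrable (lebesgue_on \<Omega>) (\<lambda>x. \<bar>u x\<bar> powr (p + 1))" "integrable (lebesgue_on \<Omega>) (\<lambda>x. \<bar>v x\<bar> powr (p + 1))"
    using L2_mult_integrable[OF u(2,1)] L2_mult_integrable[OF v(2,1)] by (simp_all add: signed_power_mult)
  have "L2_inner \<Omega> (\<lambda>x. signed_power p (u x)) (\<lambda>x. v x - u x)
      \<le> (LINT x|lebesgue_on \<Omega>. (\<bar>v x\<bar> powr (p + 1) - \<bar>u x\<bar> powr (p + 1)) / (p + 1))"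
    unfolding L2_inner_def
  proof (rule integral_mono)
    show "integrable (lebesgue_on \<Omega>) (\<lambda>x. signed_power p (u x) * (v x - u x))"
      by (rule L2_mult_integrable[OF u(2) L2_diff[OF v(1) u(1)]])
    show "integrable (lebesgue_on \<Omega>) (\<lambda>x. (\<bar>v x\<bar> powr (p + 1) - \<bar>u x\<bar> powr (p + 1)) / (p + 1))"
      using int by auto
    show "signed_power p (u x) * (v x - u x) \<le> (\<bar>v x\<bar> powr (p + 1) - \<bar>u x\<bar> powr (p + 1)) / (p + 1)" for x
      by (rule signed_power_convexity[OF p])
  qed
  then show ?thesis using int by simp
qed

text \<open>Convexity squeezes the difference quotient of \<open>\<integral>\<bar>u\<bar>\<^sup>p\<^sup>+\<^sup>1\<close> between two inner
  products, so \<open>L\<^sup>2\<close> continuity of the nonlinearity replaces any Sobolev embedding.\<close>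

lemma power_integral_has_derivative:
  assumes p: "p > 1" and u: "L2_deriv \<Omega> u u' t J"
    and F: "L2_tendsto \<Omega> (\<lambda>s x. signed_power p (u s x)) (\<lambda>x. signed_power p (u t x)) (at t within J)"
  shows "((\<lambda>s. LINT x|lebesgue_on \<Omega>. \<bar>u s x\<bar> powr (p + 1)) has_real_derivative
    (p + 1) * L2_inner \<Omega> (\<lambda>x. signed_power p (u t x)) u') (at t within J)"
proof -
  define \<Gamma> where "\<Gamma> s = (LINT x|lebesgue_on \<Omega>. \<bar>u s x\<bar> powr (p + 1))" for s
  define f where "f s = (\<lambda>x. signed_power p (u s x))" for s
  define q where "q s = (\<lambda>x. (u s x - u t x) / (s - t))" for s
  have F': "L2_tendsto \<Omega> f (f t) (at t within J)" using F by (simp add: f_def[abs_def])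
  have q: "L2_tendsto \<Omega> q u' (at t within J)" and ut: "u t \<in> L2_space \<Omega>"
    using u by (simp_all add: L2_deriv_def q_def[abs_def])
  have ft: "f t \<in> L2_space \<Omega>" using F' by (simp add: L2_tendsto_def)
  have lim1: "((\<lambda>s. L2_inner \<Omega> (f t) (q s)) \<longlongrightarrow> L2_inner \<Omega> (f t) u') (at t within J)"
    by (intro L2_tendsto_inner q L2_tendsto_const ft)
  have lim2: "((\<lambda>s. L2_inner \<Omega> (f s) (q s)) \<longlongrightarrow> L2_inner \<Omega> (f t) u') (at t within J)"
    by (intro L2_tendsto_inner q F')
  have lims: "((\<lambda>s. min (L2_inner \<Omega> (f t) (q s)) (L2_inner \<Omega> (f s) (q s))) \<longlongrightarrow> L2_inner \<Omega> (f t) u') (at t within J)"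
    "((\<lambda>s. max (L2_inner \<Omega> (f t) (q s)) (L2_inner \<Omega> (f s) (q s))) \<longlongrightarrow> L2_inner \<Omega> (f t) u') (at t within J)"
    using tendsto_min[OF lim1 lim2] tendsto_max[OF lim1 lim2] by simp_all
  have ev: "\<forall>\<^sub>F s in at t within J. u s \<in> L2_space \<Omega> \<and> f s \<in> L2_space \<Omega> \<and> s \<noteq> t"
    using L2_deriv_continuous[OF u] F' by (auto simp: L2_tendsto_def eventually_conj_iff eventually_at_filter)
  \<comment> \<open>The convexity inequality is used at \<open>t\<close> and at \<open>s\<close>.
    Division by s - t reverses both estimates for s < t, hence the bounds by \<open>min\<close> and
    \<open>max\<close>.\<close>
  have between: "\<forall>\<^sub>F s in at t within J.
      min (L2_inner \<Omega> (f t) (q s)) (L2_inner \<Omega> (f s) (q s)) \<le> (\<Gamma> s - \<Gamma> t) / (p + 1) / (s - t) \<and>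
      (\<Gamma> s - \<Gamma> t) / (p + 1) / (s - t) \<le> max (L2_inner \<Omega> (f t) (q s)) (L2_inner \<Omega> (f s) (q s))"
    using ev
  proof eventually_elim
    case (elim s)
    have 1: "L2_inner \<Omega> (f t) (\<lambda>x. u s x - u t x) \<le> (\<Gamma> s - \<Gamma> t) / (p + 1)"
      unfolding \<Gamma>_def f_def using elim ut ft unfolding f_def by (intro power_integral_convexity[OF p]) auto
    have "L2_inner \<Omega> (f s) (\<lambda>x. u t x - u s x) \<le> (\<Gamma> t - \<Gamma> s) / (p + 1)"
      unfolding \<Gamma>_def f_def using elim ut ft unfolding f_def by (intro power_integral_convexity[OF p]) auto
    moreover have "L2_inner \<Omega> (f s) (\<lambda>x. u t x - u s x) = - L2_inner \<Omega> (f s) (\<lambda>x. u s x - u t x)"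
      using elim ut by (simp add: L2_inner_diff_right)
    ultimately have 2: "(\<Gamma> s - \<Gamma> t) / (p + 1) \<le> L2_inner \<Omega> (f s) (\<lambda>x. u s x - u t x)"
      by (simp add: diff_divide_distrib)
    have q1: "L2_inner \<Omega> g (q s) = L2_inner \<Omega> g (\<lambda>x. u s x - u t x) / (s - t)" for g
      unfolding q_def by (rule L2_inner_divide_right)
    show ?case
    proof (cases "s > t")
      case True
      then show ?thesis
        unfolding q1 using divide_right_mono[OF 1, of "s - t"] divide_right_mono[OF 2, of "s - t"] by simp
    next
      case False
      then show ?thesis
        unfolding q1 using elim divide_right_mono_neg[OF 1, of "s - t"] divide_right_mono_neg[OF 2, of "s - t"] by simp
    qed
  qed
  have "((\<lambda>s. (\<Gamma> s - \<Gamma> t) / (p + 1) / (s - t)) \<longlongrightarrow> L2_inner \<Omega> (f t) u') (at t within J)"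
    by (rule tendsto_sandwich[OF _ _ lims]) (use between in \<open>auto elim: eventually_mono\<close>)
  then have "((\<lambda>s. (p + 1) * ((\<Gamma> s - \<Gamma> t) / (p + 1) / (s - t))) \<longlongrightarrow> (p + 1) * L2_inner \<Omega> (f t) u') (at t within J)"
    by (rule tendsto_mult_left)
  moreover have "(p + 1) * ((\<Gamma> s - \<Gamma> t) / (p + 1) / (s - t)) = (\<Gamma> s - \<Gamma> t) / (s - t)" for s
    using p by simp
  ultimately show ?thesis
    unfolding has_field_derivative_iff \<Gamma>_def f_def by simp
qed

section \<open>The Kirchhoff equation\<close>

lemma eventually_within_self: "\<forall>\<^sub>F s in at t within J. s \<in> J \<and> s \<noteq> t"
  by (simp add: eventually_at_filter)

section \<open>Regularity in time\<close>

lemma has_time_deriv_L2: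
  assumes "has_time_deriv (L2_space \<Omega>) (Lnorm \<Omega> 2) J u v" "t \<in> J"
  shows "L2_deriv \<Omega> u (v t) t J"
proof -
  have L: "u s \<in> L2_space \<Omega>" if "s \<in> J" for s using assms(1) that by (auto simp: has_time_deriv_def)
  have "\<forall>\<^sub>F s in at t within J. (\<lambda>x. (u s x - u t x) / (s - t)) \<in> L2_space \<Omega>"
    using eventually_within_self by eventually_elim (intro L2_divide L2_diff L assms(2), simp)
  then show ?thesis
    using assms by (auto simp: L2_deriv_def L2_tendsto_def has_time_deriv_def)
qed

text \<open>A difference quotient is a linear combination of two values of \<open>u\<close>, so its
  weak derivative is the difference quotient of the weak derivatives; hence time and space
  derivatives commute.\<close>

lemma has_time_deriv_H01:
  assumes \<Omega>: "open \<Omega>" and u: "has_time_deriv (H01_space \<Omega>) (H1_norm \<Omega>) J u v" and t: "t \<in> J"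
  shows "L2_deriv \<Omega> u (v t) t J"
    and "i \<in> Basis \<Longrightarrow> L2_deriv \<Omega> (\<lambda>s. weak_deriv \<Omega> i (u s)) (weak_deriv \<Omega> i (v t)) t J"
proof -
  have H: "u s \<in> H1_space \<Omega>" "v s \<in> H1_space \<Omega>" if "s \<in> J" for s
    using u that by (auto simp: has_time_deriv_def intro: H01_H1)
  have eq: "(\<lambda>x. (u s x - u t x) / (s - t)) = (\<lambda>x. (1 / (s - t)) * u s x + (- 1 / (s - t)) * u t x)" for s
    by (simp add: diff_divide_distrib fun_eq_iff)
  have qH: "(\<lambda>x. (u s x - u t x) / (s - t)) \<in> H1_space \<Omega>" if "s \<in> J" for s
    unfolding eq by (rule H1_lincomb(1)[OF \<Omega> H(1)[OF that] H(1)[OF t]])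
  have ev: "\<forall>\<^sub>F s in at t within J. (\<lambda>x. (u s x - u t x) / (s - t)) \<in> H1_space \<Omega>"
    using eventually_within_self by eventually_elim (use qH in auto)
  have lim: "((\<lambda>s. H1_norm \<Omega> (\<lambda>x. (u s x - u t x) / (s - t) - v t x)) \<longlongrightarrow> 0) (at t within J)"
    using u t by (simp add: has_time_deriv_def)
  note D = H1_norm_tendsto_imp[OF \<Omega> H(2)[OF t] ev lim]
  show "L2_deriv \<Omega> u (v t) t J"
    using D(1) H1_L2[OF H(1)[OF t]] by (simp add: L2_deriv_def)
  show "L2_deriv \<Omega> (\<lambda>s. weak_deriv \<Omega> i (u s)) (weak_deriv \<Omega> i (v t)) t J" if i: "i \<in> Basis"
    unfolding L2_deriv_def
  proof
    show "L2_tendsto \<Omega> (\<lambda>s x. (weak_deriv \<Omega> i (u s) x - weak_deriv \<Omega> i (u t) x) / (s - t))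
        (weak_deriv \<Omega> i (v t)) (at t within J)"
    proof (rule L2_tendsto_AE_cong[OF D(2)[OF i] open_sets_lebesgue[OF \<Omega>]])
      show "\<forall>\<^sub>F s in at t within J. AE x in lebesgue_on \<Omega>. weak_deriv \<Omega> i (\<lambda>x. (u s x - u t x) / (s - t)) x
          = (weak_deriv \<Omega> i (u s) x - weak_deriv \<Omega> i (u t) x) / (s - t)"
        using eventually_within_self
      proof eventually_elim
        case (elim s)
        then have s: "s \<in> J" by simp
        show ?case
          unfolding eq using H1_lincomb(2)[OF \<Omega> H(1)[OF s] H(1)[OF t] i, of "1 / (s - t)" "- 1 / (s - t)"]
          by eventually_elim (simp add: diff_divide_distrib)
      qed
    qed simp
  qed (rule H1_weak_deriv_L2[OF \<Omega> H(1)[OF t] i])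
qed

lemma L2_tendsto_sum:
  assumes "\<And>i. i \<in> I \<Longrightarrow> L2_tendsto \<Omega> (f i) (l i) F"
  shows "L2_tendsto \<Omega> (\<lambda>s x. \<Sum>i\<in>I. f i s x) (\<lambda>x. \<Sum>i\<in>I. l i x) F"
  using assms
  by (induction I rule: infinite_finite_induct) (auto intro!: L2_tendsto_add L2_tendsto_const)

text \<open>Each pure second derivative is dominated by \<open>H2_norm\<close>. Linearity holds
  almost everywhere only and has to be applied at both orders of differentiation.\<close>

lemma weak_laplacian_continuous:
  assumes \<Omega>: "open \<Omega>" and u: "\<And>s. s \<in> J \<Longrightarrow> u s \<in> H2_space \<Omega>" and t: "t \<in> J"
    and lim: "((\<lambda>s. H2_norm \<Omega> (\<lambda>x. u s x - u t x)) \<longlongrightarrow> 0) (at t within J)"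
  shows "L2_tendsto \<Omega> (\<lambda>s. weak_laplacian \<Omega> (u s)) (weak_laplacian \<Omega> (u t)) (at t within J)"
  unfolding weak_laplacian_def[abs_def]
proof (rule L2_tendsto_sum)
  fix i :: 'a assume i: "i \<in> Basis"
  have \<Omega>L: "\<Omega> \<in> sets lebesgue" using \<Omega> by (rule open_sets_lebesgue)
  have H: "u s \<in> H1_space \<Omega>" "weak_deriv \<Omega> i (u s) \<in> H1_space \<Omega>" if "s \<in> J" for s
    using u[OF that] i by (auto simp: H2_space_def)
  have L: "weak_deriv \<Omega> i (weak_deriv \<Omega> i (u s)) \<in> L2_space \<Omega>" if "s \<in> J" for s
    by (rule H1_weak_deriv_L2[OF \<Omega> H(2)[OF that] i])
  have le: "Lnorm \<Omega> 2 (weak_deriv \<Omega> i (weak_deriv \<Omega> i w)) \<le> H2_norm \<Omega> w" for w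
  proof -
    have "(Lnorm \<Omega> 2 (weak_deriv \<Omega> i (weak_deriv \<Omega> i w)))\<^sup>2
        \<le> (\<Sum>j\<in>Basis. (Lnorm \<Omega> 2 (weak_deriv \<Omega> j (weak_deriv \<Omega> i w)))\<^sup>2)"
      by (rule member_le_sum[OF i]) auto
    also have "\<dots> \<le> (\<Sum>i\<in>Basis. \<Sum>j\<in>Basis. (Lnorm \<Omega> 2 (weak_deriv \<Omega> j (weak_deriv \<Omega> i w)))\<^sup>2)"
      by (rule member_le_sum[OF i, of "\<lambda>i. \<Sum>j\<in>Basis. (Lnorm \<Omega> 2 (weak_deriv \<Omega> j (weak_deriv \<Omega> i w)))\<^sup>2"])
        (auto intro: sum_nonneg)
    finally show ?thesis
      unfolding H2_norm_def by (intro real_le_rsqrt) (simp add: add_increasing sum_nonneg)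
  qed
  have "((\<lambda>s. Lnorm \<Omega> 2 (\<lambda>x. weak_deriv \<Omega> i (weak_deriv \<Omega> i (u s)) x - weak_deriv \<Omega> i (weak_deriv \<Omega> i (u t)) x))
      \<longlongrightarrow> 0) (at t within J)"
  proof (rule tendsto_0_Lnorm_le[OF _ lim])
    show "\<forall>\<^sub>F s in at t within J. Lnorm \<Omega> 2 (\<lambda>x. weak_deriv \<Omega> i (weak_deriv \<Omega> i (u s)) x - weak_deriv \<Omega> i (weak_deriv \<Omega> i (u t)) x)
        \<le> H2_norm \<Omega> (\<lambda>x. u s x - u t x)"
      using eventually_within_self
    proof eventually_elim
      case (elim s)
      then have s: "s \<in> J" by simp
      have "weak_deriv \<Omega> i (weak_deriv \<Omega> i (\<lambda>x. u s x - u t x))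
          = weak_deriv \<Omega> i (\<lambda>x. weak_deriv \<Omega> i (u s) x - weak_deriv \<Omega> i (u t) x)"
        by (rule weak_deriv_AE_cong[OF \<Omega>L i H1_diff(2)[OF \<Omega> H(1)[OF s] H(1)[OF t] i]])
      moreover have "Lnorm \<Omega> 2 (\<lambda>x. weak_deriv \<Omega> i (weak_deriv \<Omega> i (u s)) x - weak_deriv \<Omega> i (weak_deriv \<Omega> i (u t)) x)
          = Lnorm \<Omega> 2 (weak_deriv \<Omega> i (\<lambda>x. weak_deriv \<Omega> i (u s) x - weak_deriv \<Omega> i (u t) x))"
        by (rule Lnorm_2_AE_cong[OF L2_diff[OF L[OF s] L[OF t]] \<Omega>L AE_sym[OF H1_diff(2)[OF \<Omega> H(2)[OF s] H(2)[OF t] i]]])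
      ultimately show ?case using le[of "\<lambda>x. u s x - u t x"] by simp
    qed
  qed
  moreover have "\<forall>\<^sub>F s in at t within J. weak_deriv \<Omega> i (weak_deriv \<Omega> i (u s)) \<in> L2_space \<Omega>"
    using eventually_within_self by eventually_elim (use L in auto)
  ultimately show "L2_tendsto \<Omega> (\<lambda>s. weak_deriv \<Omega> i (weak_deriv \<Omega> i (u s))) (weak_deriv \<Omega> i (weak_deriv \<Omega> i (u t))) (at t within J)"
    using L[OF t] by (simp add: L2_tendsto_def)
qed

text \<open>The definition of a solution and two of the membership conditions of
  \<open>H_class\<close> each provide their own time derivatives. By uniqueness of L^2 limits these
  agree almost everywhere, and all regularity is transferred to the one pair that occurs in the
  equation.\<close>

lemma kirchhoff_regularity:
  fixes \<Omega> :: "'a::euclidean_space set"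
  assumes \<Omega>: "open \<Omega>" and sol: "kirchhoff_solution \<Omega> a b lam p u0 u1 T u"
  defines "J \<equiv> time_interval T"
  obtains ut utt where
    "\<And>t. t \<in> J \<Longrightarrow> u t \<in> H01_space \<Omega> \<and> u t \<in> H2_space \<Omega> \<and> ut t \<in> H01_space \<Omega>"
    "\<And>t. t \<in> J \<Longrightarrow> L2_deriv \<Omega> u (ut t) t J"
    "\<And>t. t \<in> J \<Longrightarrow> L2_deriv \<Omega> ut (utt t) t J"
    "\<And>t i. t \<in> J \<Longrightarrow> i \<in> Basis \<Longrightarrow> L2_deriv \<Omega> (\<lambda>s. weak_deriv \<Omega> i (u s)) (weak_deriv \<Omega> i (ut t)) t J"
    "\<And>t. t \<in> J \<Longrightarrow> L2_tendsto \<Omega> utt (utt t) (at t within J)"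
    "\<And>t. t \<in> J \<Longrightarrow> L2_tendsto \<Omega> (\<lambda>s. weak_laplacian \<Omega> (u s)) (weak_laplacian \<Omega> (u t)) (at t within J)"
    "\<And>t. t \<in> J \<Longrightarrow> 0 < t \<Longrightarrow> AE x in lebesgue_on \<Omega>.
      utt t x - (a * grad_inner \<Omega> (u t) (u t) + b) * weak_laplacian \<Omega> (u t) x = lam * u t x + signed_power p (u t x)"
    "AE x in lebesgue_on \<Omega>. u 0 x = u0 x" "AE x in lebesgue_on \<Omega>. ut 0 x = u1 x"
proof -
  have \<Omega>L: "\<Omega> \<in> sets lebesgue" using \<Omega> by (rule open_sets_lebesgue)
  have bot: "at t within J \<noteq> bot" if "t \<in> J" for t
    using time_interval_within_not_bot that unfolding J_def .
  obtain ut utt where ut: "has_time_deriv (L2_space \<Omega>) (Lnorm \<Omega> 2) J u ut"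
    and utt: "has_time_deriv (L2_space \<Omega>) (Lnorm \<Omega> 2) J ut utt"
    and eq: "\<And>t. t \<in> J \<Longrightarrow> 0 < t \<Longrightarrow> AE x in lebesgue_on \<Omega>.
          utt t x - (a * (LINT y|lebesgue_on \<Omega>. (norm (weak_grad \<Omega> (u t) y))\<^sup>2) + b)
              * weak_laplacian \<Omega> (u t) x
            = lam * u t x + signed_power p (u t x)"
    and init: "AE x in lebesgue_on \<Omega>. u 0 x = u0 x" "AE x in lebesgue_on \<Omega>. ut 0 x = u1 x"
    using sol unfolding kirchhoff_solution_def J_def by blast
  have H2: "Ck_time 0 (H01_space \<Omega> \<inter> H2_space \<Omega>) (H2_norm \<Omega>) J u"
    and C1: "Ck_time (Suc 0) (H01_space \<Omega>) (H1_norm \<Omega>) J u"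
    and C2: "Ck_time (Suc (Suc 0)) (L2_space \<Omega>) (Lnorm \<Omega> 2) J u"
    using sol unfolding kirchhoff_solution_def H_class_def J_def
    by (auto simp: numeral_2_eq_2 simp del: Ck_time.simps)
  obtain v where v: "has_time_deriv (H01_space \<Omega>) (H1_norm \<Omega>) J u v"
    using C1 by auto
  obtain v2 w where v2: "has_time_deriv (L2_space \<Omega>) (Lnorm \<Omega> 2) J u v2"
    and w: "has_time_deriv (L2_space \<Omega>) (Lnorm \<Omega> 2) J v2 w" and wc: "Ck_time 0 (L2_space \<Omega>) (Lnorm \<Omega> 2) J w"
    using C2 unfolding Ck_time.simps(2) by blast
  have uniq: "AE x in lebesgue_on \<Omega>. f x = g x"
    if "L2_deriv \<Omega> h f t J" "L2_deriv \<Omega> h g t J" "t \<in> J" for f g h t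
    using L2_tendsto_unique[of \<Omega> _ f "at t within J" g] bot[OF that(3)] that(1,2) unfolding L2_deriv_def by blast
  note ut_d = has_time_deriv_L2[OF ut] and utt_d = has_time_deriv_L2[OF utt]
  have v_ut: "AE x in lebesgue_on \<Omega>. v t x = ut t x" if t: "t \<in> J" for t
    by (rule uniq[OF has_time_deriv_H01(1)[OF \<Omega> v t] ut_d[OF t] t])
  have v2_ut: "AE x in lebesgue_on \<Omega>. v2 t x = ut t x" if t: "t \<in> J" for t
    by (rule uniq[OF has_time_deriv_L2[OF v2 t] ut_d[OF t] t])
  have utH: "ut t \<in> H01_space \<Omega>" if t: "t \<in> J" for t
  proof -
    have "v t \<in> H01_space \<Omega>" using v t by (simp add: has_time_deriv_def)
    from H01_AE_cong[OF \<Omega> this v_ut[OF t]] show ?thesis .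
  qed
  have w_utt: "AE x in lebesgue_on \<Omega>. w t x = utt t x" if t: "t \<in> J" for t
  proof (rule uniq[OF _ utt_d[OF t] t])
    have d: "L2_deriv \<Omega> v2 (w t) t J" by (rule has_time_deriv_L2[OF w t])
    have "L2_tendsto \<Omega> (\<lambda>s x. (ut s x - ut t x) / (s - t)) (w t) (at t within J)"
    proof (rule L2_tendsto_AE_cong[OF conjunct2[OF d[unfolded L2_deriv_def]] \<Omega>L])
      show "\<forall>\<^sub>F s in at t within J. AE x in lebesgue_on \<Omega>. (v2 s x - v2 t x) / (s - t) = (ut s x - ut t x) / (s - t)"
        using eventually_within_self
      proof eventually_elim
        case (elim s)
        then have "s \<in> J" by simp
        from v2_ut[OF this] v2_ut[OF t] show ?case by eventually_elim simp
      qed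
    qed simp
    then show "L2_deriv \<Omega> ut (w t) t J"
      using utt_d[OF t] by (simp add: L2_deriv_def)
  qed
  have uttc: "L2_tendsto \<Omega> utt (utt t) (at t within J)" if t: "t \<in> J" for t
  proof (rule L2_tendsto_AE_cong[OF _ \<Omega>L _ w_utt[OF t]])
    have "\<forall>\<^sub>F s in at t within J. w s \<in> L2_space \<Omega>"
      using eventually_within_self by eventually_elim (use wc in auto)
    then show "L2_tendsto \<Omega> w (w t) (at t within J)"
      using wc t by (simp add: L2_tendsto_def)
    show "\<forall>\<^sub>F s in at t within J. AE x in lebesgue_on \<Omega>. w s x = utt s x"
      using eventually_within_self by eventually_elim (use w_utt in auto)
  qed
  have uH: "u t \<in> H01_space \<Omega>" "u t \<in> H2_space \<Omega>" if "t \<in> J" for t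
    using H2 that by auto
  show ?thesis
  proof (rule that[of ut utt])
    show "u t \<in> H01_space \<Omega> \<and> u t \<in> H2_space \<Omega> \<and> ut t \<in> H01_space \<Omega>" if "t \<in> J" for t
      using uH utH that by simp
    show "L2_deriv \<Omega> (\<lambda>s. weak_deriv \<Omega> i (u s)) (weak_deriv \<Omega> i (ut t)) t J" if "t \<in> J" "i \<in> Basis" for t i
      using has_time_deriv_H01(2)[OF \<Omega> v that] weak_deriv_AE_cong[OF \<Omega>L that(2) v_ut[OF that(1)]] by simp
    show "L2_tendsto \<Omega> (\<lambda>s. weak_laplacian \<Omega> (u s)) (weak_laplacian \<Omega> (u t)) (at t within J)" if "t \<in> J" for t
      using weak_laplacian_continuous[where J = J and u = u, OF \<Omega> uH(2) that] H2 that by auto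
    show "AE x in lebesgue_on \<Omega>. utt t x - (a * grad_inner \<Omega> (u t) (u t) + b) * weak_laplacian \<Omega> (u t) x
        = lam * u t x + signed_power p (u t x)" if "t \<in> J" "0 < t" for t
      using eq[OF that] integral_weak_grad_inner[OF \<Omega> H01_H1[OF uH(1)[OF that(1)]] H01_H1[OF uH(1)[OF that(1)]]]
      by (simp only: power2_norm_eq_inner)
  qed (use ut_d utt_d uttc init in auto)
qed

text \<open>The equation itself shows that the nonlinearity is continuous in time with values in
  \<open>L\<^sup>2\<close>, also at the initial time where it is not postulated.\<close>

lemma kirchhoff_nonlinearity_continuous:
  fixes \<Omega> :: "'a::euclidean_space set" and R :: "real \<Rightarrow> 'a \<Rightarrow> real"
  assumes \<Omega>: "open \<Omega>" and p: "p > 1" and T: "0 < T"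
  defines "J \<equiv> time_interval T"
  assumes u: "\<And>t. t \<in> J \<Longrightarrow> L2_tendsto \<Omega> u (u t) (at t within J)"
    and R: "\<And>t. t \<in> J \<Longrightarrow> L2_tendsto \<Omega> R (R t) (at t within J)"
    and eq: "\<And>t. t \<in> J \<Longrightarrow> 0 < t \<Longrightarrow> AE x in lebesgue_on \<Omega>. R t x = signed_power p (u t x)"
    and t: "t \<in> J"
  shows "AE x in lebesgue_on \<Omega>. R t x = signed_power p (u t x)"
    and "L2_tendsto \<Omega> (\<lambda>s x. signed_power p (u s x)) (\<lambda>x. signed_power p (u t x)) (at t within J)"
proof -
  have \<Omega>L: "\<Omega> \<in> sets lebesgue" using \<Omega> by (rule open_sets_lebesgue)
  have eq0: "AE x in lebesgue_on \<Omega>. R 0 x = signed_power p (u 0 x)"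
  proof -
    have J0: "0 \<in> J" using T by (simp add: J_def time_interval_def zero_ereal_def)
    obtain r where r: "ereal 0 < ereal r" "ereal r < T"
      using T ereal_dense2 unfolding zero_ereal_def by blast
    \<comment> \<open>Positive times tending to 0, at which the equation is available.\<close>
    define s where "s n = r / real (Suc n)" for n
    have sJ: "s n \<in> J" "0 < s n" for n
    proof -
      have "s n \<le> r" using r by (simp add: s_def divide_le_eq)
      then show "s n \<in> J" using r by (auto simp: J_def time_interval_def s_def intro: le_less_trans[of _ "ereal r"])
      show "0 < s n" using r by (simp add: s_def)
    qed
    have "(\<lambda>n. r * (1 / real (Suc n))) \<longlonglongrightarrow> r * 0"
      by (intro tendsto_mult tendsto_const LIMSEQ_Suc[OF lim_1_over_n])
    then have "s \<longlonglongrightarrow> 0" by (simp add: s_def[abs_def])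
    then have s: "filterlim s (at 0 within J) sequentially"
      unfolding filterlim_at using sJ by (auto intro!: always_eventually simp: less_imp_neq[symmetric])
    note RL = L2_tendsto_compose[OF R[OF J0] s] and uL = L2_tendsto_compose[OF u[OF J0] s]
    have L: "R (s n) \<in> L2_space \<Omega>" "u (s n) \<in> L2_space \<Omega>" for n
      using R[OF sJ(1)] u[OF sJ(1)] by (auto simp: L2_tendsto_def)
    \<comment> \<open>Two successive subsequences make both sides converge almost everywhere;
      continuity of the signed power identifies the limit at time 0.\<close>
    obtain k1 where k1: "strict_mono k1" "AE x in lebesgue_on \<Omega>. (\<lambda>n. R (s (k1 n)) x) \<longlonglongrightarrow> R 0 x"
      by (rule L2_tendsto_AE_subseq[OF L(1) RL])
    have "L2_tendsto \<Omega> (\<lambda>n. u (s (k1 n))) (u 0) sequentially"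
      by (rule L2_tendsto_compose[OF uL filterlim_subseq[OF k1(1)]])
    then obtain k2 where k2: "strict_mono k2" "AE x in lebesgue_on \<Omega>. (\<lambda>n. u (s (k1 (k2 n))) x) \<longlonglongrightarrow> u 0 x"
      by (rule L2_tendsto_AE_subseq[OF L(2)])
    have "AE x in lebesgue_on \<Omega>. \<forall>n. R (s n) x = signed_power p (u (s n) x)"
      using eq sJ by (simp add: AE_all_countable)
    with k1(2) k2(2) show ?thesis
    proof eventually_elim
      case (elim x)
      have "isCont (signed_power p) (u 0 x)"
        using continuous_on_signed_power[OF p] by (simp add: continuous_on_eq_continuous_at)
      from isCont_tendsto_compose[OF this elim(2)]
      have "(\<lambda>n. R (s (k1 (k2 n))) x) \<longlonglongrightarrow> signed_power p (u 0 x)" using elim(3) by simp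
      moreover have "(\<lambda>n. R (s (k1 (k2 n))) x) \<longlonglongrightarrow> R 0 x"
        using LIMSEQ_subseq_LIMSEQ[OF elim(1) k2(1)] by (simp add: comp_def)
      ultimately show ?case using LIMSEQ_unique by blast
    qed
  qed
  have eq': "AE x in lebesgue_on \<Omega>. R s x = signed_power p (u s x)" if "s \<in> J" for s
    using eq[OF that] eq0 that by (cases "s = 0") (auto simp: J_def time_interval_def)
  show "AE x in lebesgue_on \<Omega>. R t x = signed_power p (u t x)" by (rule eq'[OF t])
  show "L2_tendsto \<Omega> (\<lambda>s x. signed_power p (u s x)) (\<lambda>x. signed_power p (u t x)) (at t within J)"
  proof (rule L2_tendsto_AE_cong[OF R[OF t] \<Omega>L _ eq'[OF t]])
    show "\<forall>\<^sub>F s in at t within J. AE x in lebesgue_on \<Omega>. R s x = signed_power p (u s x)"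
      using eventually_within_self by eventually_elim (use eq' in auto)
  qed
qed

section \<open>The functionals in scalar form and the energy identity\<close>

lemma kirchhoff_J_eq:
  assumes "open \<Omega>" "u \<in> H1_space \<Omega>" "p > 0"
  shows "kirchhoff_J \<Omega> a b lam p u = a / 4 * (grad_inner \<Omega> u u)\<^sup>2 + b / 2 * grad_inner \<Omega> u u
    - lam / 2 * L2_inner \<Omega> u u - 1 / (p + 1) * (LINT x|lebesgue_on \<Omega>. \<bar>u x\<bar> powr (p + 1))"
  using Lnorm_powr[of "p + 1" \<Omega> u] assms(3)
  unfolding kirchhoff_J_def Lnorm_weak_grad_sq[OF assms(1,2), symmetric] Lnorm_2_sq[symmetric]
  by (simp flip: power_mult)

lemma kirchhoff_I_eq:
  assumes "open \<Omega>" "u \<in> H1_space \<Omega>" "p > 0"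
  shows "kirchhoff_I \<Omega> a b lam p u = a * (grad_inner \<Omega> u u)\<^sup>2 + b * grad_inner \<Omega> u u
    - lam * L2_inner \<Omega> u u - (LINT x|lebesgue_on \<Omega>. \<bar>u x\<bar> powr (p + 1))"
  using Lnorm_powr[of "p + 1" \<Omega> u] assms(3)
  unfolding kirchhoff_I_def Lnorm_weak_grad_sq[OF assms(1,2), symmetric] Lnorm_2_sq[symmetric]
  by (simp flip: power_mult)

lemma kirchhoff_AE_cong:
  assumes \<Omega>: "open \<Omega>" and u: "u \<in> H1_space \<Omega>" and p: "p > 0" and ae: "AE x in lebesgue_on \<Omega>. u x = v x"
  shows "kirchhoff_J \<Omega> a b lam p u = kirchhoff_J \<Omega> a b lam p v"
    and "kirchhoff_I \<Omega> a b lam p u = kirchhoff_I \<Omega> a b lam p v"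
proof -
  have \<Omega>L: "\<Omega> \<in> sets lebesgue" using \<Omega> by (rule open_sets_lebesgue)
  have v: "v \<in> H1_space \<Omega>" by (rule H1_AE_cong[OF \<Omega> u ae])
  have [measurable]: "u \<in> borel_measurable (lebesgue_on \<Omega>)" "v \<in> borel_measurable (lebesgue_on \<Omega>)"
    using u v by (auto intro: L2_measurable H1_L2)
  have "(LINT x|lebesgue_on \<Omega>. \<bar>u x\<bar> powr (p + 1)) = (LINT x|lebesgue_on \<Omega>. \<bar>v x\<bar> powr (p + 1))"
    by (rule integral_cong_AE) (use ae in \<open>auto elim: eventually_mono\<close>)
  moreover have "L2_inner \<Omega> u u = L2_inner \<Omega> v v"
    by (rule L2_inner_AE_cong[OF H1_L2[OF u] H1_L2[OF u] \<Omega>L ae ae])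
  moreover have "grad_inner \<Omega> u u = grad_inner \<Omega> v v"
    by (rule grad_inner_AE_cong[OF \<Omega>L ae ae])
  ultimately show "kirchhoff_J \<Omega> a b lam p u = kirchhoff_J \<Omega> a b lam p v"
    "kirchhoff_I \<Omega> a b lam p u = kirchhoff_I \<Omega> a b lam p v"
    by (simp_all add: kirchhoff_J_eq[OF \<Omega> u p] kirchhoff_J_eq[OF \<Omega> v p] kirchhoff_I_eq[OF \<Omega> u p] kirchhoff_I_eq[OF \<Omega> v p])
qed

text \<open>The interface to the remaining argument, which concerns real functions of time: testing
  with \<open>u\<close> gives the derivative of (u, u_t), testing with u_t the conservation of
  energy.\<close>

lemma kirchhoff_scalar_identities:
  fixes \<Omega> :: "'a::euclidean_space set"
  assumes \<Omega>: "open \<Omega>" and p: "p > 1" and sol: "kirchhoff_solution \<Omega> a b lam p u0 u1 T u"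
  defines "J \<equiv> time_interval T"
  obtains ut where
    "\<And>t. t \<in> J \<Longrightarrow> u t \<in> H01_space \<Omega>"
    "\<And>t. t \<in> J \<Longrightarrow> ut t \<in> L2_space \<Omega>"
    "\<And>t. t \<in> J \<Longrightarrow> ((\<lambda>s. L2_inner \<Omega> (u s) (u s)) has_real_derivative 2 * L2_inner \<Omega> (u t) (ut t)) (at t within J)"
    "\<And>t. t \<in> J \<Longrightarrow> ((\<lambda>s. L2_inner \<Omega> (u s) (ut s)) has_real_derivative
      L2_inner \<Omega> (ut t) (ut t) - kirchhoff_I \<Omega> a b lam p (u t)) (at t within J)"
    "\<And>t. t \<in> J \<Longrightarrow> 1 / 2 * L2_inner \<Omega> (ut t) (ut t) + kirchhoff_J \<Omega> a b lam p (u t) = kirchhoff_E0 \<Omega> a b lam p u0 u1"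
    "L2_inner \<Omega> (u 0) (ut 0) = (LINT x|lebesgue_on \<Omega>. u0 x * u1 x)"
    "continuous_on J (\<lambda>t. grad_inner \<Omega> (u t) (u t))"
    "continuous_on J (\<lambda>t. kirchhoff_I \<Omega> a b lam p (u t))"
    "AE x in lebesgue_on \<Omega>. u 0 x = u0 x"
proof -
  have \<Omega>L: "\<Omega> \<in> sets lebesgue" using \<Omega> by (rule open_sets_lebesgue)
  have T: "0 < T" using sol by (simp add: kirchhoff_solution_def)
  have J0: "0 \<in> J" using T by (simp add: J_def time_interval_def zero_ereal_def)
  obtain ut utt where uH: "\<And>t. t \<in> J \<Longrightarrow> u t \<in> H01_space \<Omega> \<and> u t \<in> H2_space \<Omega> \<and> ut t \<in> H01_space \<Omega>"
    and ud: "\<And>t. t \<in> J \<Longrightarrow> L2_deriv \<Omega> u (ut t) t J"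
    and utd: "\<And>t. t \<in> J \<Longrightarrow> L2_deriv \<Omega> ut (utt t) t J"
    and gd: "\<And>t i. t \<in> J \<Longrightarrow> i \<in> Basis \<Longrightarrow> L2_deriv \<Omega> (\<lambda>s. weak_deriv \<Omega> i (u s)) (weak_deriv \<Omega> i (ut t)) t J"
    and uttc: "\<And>t. t \<in> J \<Longrightarrow> L2_tendsto \<Omega> utt (utt t) (at t within J)"
    and lapc: "\<And>t. t \<in> J \<Longrightarrow> L2_tendsto \<Omega> (\<lambda>s. weak_laplacian \<Omega> (u s)) (weak_laplacian \<Omega> (u t)) (at t within J)"
    and eq: "\<And>t. t \<in> J \<Longrightarrow> 0 < t \<Longrightarrow> AE x in lebesgue_on \<Omega>.
      utt t x - (a * grad_inner \<Omega> (u t) (u t) + b) * weak_laplacian \<Omega> (u t) x = lam * u t x + signed_power p (u t x)"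
    and init: "AE x in lebesgue_on \<Omega>. u 0 x = u0 x" "AE x in lebesgue_on \<Omega>. ut 0 x = u1 x"
    using kirchhoff_regularity[OF \<Omega> sol] unfolding J_def by blast
  have H: "u t \<in> H1_space \<Omega>" "u t \<in> L2_space \<Omega>" "ut t \<in> H1_space \<Omega>" "ut t \<in> L2_space \<Omega>" if "t \<in> J" for t
    using uH[OF that] by (auto intro: H01_H1 H01_L2)
  have uttL: "utt t \<in> L2_space \<Omega>" if "t \<in> J" for t using uttc[OF that] by (simp add: L2_tendsto_def)
  have lapL: "weak_laplacian \<Omega> (u t) \<in> L2_space \<Omega>" if "t \<in> J" for t using lapc[OF that] by (simp add: L2_tendsto_def)
  define \<psi> where "\<psi> t = grad_inner \<Omega> (u t) (u t)" for t
  define \<Gamma> where "\<Gamma> t = (LINT x|lebesgue_on \<Omega>. \<bar>u t x\<bar> powr (p + 1))" for t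
  define F where "F t = (\<lambda>x. signed_power p (u t x))" for t
  define K where "K t = L2_inner \<Omega> (ut t) (ut t)" for t
  define \<phi> where "\<phi> t = L2_inner \<Omega> (u t) (u t)" for t
  have d\<psi>: "(\<psi> has_real_derivative 2 * grad_inner \<Omega> (u t) (ut t)) (at t within J)" if t: "t \<in> J" for t
  proof -
    have "((\<lambda>s. \<Sum>i\<in>Basis. L2_inner \<Omega> (weak_deriv \<Omega> i (u s)) (weak_deriv \<Omega> i (u s))) has_real_derivative
        (\<Sum>i\<in>Basis. L2_inner \<Omega> (weak_deriv \<Omega> i (ut t)) (weak_deriv \<Omega> i (u t))
          + L2_inner \<Omega> (weak_deriv \<Omega> i (u t)) (weak_deriv \<Omega> i (ut t)))) (at t within J)"
      by (intro DERIV_sum L2_inner_has_derivative gd t)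
    moreover have "(\<Sum>i\<in>Basis. L2_inner \<Omega> (weak_deriv \<Omega> i (ut t)) (weak_deriv \<Omega> i (u t))
          + L2_inner \<Omega> (weak_deriv \<Omega> i (u t)) (weak_deriv \<Omega> i (ut t))) = 2 * grad_inner \<Omega> (u t) (ut t)"
      using grad_inner_commute[of \<Omega> "u t" "ut t"] by (simp add: grad_inner_def sum.distrib)
    ultimately show ?thesis by (simp add: \<psi>_def[abs_def] grad_inner_def[abs_def])
  qed
  have \<psi>c: "(\<psi> \<longlongrightarrow> \<psi> t) (at t within J)" if "t \<in> J" for t
    using DERIV_continuous[OF d\<psi>[OF that]] by (simp add: continuous_within)
  \<comment> \<open>The remaining terms of the equation, solved for the nonlinearity; their L^2
    continuity follows from the regularity of \<open>u\<close>.\<close>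
  define R where "R t = (\<lambda>x. utt t x - (a * \<psi> t + b) * weak_laplacian \<Omega> (u t) x - lam * u t x)" for t
  have Rc: "L2_tendsto \<Omega> R (R t) (at t within J)" if t: "t \<in> J" for t
    unfolding R_def[abs_def]
    by (intro L2_tendsto_diff L2_tendsto_scale tendsto_intros uttc lapc \<psi>c L2_tendsto_scale_const L2_deriv_continuous[OF ud] t)
  have Req: "AE x in lebesgue_on \<Omega>. R t x = signed_power p (u t x)" if "t \<in> J" "0 < t" for t
    using eq[OF that] by eventually_elim (simp add: R_def \<psi>_def)
  note nl = kirchhoff_nonlinearity_continuous[OF \<Omega> p T, folded J_def, OF L2_deriv_continuous[OF ud] Rc Req]
  have FL: "F t \<in> L2_space \<Omega>" if "t \<in> J" for t
    using nl(2)[OF _ _ _ _ that] by (simp add: L2_tendsto_def F_def)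
  have test: "L2_inner \<Omega> (utt t) w = (a * \<psi> t + b) * L2_inner \<Omega> (weak_laplacian \<Omega> (u t)) w
      + lam * L2_inner \<Omega> (u t) w + L2_inner \<Omega> (F t) w" if t: "t \<in> J" and w: "w \<in> L2_space \<Omega>" for t w
  proof -
    have "L2_inner \<Omega> (R t) w = L2_inner \<Omega> (F t) w"
      using Rc[OF t] nl(1)[OF _ _ _ _ t]
      by (intro L2_inner_AE_cong \<Omega>L w) (auto simp: F_def L2_tendsto_def)
    moreover have "L2_inner \<Omega> (R t) w = L2_inner \<Omega> (utt t) w
        - (a * \<psi> t + b) * L2_inner \<Omega> (weak_laplacian \<Omega> (u t)) w - lam * L2_inner \<Omega> (u t) w"
      unfolding R_def using uttL[OF t] lapL[OF t] H[OF t] w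
      by (simp add: L2_inner_diff_left L2_inner_scale_left L2_diff L2_scale)
    ultimately show ?thesis by simp
  qed
  have green: "L2_inner \<Omega> (weak_laplacian \<Omega> (u t)) w = - grad_inner \<Omega> (u t) w" if "t \<in> J" "w \<in> H01_space \<Omega>" for t w
    using weak_laplacian_green(2)[OF \<Omega> _ that(2)] uH[OF that(1)] by blast
  have J_eq: "kirchhoff_J \<Omega> a b lam p (u t) = a / 4 * (\<psi> t)\<^sup>2 + b / 2 * \<psi> t - lam / 2 * \<phi> t - 1 / (p + 1) * \<Gamma> t"
    and I_eq: "kirchhoff_I \<Omega> a b lam p (u t) = a * (\<psi> t)\<^sup>2 + b * \<psi> t - lam * \<phi> t - \<Gamma> t" if "t \<in> J" for t
    using kirchhoff_J_eq[OF \<Omega> H(1)[OF that]] kirchhoff_I_eq[OF \<Omega> H(1)[OF that]] p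
    by (simp_all add: \<psi>_def \<phi>_def \<Gamma>_def)
  have d\<phi>: "(\<phi> has_real_derivative 2 * L2_inner \<Omega> (u t) (ut t)) (at t within J)" if t: "t \<in> J" for t
    using L2_inner_has_derivative[OF ud[OF t] ud[OF t]] L2_inner_commute[of \<Omega> "ut t" "u t"]
    by (simp add: \<phi>_def[abs_def])
  have dK: "(K has_real_derivative 2 * L2_inner \<Omega> (utt t) (ut t)) (at t within J)" if t: "t \<in> J" for t
    using L2_inner_has_derivative[OF utd[OF t] utd[OF t]] L2_inner_commute[of \<Omega> "utt t" "ut t"]
    by (simp add: K_def[abs_def])
  have d\<Gamma>: "(\<Gamma> has_real_derivative (p + 1) * L2_inner \<Omega> (F t) (ut t)) (at t within J)" if t: "t \<in> J" for t
    using power_integral_has_derivative[OF p ud[OF t] nl(2)[OF _ _ _ _ t]]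
    by (simp add: \<Gamma>_def[abs_def] F_def)
  define E where "E t = 1 / 2 * K t + (a / 4 * (\<psi> t)\<^sup>2 + b / 2 * \<psi> t - lam / 2 * \<phi> t - 1 / (p + 1) * \<Gamma> t)" for t
  \<comment> \<open>Testing with u_t, which lies in \<open>H01_space\<close>, so that Green's
    formula turns the Laplacian into the derivative of the gradient terms.\<close>
  have dE: "(E has_real_derivative 0) (at t within J)" if t: "t \<in> J" for t
  proof -
    have cancel: "1 / (p + 1) * ((p + 1) * X) = X" for X using p by simp
    have "(E has_real_derivative 1 / 2 * (2 * L2_inner \<Omega> (utt t) (ut t))
        + (a / 4 * (2 * \<psi> t * (2 * grad_inner \<Omega> (u t) (ut t))) + b / 2 * (2 * grad_inner \<Omega> (u t) (ut t))
          - lam / 2 * (2 * L2_inner \<Omega> (u t) (ut t)) - 1 / (p + 1) * ((p + 1) * L2_inner \<Omega> (F t) (ut t)))) (at t within J)"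
      unfolding E_def[abs_def]
      by (rule derivative_eq_intros d\<psi>[OF t] d\<phi>[OF t] dK[OF t] d\<Gamma>[OF t] refl | simp)+
    moreover have "1 / 2 * (2 * L2_inner \<Omega> (utt t) (ut t))
        + (a / 4 * (2 * \<psi> t * (2 * grad_inner \<Omega> (u t) (ut t))) + b / 2 * (2 * grad_inner \<Omega> (u t) (ut t))
          - lam / 2 * (2 * L2_inner \<Omega> (u t) (ut t)) - 1 / (p + 1) * ((p + 1) * L2_inner \<Omega> (F t) (ut t))) = 0"
      using test[OF t H(4)[OF t]] green[OF t, of "ut t"] uH[OF t]
      unfolding cancel by (simp add: algebra_simps)
    ultimately show ?thesis by simp
  qed
  obtain c where c: "\<And>t. t \<in> J \<Longrightarrow> E t = c"
    using has_field_derivative_zero_constant[OF convex_time_interval dE[unfolded J_def]] unfolding J_def by blast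
  have E0: "kirchhoff_E0 \<Omega> a b lam p u0 u1 = c"
  proof -
    have "(Lnorm \<Omega> 2 u1)\<^sup>2 = K 0"
      using Lnorm_2_AE_cong[OF H(4)[OF J0] \<Omega>L init(2)] by (simp add: K_def Lnorm_2_sq[symmetric])
    moreover have "kirchhoff_J \<Omega> a b lam p u0 = kirchhoff_J \<Omega> a b lam p (u 0)"
      using kirchhoff_AE_cong(1)[OF \<Omega> H(1)[OF J0] _ init(1)] p by simp
    ultimately show ?thesis
      using c[OF J0] J_eq[OF J0] by (simp add: kirchhoff_E0_def E_def)
  qed
  have cont: "continuous_on J \<psi>" "continuous_on J \<phi>" "continuous_on J \<Gamma>"
    using DERIV_continuous_on[OF d\<psi>] DERIV_continuous_on[OF d\<phi>] DERIV_continuous_on[OF d\<Gamma>] by simp_all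
  show ?thesis
  proof (rule that[of ut])
    show "((\<lambda>s. L2_inner \<Omega> (u s) (ut s)) has_real_derivative
      L2_inner \<Omega> (ut t) (ut t) - kirchhoff_I \<Omega> a b lam p (u t)) (at t within J)" if t: "t \<in> J" for t
    proof -
      \<comment> \<open>Testing with \<open>u\<close> itself: Green's formula and the power identity
        assemble exactly -I(u).\<close>
      have "L2_inner \<Omega> (u t) (utt t) = - kirchhoff_I \<Omega> a b lam p (u t)"
        using test[OF t H(2)[OF t]] green[OF t, of "u t"] uH[OF t] L2_inner_commute[of \<Omega> "u t" "utt t"]
          L2_inner_signed_power[of \<Omega>, where p = p and u = "u t"] I_eq[OF t]
        by (simp add: \<psi>_def \<phi>_def \<Gamma>_def F_def power2_eq_square algebra_simps)
      then show ?thesis using L2_inner_has_derivative[OF ud[OF t] utd[OF t]] by simp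
    qed
    show "1 / 2 * L2_inner \<Omega> (ut t) (ut t) + kirchhoff_J \<Omega> a b lam p (u t) = kirchhoff_E0 \<Omega> a b lam p u0 u1" if "t \<in> J" for t
      using c[OF that] J_eq[OF that] E0 by (simp add: E_def K_def)
    show "L2_inner \<Omega> (u 0) (ut 0) = (LINT x|lebesgue_on \<Omega>. u0 x * u1 x)"
      using L2_inner_AE_cong[OF H(2)[OF J0] H(4)[OF J0] \<Omega>L init] by (simp add: L2_inner_def)
    have "continuous_on J (\<lambda>t. a * (\<psi> t)\<^sup>2 + b * \<psi> t - lam * \<phi> t - \<Gamma> t)"
      by (intro continuous_intros cont)
    then show "continuous_on J (\<lambda>t. kirchhoff_I \<Omega> a b lam p (u t))"
      by (rule continuous_on_cong[THEN iffD1, rotated -1]) (auto simp: I_eq)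
  qed (use uH H d\<phi> cont(1) init(1) in \<open>auto simp: \<phi>_def[abs_def] \<psi>_def[abs_def]\<close>)
qed

section \<open>The concavity method\<close>

lemma mvt_within:
  fixes f f' :: "real \<Rightarrow> real"
  assumes "a < b" "c \<le> a" "\<And>t. c \<le> t \<Longrightarrow> (f has_real_derivative f' t) (at t within {c..})"
  obtains x where "a < x" "x < b" "f b - f a = f' x * (b - a)"
proof -
  have "(f has_derivative (\<lambda>h. f' x * h)) (at x within {a..b})" if "a \<le> x" "x \<le> b" for x
    using assms(3)[of x] assms(2) that
    by (auto simp: has_field_derivative_def intro: has_derivative_subset)
  from mvt_simple[OF assms(1) this] that show ?thesis by auto
qed

lemma nonneg_deriv_mono:
  fixes f f' :: "real \<Rightarrow> real"
  assumes "a \<le> b" "0 \<le> a" "\<And>t. 0 \<le> t \<Longrightarrow> (f has_real_derivative f' t) (at t within {0..})"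
    and "\<And>t. a < t \<Longrightarrow> t < b \<Longrightarrow> 0 \<le> f' t"
  shows "f a \<le> f b"
proof (cases "a = b")
  case False
  then have "a < b" using assms(1) by simp
  then obtain x where x: "a < x" "x < b" "f b - f a = f' x * (b - a)"
    using mvt_within assms(2,3) by blast
  then have "0 \<le> f' x * (b - a)" using assms(4) \<open>a < b\<close> by simp
  then show ?thesis using x(3) by simp
qed simp

lemma has_real_derivative_powr_within:
  assumes "(f has_real_derivative D) (at t within S)" "0 < f t"
  shows "((\<lambda>t. f t powr r) has_real_derivative r * f t powr (r - 1) * D) (at t within S)"
  by (rule DERIV_chain2[OF has_real_derivative_powr[OF assms(2)] assms(1)])

text \<open>Levine's argument: \<open>\<phi> powr (- (p - 1) / 4)\<close> is positive, concave and decreasing,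
  which is impossible on a half-line.\<close>

lemma concavity_blowup:
  fixes \<phi> g g' K :: "real \<Rightarrow> real"
  assumes p: "p > 1" and d\<phi>: "\<And>t. 0 \<le> t \<Longrightarrow> (\<phi> has_real_derivative 2 * g t) (at t within {0..})"
    and dg: "\<And>t. 0 \<le> t \<Longrightarrow> (g has_real_derivative g' t) (at t within {0..})"
    and \<phi>_nn: "\<And>t. 0 \<le> t \<Longrightarrow> 0 \<le> \<phi> t" and K: "\<And>t. 0 \<le> t \<Longrightarrow> 0 \<le> K t"
    and cs: "\<And>t. 0 \<le> t \<Longrightarrow> (g t)\<^sup>2 \<le> \<phi> t * K t"
    and g': "\<And>t. 0 \<le> t \<Longrightarrow> (p + 3) / 2 * K t \<le> g' t"
    and t0: "0 \<le> t0" "0 < g t0"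
  shows False
proof -
  \<comment> \<open>The value for which 2 (\<alpha> + 1) equals the factor (p + 3)/2 in the lower
    bound of g'.\<close>
  define \<alpha> where "\<alpha> = (p - 1) / 4"
  have \<alpha>: "\<alpha> > 0" "2 * (\<alpha> + 1) = (p + 3) / 2" using p by (simp_all add: \<alpha>_def field_simps)
  have g'_nn: "0 \<le> g' t" if "0 \<le> t" for t
  proof -
    have "0 \<le> (p + 3) / 2 * K t" using K[OF that] p by simp
    then show ?thesis using g'[OF that] by linarith
  qed
  have g_pos: "0 < g t" if "t0 \<le> t" for t
    using nonneg_deriv_mono[OF that t0(1) dg] g'_nn t0 by force
  have \<phi>_pos: "0 < \<phi> t" if "t0 \<le> t" for t
  proof -
    have "0 < (g t)\<^sup>2" using g_pos[OF that] by simp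
    then have "\<phi> t \<noteq> 0" using cs[of t] that t0 by auto
    then show ?thesis using \<phi>_nn[of t] that t0 by simp
  qed
  \<comment> \<open>The derivative of \<phi>^(-\<alpha>) is -2 \<alpha> z, so concavity means that
    \<open>z\<close> is nondecreasing.\<close>
  define z where "z t = g t * \<phi> t powr (- \<alpha> - 1)" for t
  have sub: "(f has_real_derivative D) (at t within {t0..})"
    if "(f has_real_derivative D) (at t within {0..})" for f D t
    by (rule DERIV_subset[OF that]) (use t0 in auto)
  have dz: "(z has_real_derivative \<phi> t powr (- \<alpha> - 2) * (g' t * \<phi> t - 2 * (\<alpha> + 1) * (g t)\<^sup>2)) (at t within {t0..})"
    if t: "t0 \<le> t" for t
  proof -
    have "((\<lambda>t. \<phi> t powr (- \<alpha> - 1)) has_real_derivative (- \<alpha> - 1) * \<phi> t powr (- \<alpha> - 1 - 1) * (2 * g t)) (at t within {t0..})"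
      using sub[OF d\<phi>[of t]] t t0 by (intro has_real_derivative_powr_within \<phi>_pos) auto
    then have "(z has_real_derivative g' t * \<phi> t powr (- \<alpha> - 1)
        + (- \<alpha> - 1) * \<phi> t powr (- \<alpha> - 1 - 1) * (2 * g t) * g t) (at t within {t0..})"
      unfolding z_def[abs_def] using sub[OF dg[of t]] t t0 by (intro DERIV_mult) auto
    moreover have "\<phi> t powr (- \<alpha> - 1) = \<phi> t powr (- \<alpha> - 2) * \<phi> t"
    proof -
      have e: "- \<alpha> - 1 = - 1 - \<alpha>" by simp
      show ?thesis unfolding e using powr_add[of "\<phi> t" "- \<alpha> - 2" 1] \<phi>_pos[OF t] by simp
    qed
    ultimately show ?thesis by (simp add: algebra_simps power2_eq_square)
  qed
  have z_mono: "z t0 \<le> z t" if t: "t0 < t" for t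
  proof -
    obtain x where x: "t0 < x" "z t - z t0 = \<phi> x powr (- \<alpha> - 2) * (g' x * \<phi> x - 2 * (\<alpha> + 1) * (g x)\<^sup>2) * (t - t0)"
      by (rule mvt_within[OF t order_refl dz])
    have "(p + 3) / 2 * (g x)\<^sup>2 \<le> (p + 3) / 2 * (\<phi> x * K x)"
      using cs[of x] x(1) t0 p by (intro mult_left_mono) auto
    also have "\<dots> \<le> g' x * \<phi> x"
      using mult_right_mono[OF g'[of x] \<phi>_nn[of x]] x(1) t0 by (simp add: algebra_simps)
    finally have "0 \<le> g' x * \<phi> x - 2 * (\<alpha> + 1) * (g x)\<^sup>2" unfolding \<alpha>(2) by simp
    then have "0 \<le> z t - z t0" unfolding x(2) using t by (intro mult_nonneg_nonneg) auto
    then show ?thesis by simp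
  qed
  have z0: "z t0 > 0" using g_pos[of t0] \<phi>_pos[of t0] by (simp add: z_def)
  have dy: "((\<lambda>t. \<phi> t powr (- \<alpha>)) has_real_derivative - 2 * \<alpha> * z t) (at t within {t0..})" if t: "t0 \<le> t" for t
  proof -
    have "((\<lambda>t. \<phi> t powr (- \<alpha>)) has_real_derivative (- \<alpha>) * \<phi> t powr (- \<alpha> - 1) * (2 * g t)) (at t within {t0..})"
      using sub[OF d\<phi>[of t]] t t0 by (intro has_real_derivative_powr_within \<phi>_pos) auto
    then show ?thesis by (simp add: z_def algebra_simps)
  qed
  \<comment> \<open>After this time the tangent at \<open>t0\<close> has dropped from
    \<phi>(t0)^(-\<alpha>) to -1, while the concave function lies below its tangent and is
    nonnegative.\<close>
  define L where "L = (\<phi> t0 powr (- \<alpha>) + 1) / (2 * \<alpha> * z t0)"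
  have L: "L > 0" using \<alpha> z0 by (auto simp: L_def intro!: divide_pos_pos add_nonneg_pos)
  have t0L: "t0 < t0 + L" using L by simp
  obtain x where x: "t0 < x" "\<phi> (t0 + L) powr (- \<alpha>) - \<phi> t0 powr (- \<alpha>) = - 2 * \<alpha> * z x * (t0 + L - t0)"
    by (rule mvt_within[OF t0L order_refl dy])
  have "2 * \<alpha> * z t0 * L \<le> 2 * \<alpha> * z x * L"
    using z_mono[OF x(1)] \<alpha> L by (intro mult_right_mono mult_left_mono) auto
  moreover have "2 * \<alpha> * z t0 * L = \<phi> t0 powr (- \<alpha>) + 1"
    using \<alpha> z0 by (simp add: L_def)
  ultimately have "\<phi> (t0 + L) powr (- \<alpha>) \<le> - 1" using x(2) by simp
  moreover have "0 \<le> \<phi> (t0 + L) powr (- \<alpha>)" by simp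
  ultimately show False by linarith
qed

text \<open>What the concavity argument still needs is a time with g > 0: either the initial time
  has it, or a lower bound c > 0 of g' produces it by linear growth.\<close>

lemma blowup_criterion:
  fixes \<phi> g g' K :: "real \<Rightarrow> real"
  assumes p: "p > 1" and d\<phi>: "\<And>t. 0 \<le> t \<Longrightarrow> (\<phi> has_real_derivative 2 * g t) (at t within {0..})"
    and dg: "\<And>t. 0 \<le> t \<Longrightarrow> (g has_real_derivative g' t) (at t within {0..})"
    and \<phi>_nn: "\<And>t. 0 \<le> t \<Longrightarrow> 0 \<le> \<phi> t" and K: "\<And>t. 0 \<le> t \<Longrightarrow> 0 \<le> K t"
    and cs: "\<And>t. 0 \<le> t \<Longrightarrow> (g t)\<^sup>2 \<le> \<phi> t * K t"
    and g': "\<And>t. 0 \<le> t \<Longrightarrow> (p + 3) / 2 * K t + c \<le> g' t"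
    and c: "0 < c \<or> 0 \<le> c \<and> 0 < g 0"
  shows False
proof -
  have "\<exists>t0\<ge>0. 0 < g t0"
  proof (cases "0 < g 0")
    case False
    then have c: "0 < c" using c by simp
    \<comment> \<open>The time at which the line of slope \<open>c\<close> from \<open>g 0\<close>
      reaches 1.\<close>
    define t where "t = (1 - g 0) / c"
    have t: "t > 0" using False c by (simp add: t_def)
    obtain x where x: "0 < x" "g t - g 0 = g' x * (t - 0)"
      using mvt_within[OF t order_refl dg] by metis
    have "0 \<le> (p + 3) / 2 * K x" using p K[of x] x(1) by simp
    then have "c \<le> g' x" using g'[of x] x(1) by simp
    then have "c * t \<le> g' x * t" using t by (intro mult_right_mono) auto
    moreover have "c * t = 1 - g 0" using c by (simp add: t_def)
    ultimately have "0 < g t" using x(2) by simp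
    then show ?thesis using t less_imp_le by blast
  qed auto
  then obtain t0 where "0 \<le> t0" "0 < g t0" by blast
  moreover have "(p + 3) / 2 * K t \<le> g' t" if "0 \<le> t" for t using g'[OF that] c by auto
  ultimately show False using concavity_blowup[OF p d\<phi> dg \<phi>_nn K cs] by blast
qed

text \<open>At the first time where f is nonnegative, continuity makes f equal to 0, and f is
  negative before; \<open>step\<close> excludes exactly this. Estimates valid only inside the region
  f < 0 thereby become available for all times.\<close>

lemma continuous_barrier:
  fixes f :: "real \<Rightarrow> real"
  assumes cont: "continuous_on {0..} f" and f0: "f 0 < 0"
    and step: "\<And>t. 0 < t \<Longrightarrow> (\<And>s. 0 \<le> s \<Longrightarrow> s < t \<Longrightarrow> f s < 0) \<Longrightarrow> f t \<noteq> 0" and t: "0 \<le> t"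
  shows "f t < 0"
proof (rule ccontr)
  assume "\<not> f t < 0"
  then have "t \<in> {0..t} \<inter> f -` {0..}" using t by simp
  define S where "S = {0..t} \<inter> f -` {0..}"
  have "closed S"
    unfolding S_def using continuous_on_subset[OF cont, of "{0..t}"]
    by (intro continuous_closed_preimage) auto
  then have "compact S" unfolding S_def by (metis Int_lower1 bounded_closed_interval bounded_subset compact_eq_bounded_closed)
  then obtain \<tau> where \<tau>: "\<tau> \<in> S" "\<And>s. s \<in> S \<Longrightarrow> \<tau> \<le> s"
    using compact_attains_inf[of S] \<open>t \<in> _\<close> unfolding S_def by blast
  have \<tau>': "0 \<le> \<tau>" "\<tau> \<le> t" "0 \<le> f \<tau>" using \<tau>(1) by (auto simp: S_def)
  have \<tau>pos: "0 < \<tau>" using \<tau>' f0 by (cases "\<tau> = 0") auto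
  have before: "f s < 0" if "0 \<le> s" "s < \<tau>" for s
    using \<tau>(2)[of s] that \<tau>'(2) by (auto simp: S_def not_less[symmetric])
  obtain s where s: "0 \<le> s" "s \<le> \<tau>" "f s = 0"
    using IVT'[of f 0 0 \<tau>] f0 \<tau>' continuous_on_subset[OF cont, of "{0..\<tau>}"] by auto
  have "s = \<tau>" using before[of s] s by force
  then show False using step[OF \<tau>pos before] s(3) by blast
qed

section \<open>The potential well\<close>

text \<open>Multiplication of J by p + 1 gives the power integral the same coefficient as in I, so
  it cancels; the coefficients left are (p + 1)/4 - 1 and (p + 1)/2 - 1.\<close>

lemma kirchhoff_J_I_identity:
  assumes "open \<Omega>" "u \<in> H1_space \<Omega>" "p > 0"
  shows "(p + 1) * kirchhoff_J \<Omega> a b lam p u - kirchhoff_I \<Omega> a b lam p u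
    = (p - 3) / 4 * a * (grad_inner \<Omega> u u)\<^sup>2 + (p - 1) / 2 * (b * grad_inner \<Omega> u u - lam * L2_inner \<Omega> u u)"
proof -
  have cancel: "(p + 1) * (1 / (p + 1) * X) = X" for X using assms(3) by simp
  show ?thesis
    unfolding kirchhoff_J_eq[OF assms] kirchhoff_I_eq[OF assms] right_diff_distrib[of "p + 1"] cancel
    by (simp add: field_simps)
qed

lemma zero_on_power_integral:
  assumes "zero_on \<Omega> (u :: 'a::euclidean_space \<Rightarrow> real)" "u \<in> L2_space \<Omega>"
  shows "(LINT x|lebesgue_on \<Omega>. \<bar>u x\<bar> powr q) = 0"
proof -
  have [measurable]: "u \<in> borel_measurable (lebesgue_on \<Omega>)" using assms(2) by (rule L2_measurable)
  have "(LINT x|lebesgue_on \<Omega>. \<bar>u x\<bar> powr q) = (LINT x|lebesgue_on \<Omega>. 0)"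
    by (rule integral_cong_AE) (use assms(1) in \<open>auto simp: zero_on_def elim: eventually_mono\<close>)
  then show ?thesis by simp
qed

lemma kirchhoff_quadratic_nonneg:
  assumes \<Omega>: "open \<Omega>" "bounded \<Omega>" "\<Omega> \<noteq> {}" and b: "b > 0"
    and lam: "lam \<le> b * principal_eigenvalue \<Omega>" and v: "v \<in> H01_space \<Omega>"
  shows "0 \<le> b * grad_inner \<Omega> v v - lam * L2_inner \<Omega> v v"
proof -
  have "lam * L2_inner \<Omega> v v \<le> b * principal_eigenvalue \<Omega> * L2_inner \<Omega> v v"
    using lam by (intro mult_right_mono) auto
  also have "\<dots> \<le> b * grad_inner \<Omega> v v"
    using mult_left_mono[OF principal_eigenvalue_characterization(2)[OF \<Omega> v], of b] b by simp
  finally show ?thesis by simp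
qed

text \<open>A real infimum lies below its members only if the set is bounded below; on the Nehari
  manifold I = 0, so the preceding identity gives J \<ge> 0.\<close>

lemma well_depth_le_nehari:
  assumes \<Omega>: "open \<Omega>" "bounded \<Omega>" "\<Omega> \<noteq> {}" and a: "a > 0" and b: "b > 0" and p: "p > 3"
    and lam: "lam \<le> b * principal_eigenvalue \<Omega>" and u: "u \<in> nehari \<Omega> a b lam p"
  shows "well_depth \<Omega> a b lam p \<le> kirchhoff_J \<Omega> a b lam p u"
proof -
  have "0 \<le> kirchhoff_J \<Omega> a b lam p v" if v: "v \<in> nehari \<Omega> a b lam p" for v
  proof -
    have v': "v \<in> H01_space \<Omega>" "kirchhoff_I \<Omega> a b lam p v = 0" using v by (auto simp: nehari_def)
    have "0 \<le> (p + 1) * kirchhoff_J \<Omega> a b lam p v"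
      using kirchhoff_J_I_identity[OF \<Omega>(1) H01_H1[OF v'(1)], of p a b lam]
        kirchhoff_quadratic_nonneg[OF \<Omega> b lam v'(1)] v'(2) a p by simp
    then show ?thesis using p by (simp add: zero_le_mult_iff)
  qed
  then show ?thesis
    unfolding well_depth_def using u by (intro cINF_lower bdd_belowI2[where m = 0]) auto
qed

text \<open>The ray through \<open>u\<close> meets the Nehari manifold below \<open>u\<close>.\<close>

lemma well_depth_le:
  assumes \<Omega>: "open \<Omega>" "bounded \<Omega>" "\<Omega> \<noteq> {}" and a: "a > 0" and b: "b > 0" and p: "p > 3"
    and lam: "lam \<le> b * principal_eigenvalue \<Omega>" and u: "u \<in> H01_space \<Omega>"
    and I: "kirchhoff_I \<Omega> a b lam p u < 0"
  shows "(p + 1) * well_depth \<Omega> a b lam p \<le> (p - 3) / 4 * a * (grad_inner \<Omega> u u)\<^sup>2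
    + (p - 1) / 2 * (b * grad_inner \<Omega> u u - lam * L2_inner \<Omega> u u)"
proof -
  note eig = principal_eigenvalue_characterization[OF \<Omega>]
  define \<psi> where "\<psi> = grad_inner \<Omega> u u"
  define \<phi> where "\<phi> = L2_inner \<Omega> u u"
  define B where "B = b * \<psi> - lam * \<phi>"
  define \<Gamma> where "\<Gamma> = (LINT x|lebesgue_on \<Omega>. \<bar>u x\<bar> powr (p + 1))"
  have B: "0 \<le> B" using kirchhoff_quadratic_nonneg[OF \<Omega> b lam u] by (simp add: B_def \<psi>_def \<phi>_def)
  have I': "a * \<psi>\<^sup>2 + B < \<Gamma>"
    using I kirchhoff_I_eq[OF \<Omega>(1) H01_H1[OF u], of p a b lam] p by (simp add: B_def \<psi>_def \<phi>_def \<Gamma>_def)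
  have nz: "\<not> zero_on \<Omega> u"
  proof
    assume "zero_on \<Omega> u"
    then have "\<Gamma> = 0" unfolding \<Gamma>_def by (rule zero_on_power_integral[OF _ H01_L2[OF u]])
    moreover have "0 \<le> a * \<psi>\<^sup>2" using a by simp
    ultimately show False using I' B by linarith
  qed
  then have \<phi>: "\<phi> > 0"
    using L2_inner_self_eq_0_iff[OF H01_L2[OF u]] L2_inner_self_nonneg[of \<Omega> u] unfolding \<phi>_def by linarith
  then have \<psi>: "\<psi> > 0"
    using eig(2)[OF u] mult_pos_pos[OF eig(1) \<phi>] unfolding \<psi>_def \<phi>_def by linarith
  have \<Gamma>: "\<Gamma> > 0" using I' B \<psi> a by (smt (verit) mult_nonneg_nonneg zero_le_power2)
  \<comment> \<open>The value of I at \<open>s u\<close> for s > 0.\<close>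
  define h where "h s = a * \<psi>\<^sup>2 * s ^ 4 + B * s\<^sup>2 - \<Gamma> * s powr (p + 1)" for s
  \<comment> \<open>The scale at which the quartic term and the power term balance, so that h(s1) =
    B s1^2 \<ge> 0. It is at most 1 because I(u) < 0, and \<open>h\<close> has a zero between it and
    1.\<close>
  define s1 where "s1 = (a * \<psi>\<^sup>2 / \<Gamma>) powr (1 / (p - 3))"
  have ratio: "0 < a * \<psi>\<^sup>2 / \<Gamma>" "a * \<psi>\<^sup>2 / \<Gamma> \<le> 1" using a \<psi> \<Gamma> I' B by simp_all
  have s1: "0 < s1" "s1 \<le> 1"
    unfolding s1_def using ratio p powr_mono2[of "1 / (p - 3)" "a * \<psi>\<^sup>2 / \<Gamma>" 1] by auto
  have "s1 powr (p - 3) = a * \<psi>\<^sup>2 / \<Gamma>"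
    using ratio p a \<Gamma> unfolding s1_def by (simp add: powr_powr)
  then have "\<Gamma> * s1 powr (p + 1) = a * \<psi>\<^sup>2 * s1 ^ 4"
    using powr_add[of s1 "p - 3" 4] s1(1) \<Gamma> by (simp add: powr_numeral add.commute)
  then have "0 \<le> h s1" using B by (simp add: h_def)
  moreover have "h 1 \<le> 0" using I' by (simp add: h_def)
  moreover have "continuous_on {s1..1} h"
    unfolding h_def using s1(1) p by (auto intro!: continuous_intros)
  ultimately obtain s where s: "s1 \<le> s" "s \<le> 1" "h s = 0"
    using IVT2'[of h 1 0 s1] s1(2) by auto
  have s0: "0 < s" using s s1 by simp
  let ?v = "\<lambda>x. s * u x"
  have vH: "?v \<in> H01_space \<Omega>" by (rule H01_scale[OF \<Omega>(1) u])
  have v\<psi>: "grad_inner \<Omega> ?v ?v = s\<^sup>2 * \<psi>"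
    unfolding \<psi>_def by (rule grad_inner_scale[OF \<Omega>(1) H01_H1[OF u]])
  have v\<phi>: "L2_inner \<Omega> ?v ?v = s\<^sup>2 * \<phi>"
    by (simp add: L2_inner_scale_left L2_inner_scale_right \<phi>_def power2_eq_square)
  have v\<Gamma>: "(LINT x|lebesgue_on \<Omega>. \<bar>?v x\<bar> powr (p + 1)) = s powr (p + 1) * \<Gamma>"
    using s0 by (simp add: \<Gamma>_def abs_mult powr_mult)
  have "kirchhoff_I \<Omega> a b lam p ?v = h s"
    using kirchhoff_I_eq[OF \<Omega>(1) H01_H1[OF vH], of p a b lam] p unfolding v\<psi> v\<phi> v\<Gamma>
    by (simp add: h_def B_def algebra_simps power_mult_distrib flip: power_mult)
  then have vI: "kirchhoff_I \<Omega> a b lam p ?v = 0" using s(3) by simp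
  have "\<not> zero_on \<Omega> ?v"
    using L2_inner_self_eq_0_iff[OF H01_L2[OF vH]] v\<phi> s0 \<phi> by simp
  then have vN: "?v \<in> nehari \<Omega> a b lam p" using vH vI by (simp add: nehari_def)
  have "well_depth \<Omega> a b lam p \<le> kirchhoff_J \<Omega> a b lam p ?v"
    by (rule well_depth_le_nehari[OF \<Omega> a b p lam vN])
  then have "(p + 1) * well_depth \<Omega> a b lam p \<le> (p + 1) * kirchhoff_J \<Omega> a b lam p ?v"
    using p by (intro mult_left_mono) auto
  also have "\<dots> = (p - 3) / 4 * a * (s\<^sup>2 * \<psi>)\<^sup>2 + (p - 1) / 2 * (s\<^sup>2 * B)"
    using kirchhoff_J_I_identity[OF \<Omega>(1) H01_H1[OF vH], of p a b lam] p vI unfolding v\<psi> v\<phi>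
    by (simp add: B_def algebra_simps)
  also have "\<dots> \<le> (p - 3) / 4 * a * \<psi>\<^sup>2 + (p - 1) / 2 * B"
  proof (intro add_mono mult_left_mono)
    \<comment> \<open>On the Nehari manifold (p + 1) J is a sum of nonnegative terms that increase
      with \<open>s\<close>, and s \<le> 1.\<close>
    have s2: "s\<^sup>2 \<le> 1" using s s0 by (simp add: power_le_one)
    then show "s\<^sup>2 * B \<le> B" using B by (simp add: mult_left_le_one_le)
    show "(s\<^sup>2 * \<psi>)\<^sup>2 \<le> \<psi>\<^sup>2" using s2 \<psi> by (intro power_mono) (auto simp: mult_left_le_one_le)
  qed (use a p in auto)
  finally show ?thesis by (simp add: B_def \<psi>_def \<phi>_def)
qed

section \<open>Contradiction for global solutions\<close>

text \<open>Each case is reduced, through \<open>finish\<close>, to a lower bound of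
  \<open>P\<close> by (p + 1) E(0) + c for all times. In two cases that bound holds only while the
  solution stays in a suitable region, whose invariance is shown by
  \<open>continuous_barrier\<close>.\<close>

lemma kirchhoff_blowup:
  fixes \<Omega> :: "'a::euclidean_space set" and lam1 h0 :: real
  assumes \<Omega>: "open \<Omega>" "bounded \<Omega>" "\<Omega> \<noteq> {}" and a: "a > 0" and b: "b > 0" and p: "p > 3"
    and sol: "kirchhoff_solution \<Omega> a b lam p u0 u1 \<infinity> u"
  defines "lam1 \<equiv> principal_eigenvalue \<Omega>" and "E0 \<equiv> kirchhoff_E0 \<Omega> a b lam p u0 u1"
    and "h0 \<equiv> (p - 1)\<^sup>2 * (lam - b * principal_eigenvalue \<Omega>)\<^sup>2 / (2 * (p - 3) * a * (principal_eigenvalue \<Omega>)\<^sup>2)"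
    and "m \<equiv> LINT x|lebesgue_on \<Omega>. u0 x * u1 x"
  assumes cases: "lam \<le> b * lam1 \<and> (E0 < 0 \<or> E0 = 0 \<and> 0 < m
      \<or> E0 < well_depth \<Omega> a b lam p \<and> 0 < m \<and> u0 \<in> W_minus \<Omega> a b lam p
      \<or> E0 > 0 \<and> 0 < m \<and> (Lnorm \<Omega> 2 u0) ^ 4 > 4 * (p + 1) / ((p - 3) * a * lam1\<^sup>2) * E0)
    \<or> lam > b * lam1 \<and> (E0 < - h0 / (2 * p + 2) \<or> E0 = - h0 / (2 * p + 2) \<and> 0 < m)"
  shows False
proof -
  have J: "time_interval \<infinity> = {0..}" by (auto simp: time_interval_def)
  have p1: "p > 1" and p0: "p > 0" using p by simp_all
  obtain ut where uH: "\<And>t. 0 \<le> t \<Longrightarrow> u t \<in> H01_space \<Omega>"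
    and utL: "\<And>t. 0 \<le> t \<Longrightarrow> ut t \<in> L2_space \<Omega>"
    and d\<phi>: "\<And>t. 0 \<le> t \<Longrightarrow> ((\<lambda>s. L2_inner \<Omega> (u s) (u s)) has_real_derivative 2 * L2_inner \<Omega> (u t) (ut t)) (at t within {0..})"
    and dg: "\<And>t. 0 \<le> t \<Longrightarrow> ((\<lambda>s. L2_inner \<Omega> (u s) (ut s)) has_real_derivative
      L2_inner \<Omega> (ut t) (ut t) - kirchhoff_I \<Omega> a b lam p (u t)) (at t within {0..})"
    and energy: "\<And>t. 0 \<le> t \<Longrightarrow> 1 / 2 * L2_inner \<Omega> (ut t) (ut t) + kirchhoff_J \<Omega> a b lam p (u t) = E0"
    and m: "L2_inner \<Omega> (u 0) (ut 0) = m"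
    and Ic: "continuous_on {0..} (\<lambda>t. kirchhoff_I \<Omega> a b lam p (u t))"
    and init: "AE x in lebesgue_on \<Omega>. u 0 x = u0 x"
    by (rule kirchhoff_scalar_identities[OF \<Omega>(1) p1 sol]) (auto simp: J E0_def m_def)
  note eig = principal_eigenvalue_characterization[OF \<Omega>, folded lam1_def]
  define \<phi> where "\<phi> t = L2_inner \<Omega> (u t) (u t)" for t
  define \<psi> where "\<psi> t = grad_inner \<Omega> (u t) (u t)" for t
  define g where "g t = L2_inner \<Omega> (u t) (ut t)" for t
  define K where "K t = L2_inner \<Omega> (ut t) (ut t)" for t
  define I where "I t = kirchhoff_I \<Omega> a b lam p (u t)" for t
  \<comment> \<open>The quantity (p + 1) J - I along the solution, in which the power integral no
    longer occurs.\<close>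
  define P where "P t = (p - 3) / 4 * a * (\<psi> t)\<^sup>2 + (p - 1) / 2 * (b * \<psi> t - lam * \<phi> t)" for t
  have d\<phi>': "(\<phi> has_real_derivative 2 * g t) (at t within {0..})" if "0 \<le> t" for t
    using d\<phi>[OF that] by (simp add: \<phi>_def[abs_def] g_def)
  have dg': "(g has_real_derivative K t - I t) (at t within {0..})" if "0 \<le> t" for t
    using dg[OF that] by (simp add: g_def[abs_def] K_def I_def)
  have nn: "0 \<le> \<phi> t" "0 \<le> K t" for t by (simp_all add: \<phi>_def K_def)
  have cs: "(g t)\<^sup>2 \<le> \<phi> t * K t" if "0 \<le> t" for t
    unfolding g_def \<phi>_def K_def by (rule L2_Cauchy_Schwarz_sq[OF H01_L2[OF uH[OF that]] utL[OF that]])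
  have g0: "g 0 = m" by (simp add: g_def m)
  have poin: "lam1 * \<phi> t \<le> \<psi> t" if "0 \<le> t" for t
    using eig(2)[OF uH[OF that]] by (simp add: \<phi>_def \<psi>_def)
  \<comment> \<open>I is eliminated in favour of (p + 1) J - P, and J in favour of the conserved
    energy; this adds (p + 1)/2 to the coefficient 1 of K.\<close>
  have key: "K t - I t = (p + 3) / 2 * K t + (P t - (p + 1) * E0)" if t: "0 \<le> t" for t
  proof -
    have "(p + 1) * kirchhoff_J \<Omega> a b lam p (u t) - I t = P t"
      using kirchhoff_J_I_identity[OF \<Omega>(1) H01_H1[OF uH[OF t]] p0] by (simp add: P_def \<psi>_def \<phi>_def I_def)
    moreover have "kirchhoff_J \<Omega> a b lam p (u t) = E0 - K t / 2"
      using energy[OF t] by (simp add: K_def)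
    ultimately show ?thesis by (simp add: algebra_simps add_divide_distrib diff_divide_distrib)
  qed
  have finish: False if "\<And>t. 0 \<le> t \<Longrightarrow> (p + 1) * E0 + c \<le> P t" "0 < c \<or> 0 \<le> c \<and> 0 < m" for c
  proof (rule blowup_criterion[OF p1 d\<phi>' dg' nn(1) nn(2) cs, where c = c])
    show "(p + 3) / 2 * K t + c \<le> K t - I t" if "0 \<le> t" for t
      using key[OF that] \<open>\<And>t. 0 \<le> t \<Longrightarrow> (p + 1) * E0 + c \<le> P t\<close>[OF that] by linarith
    show "0 < c \<or> 0 \<le> c \<and> 0 < g 0" using that(2) g0 by simp
  qed
  have g'_nn: "0 \<le> K t - I t" if "0 \<le> t" "(p + 1) * E0 \<le> P t" for t
    unfolding key[OF that(1)] using that(2) nn(2)[of t] p by (intro add_nonneg_nonneg mult_nonneg_nonneg) auto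
  have gc: "continuous_on {0..} g" by (rule DERIV_continuous_on[OF dg']) simp
  have \<phi>_ge: "\<phi> 0 \<le> \<phi> t" if "0 \<le> t" "\<And>s. 0 \<le> s \<Longrightarrow> s < t \<Longrightarrow> 0 < g s" for t
    using that by (intro nonneg_deriv_mono[OF _ _ d\<phi>']) (auto intro: less_imp_le)
  have g_ge: "g 0 \<le> g t" if "0 \<le> t" "\<And>s. 0 \<le> s \<Longrightarrow> s < t \<Longrightarrow> (p + 1) * E0 \<le> P s" for t
    by (rule nonneg_deriv_mono[OF that(1) order_refl dg']) (use that(2) in \<open>auto intro!: g'_nn simp del: diff_ge_0_iff_ge\<close>)
  consider (a) "lam \<le> b * lam1" "E0 < 0 \<or> E0 = 0 \<and> 0 < m"
    | (well) "lam \<le> b * lam1" "E0 < well_depth \<Omega> a b lam p" "0 < m" "u0 \<in> W_minus \<Omega> a b lam p"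
    | (large) "lam \<le> b * lam1" "0 < m" "(Lnorm \<Omega> 2 u0) ^ 4 > 4 * (p + 1) / ((p - 3) * a * lam1\<^sup>2) * E0"
    | (b) "lam > b * lam1" "E0 < - h0 / (2 * p + 2) \<or> E0 = - h0 / (2 * p + 2) \<and> 0 < m"
    using cases by blast
  then show False
  proof cases
    case a
    have "0 \<le> P t" if t: "0 \<le> t" for t
    proof -
      have "lam * \<phi> t \<le> b * lam1 * \<phi> t" using a nn(1) by (intro mult_right_mono) auto
      also have "\<dots> \<le> b * \<psi> t" using mult_left_mono[OF poin[OF t], of b] b by simp
      finally show ?thesis
        unfolding P_def using \<open>a > 0\<close> p by (intro add_nonneg_nonneg mult_nonneg_nonneg) auto
    qed
    then have P_nn: "(p + 1) * E0 + - ((p + 1) * E0) \<le> P t" if "0 \<le> t" for t using that by simp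
    have "0 < - ((p + 1) * E0) \<or> 0 \<le> - ((p + 1) * E0) \<and> 0 < m"
      using a(2) mult_pos_neg[of "p + 1" E0] p by auto
    from finish[of "- ((p + 1) * E0)", OF P_nn this] show False .
  next
    case well
    have P_ge: "(p + 1) * well_depth \<Omega> a b lam p \<le> P t" if "0 \<le> t" "I t < 0" for t
      using well_depth_le[OF \<Omega> \<open>a > 0\<close> \<open>b > 0\<close> p well(1)[unfolded lam1_def] uH[OF that(1)]] that(2)
      by (simp add: P_def \<psi>_def \<phi>_def I_def)
    have P_ge': "(p + 1) * E0 \<le> P t" if "0 \<le> t" "I t < 0" for t
      using P_ge[OF that] mult_left_mono[of E0 "well_depth \<Omega> a b lam p" "p + 1"] well(2) p by linarith
    have I0: "I 0 < 0"
    proof -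
      have "kirchhoff_I \<Omega> a b lam p (u 0) = kirchhoff_I \<Omega> a b lam p u0"
        by (rule kirchhoff_AE_cong(2)[OF \<Omega>(1) H01_H1[OF uH[OF order_refl]] p0 init])
      then show ?thesis using well(4) by (simp add: I_def W_minus_def nehari_minus_def)
    qed
    have \<phi>0: "0 < \<phi> 0"
    proof -
      have "0 < (g 0)\<^sup>2" using g0 well(3) by simp
      then have "\<phi> 0 \<noteq> 0" using cs[of 0] by auto
      then show ?thesis using nn(1)[of 0] by simp
    qed
    \<comment> \<open>Both signs are followed at once because each needs the other: I < 0 bounds
      \<open>P\<close> below and keeps g from decreasing, while g > 0 keeps \<phi> away from 0, so
      that a zero of I would lie on the Nehari manifold and give d \<le> J(u(t)) \<le> E(0).\<close>
    have inv: "max (I t) (- g t) < 0" if t: "0 \<le> t" for t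
    proof (rule continuous_barrier[OF _ _ _ t])
      show "continuous_on {0..} (\<lambda>t. max (I t) (- g t))"
        unfolding I_def by (intro continuous_on_max continuous_on_minus Ic gc)
      show "max (I 0) (- g 0) < 0" using I0 g0 well(3) by simp
      fix t :: real assume t: "0 < t" and before: "\<And>s. 0 \<le> s \<Longrightarrow> s < t \<Longrightarrow> max (I s) (- g s) < 0"
      have Is: "I s < 0" and gs: "0 < g s" if "0 \<le> s" "s < t" for s
        using before[OF that] by auto
      have "g 0 \<le> g t" using t by (intro g_ge P_ge' Is) auto
      then have gt: "0 < g t" using g0 well(3) by simp
      have "I t \<noteq> 0"
      proof
        assume "I t = 0"
        have "\<phi> 0 \<le> \<phi> t" using t by (intro \<phi>_ge gs) auto
        then have "\<not> zero_on \<Omega> (u t)"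
          using \<phi>0 L2_inner_self_eq_0_iff[OF H01_L2[OF uH[of t]]] t by (auto simp: \<phi>_def)
        then have N: "u t \<in> nehari \<Omega> a b lam p"
          using \<open>I t = 0\<close> uH[of t] t by (simp add: nehari_def I_def)
        have J_ge: "P s = (p + 1) * kirchhoff_J \<Omega> a b lam p (u s) - I s" if "0 \<le> s" for s
          using kirchhoff_J_I_identity[OF \<Omega>(1) H01_H1[OF uH[OF that]] p0] by (simp add: P_def \<psi>_def \<phi>_def I_def)
        have "well_depth \<Omega> a b lam p \<le> kirchhoff_J \<Omega> a b lam p (u t)"
          by (rule well_depth_le_nehari[OF \<Omega> \<open>a > 0\<close> \<open>b > 0\<close> p well(1)[unfolded lam1_def] N])
        also have "\<dots> \<le> E0"
          using energy[OF less_imp_le[OF t]] L2_inner_self_nonneg[of \<Omega> "ut t"] by linarith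
        finally show False using well(2) by simp
      qed
      then show "max (I t) (- g t) \<noteq> 0" using gt by (auto simp: max_def)
    qed
    show False
    proof (rule finish[of "(p + 1) * (well_depth \<Omega> a b lam p - E0)"])
      show "(p + 1) * E0 + (p + 1) * (well_depth \<Omega> a b lam p - E0) \<le> P t" if "0 \<le> t" for t
        using P_ge[OF that] inv[OF that] by (simp add: algebra_simps)
    qed (use well(2) p in simp)
  next
    case large
    \<comment> \<open>From \<psi> \<ge> \<lambda>_1 \<phi>, the function \<open>P\<close> dominates
      q \<phi>^2; the hypothesis on the size of \<open>u0\<close> is (p + 1) E(0) < q
      \<phi>(0)^2.\<close>
    define q where "q = (p - 3) / 4 * a * lam1\<^sup>2"
    have q: "q > 0" using p \<open>a > 0\<close> eig(1) by (simp add: q_def)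
    have P_ge: "q * (\<phi> t)\<^sup>2 \<le> P t" if t: "0 \<le> t" for t
    proof -
      have "lam * \<phi> t \<le> b * lam1 * \<phi> t" using large nn(1) by (intro mult_right_mono) auto
      also have "\<dots> \<le> b * \<psi> t" using mult_left_mono[OF poin[OF t], of b] b by simp
      finally have "0 \<le> (p - 1) / 2 * (b * \<psi> t - lam * \<phi> t)" using p by (intro mult_nonneg_nonneg) auto
      moreover have "(lam1 * \<phi> t)\<^sup>2 \<le> (\<psi> t)\<^sup>2"
        using poin[OF t] eig(1) nn(1) by (intro power_mono) auto
      then have "(p - 3) / 4 * a * (lam1 * \<phi> t)\<^sup>2 \<le> (p - 3) / 4 * a * (\<psi> t)\<^sup>2"
        using p \<open>a > 0\<close> by (intro mult_left_mono) auto
      moreover have "q * (\<phi> t)\<^sup>2 = (p - 3) / 4 * a * (lam1 * \<phi> t)\<^sup>2"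
        by (simp add: q_def power_mult_distrib)
      ultimately show ?thesis unfolding P_def by linarith
    qed
    have q0: "(p + 1) * E0 < q * (\<phi> 0)\<^sup>2"
    proof -
      have "L2_inner \<Omega> u0 u0 = \<phi> 0"
        unfolding \<phi>_def using uH[OF order_refl]
        by (intro L2_inner_AE_cong[symmetric] H01_L2 open_sets_lebesgue \<Omega>(1) init)
      then have "((Lnorm \<Omega> 2 u0)\<^sup>2)\<^sup>2 = (\<phi> 0)\<^sup>2" by (simp add: Lnorm_2_sq)
      then have "(Lnorm \<Omega> 2 u0) ^ 4 = (\<phi> 0)\<^sup>2" by (simp flip: power_mult)
      then have "4 * (p + 1) / ((p - 3) * a * lam1\<^sup>2) * E0 < (\<phi> 0)\<^sup>2" using large(3) by simp
      moreover have "4 * (p + 1) / ((p - 3) * a * lam1\<^sup>2) * E0 = (p + 1) * E0 / q"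
        using q by (simp add: q_def field_simps)
      ultimately have "(p + 1) * E0 / q < (\<phi> 0)\<^sup>2" by (simp only:)
      then show ?thesis using q by (simp add: divide_less_eq mult.commute)
    qed
    have P_ge': "(p + 1) * E0 + (q * (\<phi> 0)\<^sup>2 - (p + 1) * E0) \<le> P t" if "0 \<le> t" "\<phi> 0 \<le> \<phi> t" for t
    proof -
      have "q * (\<phi> 0)\<^sup>2 \<le> q * (\<phi> t)\<^sup>2"
        using that(2) nn(1) q by (intro mult_left_mono power_mono) auto
      then show ?thesis using P_ge[OF that(1)] by simp
    qed
    \<comment> \<open>The barrier breaks a circle: g is nondecreasing as long as \<phi> \<ge>
      \<phi>(0), and \<phi> \<ge> \<phi>(0) holds as long as g > 0.\<close>
    have inv: "- g t < 0" if t: "0 \<le> t" for t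
    proof (rule continuous_barrier[OF _ _ _ t])
      show "continuous_on {0..} (\<lambda>t. - g t)" by (intro continuous_on_minus gc)
      show "- g 0 < 0" using g0 large(2) by simp
      fix t :: real assume t: "0 < t" and before: "\<And>s. 0 \<le> s \<Longrightarrow> s < t \<Longrightarrow> - g s < 0"
      have "g 0 \<le> g t"
      proof (rule g_ge)
        fix s assume s: "0 \<le> s" "s < t"
        have "\<phi> 0 \<le> \<phi> s" using s before by (intro \<phi>_ge) auto
        then show "(p + 1) * E0 \<le> P s" using P_ge'[OF s(1)] q0 by simp
      qed (use t in simp)
      then show "- g t \<noteq> 0" using g0 large(2) by simp
    qed
    show False
    proof (rule finish[of "q * (\<phi> 0)\<^sup>2 - (p + 1) * E0"])
      show "(p + 1) * E0 + (q * (\<phi> 0)\<^sup>2 - (p + 1) * E0) \<le> P t" if "0 \<le> t" for t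
        using that inv by (intro P_ge' \<phi>_ge) auto
    qed (use q0 in simp)
  next
    case b
    \<comment> \<open>The excess of \<lambda> over b \<lambda>_1 in units of \<lambda>_1, so that
      the Poincare inequality bounds \<lambda> \<phi> by (b + \<beta>) \<psi>.\<close>
    define \<beta> where "\<beta> = (lam - b * lam1) / lam1"
    have \<beta>: "\<beta> > 0" using b(1) eig(1) by (simp add: \<beta>_def)
    have h0: "h0 = (p - 1)\<^sup>2 * \<beta>\<^sup>2 / (2 * (p - 3) * a)"
      unfolding h0_def \<beta>_def lam1_def by (simp add: power_divide field_simps)
    have P_ge: "- h0 / 2 \<le> P t" if t: "0 \<le> t" for t
    proof -
      have "(lam - b * lam1) * \<phi> t = \<beta> * (lam1 * \<phi> t)" using eig(1) by (simp add: \<beta>_def)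
      also have "\<dots> \<le> \<beta> * \<psi> t" using poin[OF t] \<beta> by (intro mult_left_mono) auto
      finally have "lam * \<phi> t \<le> b * (lam1 * \<phi> t) + \<beta> * \<psi> t" by (simp add: algebra_simps)
      also have "b * (lam1 * \<phi> t) \<le> b * \<psi> t" using poin[OF t] \<open>b > 0\<close> by (intro mult_left_mono) auto
      finally have "- (\<beta> * \<psi> t) \<le> b * \<psi> t - lam * \<phi> t" by simp
      then have "(p - 1) / 2 * (- (\<beta> * \<psi> t)) \<le> (p - 1) / 2 * (b * \<psi> t - lam * \<phi> t)"
        using p by (intro mult_left_mono) auto
      moreover have "- h0 / 2 \<le> (p - 3) / 4 * a * (\<psi> t)\<^sup>2 + (p - 1) / 2 * (- (\<beta> * \<psi> t))"
      proof -
        define A where "A = (p - 3) / 4 * a"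
        define B where "B = (p - 1) / 2 * \<beta>"
        have A: "A > 0" using p \<open>a > 0\<close> by (simp add: A_def)
        \<comment> \<open>Completing the square; the minimum -B^2/(4 A) over all \<psi> equals
          -h_0/2, which is the origin of \<open>h0\<close>.\<close>
        have "A * (\<psi> t)\<^sup>2 - B * \<psi> t + B\<^sup>2 / (4 * A) = A * (\<psi> t - B / (2 * A))\<^sup>2"
          using A by (simp add: power2_eq_square field_simps)
        moreover have "0 \<le> A * (\<psi> t - B / (2 * A))\<^sup>2" using A by simp
        moreover have "B\<^sup>2 / (4 * A) = h0 / 2"
          unfolding h0 A_def B_def using p \<open>a > 0\<close> by (simp add: power2_eq_square field_simps)
        ultimately have "- h0 / 2 \<le> A * (\<psi> t)\<^sup>2 - B * \<psi> t" by linarith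
        moreover have "(p - 1) / 2 * (- (\<beta> * \<psi> t)) = - (B * \<psi> t)" by (simp add: B_def)
        ultimately show ?thesis unfolding A_def by linarith
      qed
      ultimately show ?thesis unfolding P_def by linarith
    qed
    show False
    proof (rule finish[of "- h0 / 2 - (p + 1) * E0"])
      show "(p + 1) * E0 + (- h0 / 2 - (p + 1) * E0) \<le> P t" if "0 \<le> t" for t using P_ge[OF that] by simp
      have "2 * p + 2 \<noteq> 0" using p by simp
      \<comment> \<open>The threshold for the energy is the value at which (p + 1) E(0) meets the
        lower bound -h_0/2 of \<open>P\<close>.\<close>
      then have thr: "(p + 1) * (- h0 / (2 * p + 2)) = - h0 / 2" by (simp add: field_simps)
      show "0 < - h0 / 2 - (p + 1) * E0 \<or> 0 \<le> - h0 / 2 - (p + 1) * E0 \<and> 0 < m"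
        using b(2)
      proof
        assume "E0 < - h0 / (2 * p + 2)"
        then have "(p + 1) * E0 < (p + 1) * (- h0 / (2 * p + 2))" using p by (intro mult_strict_left_mono) auto
        then show ?thesis unfolding thr by simp
      qed (use thr in simp)
    qed
  qed
qed

section \<open>The vacuum region\<close>

lemma sobolev_const_bounds:
  assumes "u \<in> H01_space \<Omega>" "\<not> zero_on \<Omega> u"
  shows "0 \<le> sobolev_const \<Omega> q"
    and "sobolev_const \<Omega> q \<le> (Lnorm \<Omega> 2 (weak_grad \<Omega> u))\<^sup>2 / (Lnorm \<Omega> q u)\<^sup>2"
  unfolding sobolev_const_def using assms
  by (auto intro!: cINF_greatest cINF_lower bdd_belowI2[where m = 0])

text \<open>J(u(t)) \<le> 0 bounds the fourth power of the gradient norm by the power integral, and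
  the Sobolev quotient bounds that integral by the power p + 1 of the same norm. So the norm is
  either 0 or at least \<open>r\<close>, and by continuity it cannot pass from one alternative to
  the other.\<close>

lemma kirchhoff_vacuum_region:
  fixes \<Omega> :: "'a::euclidean_space set" and u :: "real \<Rightarrow> 'a \<Rightarrow> real"
  assumes \<Omega>: "open \<Omega>" "bounded \<Omega>" "\<Omega> \<noteq> {}" and a: "a > 0" and b: "b > 0" and p: "p > 3"
    and lam: "lam \<le> b * principal_eigenvalue \<Omega>"
    and u0: "u0 \<in> H01_space \<Omega>" and sol: "kirchhoff_solution \<Omega> a b lam p u0 u1 T u"
    and E0: "kirchhoff_E0 \<Omega> a b lam p u0 u1 \<le> 0" and pos: "Lnorm \<Omega> 2 (weak_grad \<Omega> u0) > 0"
    and t: "t \<in> time_interval T"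
  shows "((p + 1) / 4 * a * sobolev_const \<Omega> (p + 1) powr ((p + 1) / 2)) powr (1 / (p - 3))
    \<le> Lnorm \<Omega> 2 (weak_grad \<Omega> (u t))"
proof -
  define J where "J = time_interval T"
  have p1: "p > 1" and p0: "p > 0" using p by simp_all
  obtain ut where uH: "\<And>t. t \<in> J \<Longrightarrow> u t \<in> H01_space \<Omega>"
    and energy: "\<And>t. t \<in> J \<Longrightarrow> 1 / 2 * L2_inner \<Omega> (ut t) (ut t) + kirchhoff_J \<Omega> a b lam p (u t) = kirchhoff_E0 \<Omega> a b lam p u0 u1"
    and gc: "continuous_on J (\<lambda>t. grad_inner \<Omega> (u t) (u t))"
    and init: "AE x in lebesgue_on \<Omega>. u 0 x = u0 x"
    by (rule kirchhoff_scalar_identities[OF \<Omega>(1) p1 sol]) (auto simp: J_def)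
  note eig = principal_eigenvalue_characterization[OF \<Omega>]
  define S where "S = sobolev_const \<Omega> (p + 1)"
  define M where "M = (p + 1) / 4 * a * S powr ((p + 1) / 2)"
  define r where "r = M powr (1 / (p - 3))"
  define n where "n t = Lnorm \<Omega> 2 (weak_grad \<Omega> (u t))" for t
  have n_sq: "(n t)\<^sup>2 = grad_inner \<Omega> (u t) (u t)" if "t \<in> J" for t
    unfolding n_def by (rule Lnorm_weak_grad_sq[OF \<Omega>(1) H01_H1[OF uH[OF that]]])
  have n_nn: "0 \<le> n t" for t by (simp add: n_def)
  \<comment> \<open>Positivity of \<open>n t\<close> is essential: the final division by its fourth
    power would fail at 0.\<close>
  have dichotomy: "r \<le> n t" if t: "t \<in> J" and nt: "0 < n t" for t
  proof -
    define \<psi> where "\<psi> = grad_inner \<Omega> (u t) (u t)"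
    define \<phi> where "\<phi> = L2_inner \<Omega> (u t) (u t)"
    define q where "q = Lnorm \<Omega> (p + 1) (u t)"
    have q_nn: "0 \<le> q" by (simp add: q_def)
    have q_powr: "q powr (p + 1) = (LINT x|lebesgue_on \<Omega>. \<bar>u t x\<bar> powr (p + 1))"
      unfolding q_def using p by (intro Lnorm_powr) simp
    have "lam * \<phi> \<le> b * principal_eigenvalue \<Omega> * \<phi>" using lam by (intro mult_right_mono) (auto simp: \<phi>_def)
    also have "\<dots> \<le> b * \<psi>" using mult_left_mono[OF eig(2)[OF uH[OF t]], of b] b by (simp add: \<phi>_def \<psi>_def)
    finally have B: "0 \<le> b * \<psi> - lam * \<phi>" by simp
    have "kirchhoff_J \<Omega> a b lam p (u t) \<le> 0"
      using energy[OF t] E0 L2_inner_self_nonneg[of \<Omega> "ut t"] by linarith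
    then have "a / 4 * \<psi>\<^sup>2 \<le> 1 / (p + 1) * q powr (p + 1)"
      using kirchhoff_J_eq[OF \<Omega>(1) H01_H1[OF uH[OF t]] p0, of a b lam] B
      unfolding q_powr by (simp add: \<psi>_def \<phi>_def)
    then have le: "(p + 1) * (a / 4 * \<psi>\<^sup>2) \<le> (p + 1) * (1 / (p + 1) * q powr (p + 1))"
      using p by (intro mult_left_mono) auto
    have le: "(p + 1) / 4 * a * (n t) ^ 4 \<le> q powr (p + 1)"
    proof -
      have "n t ^ 4 = \<psi>\<^sup>2" unfolding \<psi>_def n_sq[OF t, symmetric] by (simp flip: power_mult)
      moreover have "(p + 1) * (1 / (p + 1) * q powr (p + 1)) = q powr (p + 1)" using p by simp
      ultimately show ?thesis using le by (simp add: mult.assoc)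
    qed
    have "0 < (p + 1) / 4 * a * (n t) ^ 4" using p a nt by simp
    then have q_pos: "0 < q" using le q_nn by (cases "q = 0") auto
    have nz: "\<not> zero_on \<Omega> (u t)"
      using zero_on_power_integral[OF _ H01_L2[OF uH[OF t]], of "p + 1"] q_powr q_pos by auto
    note S = sobolev_const_bounds[OF uH[OF t] nz, of "p + 1", folded S_def n_def q_def]
    have "S * q\<^sup>2 \<le> (n t)\<^sup>2" using S(2) q_pos by (simp add: le_divide_eq)
    \<comment> \<open>The Sobolev quotient compares squares; this exponent turns them into powers p
      + 1.\<close>
    then have "(S * q\<^sup>2) powr ((p + 1) / 2) \<le> ((n t)\<^sup>2) powr ((p + 1) / 2)"
      using S(1) p by (intro powr_mono2) auto
    moreover have sq: "(x\<^sup>2) powr ((p + 1) / 2) = x powr (p + 1)" if "0 < x" for x :: real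
    proof -
      have "(x\<^sup>2) powr ((p + 1) / 2) = x powr (2 * ((p + 1) / 2))"
        unfolding powr_powr[symmetric] using that by (simp add: powr_numeral)
      also have "2 * ((p + 1) / 2) = p + 1" by simp
      finally show ?thesis .
    qed
    ultimately have Sq: "S powr ((p + 1) / 2) * q powr (p + 1) \<le> n t powr (p + 1)"
      using sq[OF q_pos] sq[OF nt] S(1) by (simp add: powr_mult)
    have "M * n t ^ 4 = S powr ((p + 1) / 2) * ((p + 1) / 4 * a * n t ^ 4)" by (simp add: M_def)
    also have "\<dots> \<le> S powr ((p + 1) / 2) * q powr (p + 1)" using le by (intro mult_left_mono) auto
    also have "\<dots> \<le> n t powr (p + 1)" by (rule Sq)
    also have "\<dots> = n t powr (p - 3) * n t ^ 4"
      using powr_add[of "n t" "p - 3" 4] nt by (simp add: powr_numeral add.commute)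
    finally have "M \<le> n t powr (p - 3)" using nt by simp
    then have "r \<le> (n t powr (p - 3)) powr (1 / (p - 3))"
      unfolding r_def using p a by (intro powr_mono2) (auto simp: M_def)
    also have "\<dots> = n t" using nt p by (simp add: powr_powr)
    finally show ?thesis .
  qed
  have J0: "0 \<in> J" "{0..t} \<subseteq> J"
    using t by (auto simp: J_def time_interval_def intro: le_less_trans[of "ereal _" "ereal t"])
  have n0: "0 < n 0"
  proof -
    have "(n 0)\<^sup>2 = grad_inner \<Omega> u0 u0"
      using n_sq[OF J0(1)] grad_inner_AE_cong[OF open_sets_lebesgue[OF \<Omega>(1)] init init] by simp
    also have "\<dots> = (Lnorm \<Omega> 2 (weak_grad \<Omega> u0))\<^sup>2"
      by (rule Lnorm_weak_grad_sq[OF \<Omega>(1) H01_H1[OF u0], symmetric])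
    finally have "n 0 \<noteq> 0" using pos by auto
    then show ?thesis using n_nn[of 0] by simp
  qed
  have nc: "continuous_on J n"
  proof -
    have "continuous_on J (\<lambda>t. sqrt (grad_inner \<Omega> (u t) (u t)))" by (intro continuous_on_real_sqrt gc)
    moreover have "sqrt (grad_inner \<Omega> (u t) (u t)) = n t" if "t \<in> J" for t
      unfolding n_sq[OF that, symmetric] using n_nn[of t] by simp
    ultimately show ?thesis by (rule continuous_on_eq)
  qed
  have "r \<le> n t"
  proof (rule ccontr)
    assume "\<not> r \<le> n t"
    then have "\<not> 0 < n t" using dichotomy[of t] t by (auto simp: J_def)
    then have nt: "n t = 0" "0 < r" using \<open>\<not> r \<le> n t\<close> n_nn[of t] by linarith+
    \<comment> \<open>On the way from at least \<open>r\<close> down to 0 the norm would take the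
      value r/2, which lies in the forbidden gap.\<close>
    have "r / 2 \<le> n 0" using dichotomy[OF J0(1) n0] nt(2) by simp
    moreover have "n t \<le> r / 2" using nt by simp
    moreover have "0 \<le> t" using t by (simp add: time_interval_def)
    moreover have "continuous_on {0..t} n" by (rule continuous_on_subset[OF nc J0(2)])
    ultimately obtain s where s: "0 \<le> s" "s \<le> t" "n s = r / 2"
      using IVT2'[of n t "r / 2" 0] by blast
    have "s \<in> J" using J0(2) s(1,2) by auto
    then show False using dichotomy[of s] s(3) nt(2) by simp
  qed
  then show ?thesis by (simp add: r_def M_def S_def n_def)
qed

theorem theorem2p10:
  fixes \<Omega> :: "(real ^ 3) set" and a b lam p lam1 h0 E0 :: real
    and u0 u1 :: "real ^ 3 \<Rightarrow> real" and u :: "real \<Rightarrow> real ^ 3 \<Rightarrow> real" and Tmax :: ereal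
  assumes "open \<Omega>" "bounded \<Omega>" "\<Omega> \<noteq> {}" "smooth_boundary \<Omega>"
    and "a > 0" "b > 0" "p > 3"
    and "u0 \<in> H2_space \<Omega> \<inter> H01_space \<Omega>" "u1 \<in> H01_space \<Omega>"
    and "Tmax = kirchhoff_Tmax \<Omega> a b lam p u0 u1"
    and "kirchhoff_solution \<Omega> a b lam p u0 u1 Tmax u"
    and "lam1 = principal_eigenvalue \<Omega>"
    and "E0 = kirchhoff_E0 \<Omega> a b lam p u0 u1"
    and "h0 = (p - 1)\<^sup>2 * (lam - b * lam1)\<^sup>2 / (2 * (p - 3) * a * lam1\<^sup>2)"
  shows "((lam \<le> b * lam1 \<and>
            (E0 < 0
           \<or> E0 = 0 \<and> (LINT x|lebesgue_on \<Omega>. u0 x * u1 x) > 0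
           \<or> 3 < p \<and> p < 5 \<and> 0 < E0 \<and> E0 < well_depth \<Omega> a b lam p
               \<and> (LINT x|lebesgue_on \<Omega>. u0 x * u1 x) > 0 \<and> u0 \<in> W_minus \<Omega> a b lam p
           \<or> E0 > 0 \<and> (LINT x|lebesgue_on \<Omega>. u0 x * u1 x) > 0
               \<and> (Lnorm \<Omega> 2 u0) ^ 4 > 4 * (p + 1) / ((p - 3) * a * lam1\<^sup>2) * E0)
        \<or> lam > b * lam1 \<and>
            (E0 < - h0 / (2 * p + 2)
           \<or> E0 = - h0 / (2 * p + 2) \<and> (LINT x|lebesgue_on \<Omega>. u0 x * u1 x) > 0))
          \<longrightarrow> Tmax < \<infinity>)
      \<and> (3 < p \<and> p < 5 \<and> lam \<le> b * lam1 \<and> E0 \<le> 0 \<and> Lnorm \<Omega> 2 (weak_grad \<Omega> u0) > 0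
          \<longrightarrow> (\<forall>t\<in>time_interval Tmax. Lnorm \<Omega> 2 (weak_grad \<Omega> (u t))
                \<ge> ((p + 1) / 4 * a * sobolev_const \<Omega> (p + 1) powr ((p + 1) / 2)) powr (1 / (p - 3))))"
proof (intro conjI impI)
  note \<Omega> = assms(1-3) and ab = assms(5,6) and p = assms(7)
  assume c: "(lam \<le> b * lam1 \<and>
            (E0 < 0
           \<or> E0 = 0 \<and> (LINT x|lebesgue_on \<Omega>. u0 x * u1 x) > 0
           \<or> 3 < p \<and> p < 5 \<and> 0 < E0 \<and> E0 < well_depth \<Omega> a b lam p
               \<and> (LINT x|lebesgue_on \<Omega>. u0 x * u1 x) > 0 \<and> u0 \<in> W_minus \<Omega> a b lam p
           \<or> E0 > 0 \<and> (LINT x|lebesgue_on \<Omega>. u0 x * u1 x) > 0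
               \<and> (Lnorm \<Omega> 2 u0) ^ 4 > 4 * (p + 1) / ((p - 3) * a * lam1\<^sup>2) * E0)
        \<or> lam > b * lam1 \<and>
            (E0 < - h0 / (2 * p + 2)
           \<or> E0 = - h0 / (2 * p + 2) \<and> (LINT x|lebesgue_on \<Omega>. u0 x * u1 x) > 0))"
  show "Tmax < \<infinity>"
  proof (rule ccontr)
    \<comment> \<open>The given \<open>u\<close> solves the problem up to \<open>Tmax\<close>, so an
      infinite \<open>Tmax\<close> makes it a global solution.\<close>
    assume "\<not> Tmax < \<infinity>"
    then have "kirchhoff_solution \<Omega> a b lam p u0 u1 \<infinity> u" using assms(11) by simp
    from kirchhoff_blowup[OF \<Omega> ab p this] show False
      using c unfolding assms(12-14) by blast
  qed
next
  assume c: "3 < p \<and> p < 5 \<and> lam \<le> b * lam1 \<and> E0 \<le> 0 \<and> Lnorm \<Omega> 2 (weak_grad \<Omega> u0) > 0"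
  show "\<forall>t\<in>time_interval Tmax. Lnorm \<Omega> 2 (weak_grad \<Omega> (u t))
      \<ge> ((p + 1) / 4 * a * sobolev_const \<Omega> (p + 1) powr ((p + 1) / 2)) powr (1 / (p - 3))"
    using kirchhoff_vacuum_region[OF assms(1-3,5-7) _ IntD2[OF assms(8)] assms(11)] c
    unfolding assms(12,13) by blast
qed

end
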